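(* Let $k$ be a field of characteristic zero. The DG operad inclusion $\mathcal{C}\subset\mathcal{ECBV}_\infty$ of the commutative operad into the exact commutative $BV_\infty$ operad, given by $\mu\mapsto\mu$, is a quasi-isomorphism.
   Context: Operads are symmetric DG operads over $k$; complexes are cochain complexes. The right action of $\tau\in\mathbb{S}_n$ is normalized so that $(f\cdot\tau)(x_1,\dots,x_n)=\pm f(x_{\tau^{-1}(1)},\dots,x_{\tau^{-1}(n)})$ with Koszul sign. Products of arity $1$ elements are compositions, $[a,b]=ab-(-1)^{|a||b|}ba$. "DG operad generated by $X$" means generated by the elements of $X$ and their differentials, the differentials being free unless a relation says otherwise. $\mathcal{C}$ is the operad for (non-unital) commutative associative algebras, with trivial differential, generated by $\mu\in\mathcal{C}(2)^0$, $\mu\cdot(1\ 2)=\mu$, with $\mu\circ_1\mu=\mu\circ_2\mu$. $\mu^{(m)}$ denotes the iterated product of arity $m$, with $\mu^{(1)}$ the operadic unit. For an arity $1$ element $D$ and $n\geq1$, $\mathrm{DO}_n(D)$ denotes the relation $$\sum_{\substack{p+q=n+1\\ p\geq1}}(-1)^p\sum_{\sigma\in \mathrm{Sh}_{p,q}}\bigl(\mu^{(q+1)}\circ_1(D\circ_1\mu^{(p)})\bigr)\cdot\sigma^{-1}=0,$$ where $\mathrm{Sh}_{p,q}\subset\mathbb{S}_{n+1}$ is the set of $(p,q)$-shuffles ($\sigma(1)<\dots<\sigma(p)$, $\sigma(p+1)<\dots<\sigma(p+q)$). It says that $D$ is a differential operator of order $\leq n$. $\mathcal{ECBV}_\infty$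 is the DG operad generated by $\mu\in\mathcal{ECBV}_\infty(2)^0$ and $i_n\in\mathcal{ECBV}_\infty(1)^{-2n}$, $n\geq1$, with $\mu\cdot(1\ 2)=\mu$, subject to: $d(\mu)=0$; $\mu\circ_1\mu=\mu\circ_2\mu$; $[i_n,i_m]=0$ for $n,m\geq1$; $\sum_{j=1}^{n-1}[i_j,d(i_{n-j})]=0$ for $n\geq2$; and $\mathrm{DO}_{n+1}(i_n)$ for $n\geq1$. *)

theory Defs
  imports Complex_Main "HOL-Combinatorics.Permutations"
begin

section \<open>Symmetric DG operads\<close>

text \<open>
  A symmetric DG operad over a field is given by partial compositions. The component of arity
  \<open>n\<close> and cohomological degree \<open>p\<close> is the carrier set \<open>ocar P n p\<close>, with zero \<open>ozero P n p\<close>; only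
  homogeneous elements are represented. \<open>ocomp P x i y\<close> is the composition of \<open>y\<close> into the
  \<open>i\<close>-th input of \<open>x\<close> (inputs are numbered from 1), and \<open>oact P x \<sigma>\<close> is the right action.
\<close>

record ('a, 'k) dg_operad_data =
  ocar  :: "nat \<Rightarrow> int \<Rightarrow> 'a set"
  ozero :: "nat \<Rightarrow> int \<Rightarrow> 'a"
  oadd  :: "'a \<Rightarrow> 'a \<Rightarrow> 'a"
  osmul :: "'k \<Rightarrow> 'a \<Rightarrow> 'a"
  oone  :: 'a
  ocomp :: "'a \<Rightarrow> nat \<Rightarrow> 'a \<Rightarrow> 'a"
  oact  :: "'a \<Rightarrow> (nat \<Rightarrow> nat) \<Rightarrow> 'a"
  odif  :: "'a \<Rightarrow> 'a"

definition koszul :: "int \<Rightarrow> int \<Rightarrow> 'k::field" where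
  "koszul p q = (if odd p \<and> odd q then -1 else 1)"

text \<open>
  \<open>circ_perm n i \<sigma> \<tau>\<close> is the permutation \<open>\<rho>\<close> with
  \<open>(x\<cdot>\<sigma>) \<circ>\<^sub>i (y\<cdot>\<tau>) = (x \<circ>\<^bsub>\<sigma>(i)\<^esub> y)\<cdot>\<rho>\<close> for \<open>y\<close> of arity \<open>n\<close>. In the normalization
  \<open>(f\<cdot>\<tau>)(x\<^sub>1,\<dots>,x\<^sub>n) = \<plusminus>f(x\<^bsub>\<tau>\<^sup>-\<^sup>1(1)\<^esub>,\<dots>)\<close> the argument \<open>x\<^sub>j\<close> of \<open>f\<cdot>\<tau>\<close> is fed into input \<open>\<tau>(j)\<close>
  of \<open>f\<close>; so \<open>\<rho>(j)\<close> is the input of \<open>x \<circ>\<^bsub>\<sigma>(i)\<^esub> y\<close> that receives the \<open>j\<close>-th argument.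
\<close>

definition circ_perm ::
    "nat \<Rightarrow> nat \<Rightarrow> (nat \<Rightarrow> nat) \<Rightarrow> (nat \<Rightarrow> nat) \<Rightarrow> nat \<Rightarrow> nat" where
  "circ_perm n i \<sigma> \<tau> j =
     (if i \<le> j \<and> j < i + n then \<sigma> i - 1 + \<tau> (j - i + 1)
      else (let l = (if j < i then j else j + 1 - n)
            in if \<sigma> l < \<sigma> i then \<sigma> l else \<sigma> l + n - 1))"

locale dg_operad =
  fixes P :: "('a, 'k::field) dg_operad_data"
  assumes zero_closed: "ozero P n p \<in> ocar P n p"
    and add_closed: "\<lbrakk>x \<in> ocar P n p; y \<in> ocar P n p\<rbrakk> \<Longrightarrow> oadd P x y \<in> ocar P n p"
    and smul_closed: "x \<in> ocar P n p \<Longrightarrow> osmul P c x \<in> ocar P n p"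
    and one_closed: "oone P \<in> ocar P 1 0"
    and comp_closed: "\<lbrakk>x \<in> ocar P m p; y \<in> ocar P n q; 1 \<le> i; i \<le> m\<rbrakk>
          \<Longrightarrow> ocomp P x i y \<in> ocar P (m + n - 1) (p + q)"
    and act_closed: "\<lbrakk>x \<in> ocar P n p; \<sigma> permutes {1..n}\<rbrakk> \<Longrightarrow> oact P x \<sigma> \<in> ocar P n p"
    and dif_closed: "x \<in> ocar P n p \<Longrightarrow> odif P x \<in> ocar P n (p + 1)"
    \<comment> \<open>vector spaces\<close>
    and add_assoc: "\<lbrakk>x \<in> ocar P n p; y \<in> ocar P n p; z \<in> ocar P n p\<rbrakk>
          \<Longrightarrow> oadd P (oadd P x y) z = oadd P x (oadd P y z)"
    and add_comm: "\<lbrakk>x \<in> ocar P n p; y \<in> ocar P n p\<rbrakk> \<Longrightarrow> oadd P x y = oadd P y x"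
    and add_zero: "x \<in> ocar P n p \<Longrightarrow> oadd P x (ozero P n p) = x"
    and add_neg: "x \<in> ocar P n p \<Longrightarrow> oadd P x (osmul P (-1) x) = ozero P n p"
    and smul_add: "\<lbrakk>x \<in> ocar P n p; y \<in> ocar P n p\<rbrakk>
          \<Longrightarrow> osmul P c (oadd P x y) = oadd P (osmul P c x) (osmul P c y)"
    and add_smul: "x \<in> ocar P n p \<Longrightarrow> osmul P (b + c) x = oadd P (osmul P b x) (osmul P c x)"
    and smul_smul: "x \<in> ocar P n p \<Longrightarrow> osmul P b (osmul P c x) = osmul P (b * c) x"
    and one_smul: "x \<in> ocar P n p \<Longrightarrow> osmul P 1 x = x"
    \<comment> \<open>bilinearity of composition, linearity of the action and of the differential\<close>
    and comp_add_left: "\<lbrakk>x \<in> ocar P m p; x' \<in> ocar P m p; y \<in> ocar P n q; 1 \<le> i; i \<le> m\<rbrakk>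
          \<Longrightarrow> ocomp P (oadd P x x') i y = oadd P (ocomp P x i y) (ocomp P x' i y)"
    and comp_add_right: "\<lbrakk>x \<in> ocar P m p; y \<in> ocar P n q; y' \<in> ocar P n q; 1 \<le> i; i \<le> m\<rbrakk>
          \<Longrightarrow> ocomp P x i (oadd P y y') = oadd P (ocomp P x i y) (ocomp P x i y')"
    and comp_smul_left: "\<lbrakk>x \<in> ocar P m p; y \<in> ocar P n q; 1 \<le> i; i \<le> m\<rbrakk>
          \<Longrightarrow> ocomp P (osmul P c x) i y = osmul P c (ocomp P x i y)"
    and comp_smul_right: "\<lbrakk>x \<in> ocar P m p; y \<in> ocar P n q; 1 \<le> i; i \<le> m\<rbrakk>
          \<Longrightarrow> ocomp P x i (osmul P c y) = osmul P c (ocomp P x i y)"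
    and act_add: "\<lbrakk>x \<in> ocar P n p; y \<in> ocar P n p; \<sigma> permutes {1..n}\<rbrakk>
          \<Longrightarrow> oact P (oadd P x y) \<sigma> = oadd P (oact P x \<sigma>) (oact P y \<sigma>)"
    and act_smul: "\<lbrakk>x \<in> ocar P n p; \<sigma> permutes {1..n}\<rbrakk>
          \<Longrightarrow> oact P (osmul P c x) \<sigma> = osmul P c (oact P x \<sigma>)"
    and dif_add: "\<lbrakk>x \<in> ocar P n p; y \<in> ocar P n p\<rbrakk>
          \<Longrightarrow> odif P (oadd P x y) = oadd P (odif P x) (odif P y)"
    and dif_smul: "x \<in> ocar P n p \<Longrightarrow> odif P (osmul P c x) = osmul P c (odif P x)"
    \<comment> \<open>right action and equivariance\<close>
    and act_id: "x \<in> ocar P n p \<Longrightarrow> oact P x id = x"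
    and act_act: "\<lbrakk>x \<in> ocar P n p; \<sigma> permutes {1..n}; \<tau> permutes {1..n}\<rbrakk>
          \<Longrightarrow> oact P (oact P x \<sigma>) \<tau> = oact P x (\<sigma> \<circ> \<tau>)"
    and comp_act: "\<lbrakk>x \<in> ocar P m p; y \<in> ocar P n q; 1 \<le> i; i \<le> m;
            \<sigma> permutes {1..m}; \<tau> permutes {1..n}\<rbrakk>
          \<Longrightarrow> ocomp P (oact P x \<sigma>) i (oact P y \<tau>)
            = oact P (ocomp P x (\<sigma> i) y) (circ_perm n i \<sigma> \<tau>)"
    \<comment> \<open>unit, sequential and parallel composition\<close>
    and comp_one: "\<lbrakk>x \<in> ocar P m p; 1 \<le> i; i \<le> m\<rbrakk> \<Longrightarrow> ocomp P x i (oone P) = x"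
    and one_comp: "x \<in> ocar P n p \<Longrightarrow> ocomp P (oone P) 1 x = x"
    and comp_seq: "\<lbrakk>x \<in> ocar P l p; y \<in> ocar P m q; z \<in> ocar P n r;
            1 \<le> i; i \<le> l; 1 \<le> j; j \<le> m\<rbrakk>
          \<Longrightarrow> ocomp P (ocomp P x i y) (i + j - 1) z = ocomp P x i (ocomp P y j z)"
    and comp_par: "\<lbrakk>x \<in> ocar P l p; y \<in> ocar P m q; z \<in> ocar P n r; 1 \<le> i; i < j; j \<le> l\<rbrakk>
          \<Longrightarrow> ocomp P (ocomp P x i y) (j + m - 1) z
            = osmul P (koszul q r) (ocomp P (ocomp P x j z) i y)"
    \<comment> \<open>differential\<close>
    and dif_dif: "x \<in> ocar P n p \<Longrightarrow> odif P (odif P x) = ozero P n (p + 2)"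
    and dif_act: "\<lbrakk>x \<in> ocar P n p; \<sigma> permutes {1..n}\<rbrakk>
          \<Longrightarrow> odif P (oact P x \<sigma>) = oact P (odif P x) \<sigma>"
    and dif_comp: "\<lbrakk>x \<in> ocar P m p; y \<in> ocar P n q; 1 \<le> i; i \<le> m\<rbrakk>
          \<Longrightarrow> odif P (ocomp P x i y)
            = oadd P (ocomp P (odif P x) i y) (osmul P (koszul 1 p) (ocomp P x i (odif P y)))"

locale dg_operad_hom = P: dg_operad P + Q: dg_operad Q
  for P :: "('a, 'k::field) dg_operad_data" and Q :: "('b, 'k) dg_operad_data" +
  fixes \<phi> :: "'a \<Rightarrow> 'b"
  assumes hom_closed: "x \<in> ocar P n p \<Longrightarrow> \<phi> x \<in> ocar Q n p"
    and hom_add: "\<lbrakk>x \<in> ocar P n p; y \<in> ocar P n p\<rbrakk> \<Longrightarrow> \<phi> (oadd P x y) = oadd Q (\<phi> x) (\<phi> y)"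
    and hom_smul: "x \<in> ocar P n p \<Longrightarrow> \<phi> (osmul P c x) = osmul Q c (\<phi> x)"
    and hom_one: "\<phi> (oone P) = oone Q"
    and hom_comp: "\<lbrakk>x \<in> ocar P m p; y \<in> ocar P n q; 1 \<le> i; i \<le> m\<rbrakk>
          \<Longrightarrow> \<phi> (ocomp P x i y) = ocomp Q (\<phi> x) i (\<phi> y)"
    and hom_act: "\<lbrakk>x \<in> ocar P n p; \<sigma> permutes {1..n}\<rbrakk>
          \<Longrightarrow> \<phi> (oact P x \<sigma>) = oact Q (\<phi> x) \<sigma>"
    and hom_dif: "x \<in> ocar P n p \<Longrightarrow> \<phi> (odif P x) = odif Q (\<phi> x)"

definition cocycles :: "('a, 'k) dg_operad_data \<Rightarrow> nat \<Rightarrow> int \<Rightarrow> 'a set" where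
  "cocycles P n p = {x \<in> ocar P n p. odif P x = ozero P n (p + 1)}"

definition coboundaries :: "('a, 'k) dg_operad_data \<Rightarrow> nat \<Rightarrow> int \<Rightarrow> 'a set" where
  "coboundaries P n p = odif P ` ocar P n (p - 1)"

definition coho_class :: "('a, 'k) dg_operad_data \<Rightarrow> nat \<Rightarrow> int \<Rightarrow> 'a \<Rightarrow> 'a set" where
  "coho_class P n p z = (\<lambda>b. oadd P z b) ` coboundaries P n p"

definition cohomology :: "('a, 'k) dg_operad_data \<Rightarrow> nat \<Rightarrow> int \<Rightarrow> 'a set set" where
  "cohomology P n p = coho_class P n p ` cocycles P n p"

text \<open>The map induced by \<open>\<phi>\<close> on cohomology, \<open>[z] \<mapsto> [\<phi> z]\<close>, when \<open>\<phi>\<close> is a chain map into \<open>Q\<close>.\<close>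

definition coho_map ::
    "('b, 'k) dg_operad_data \<Rightarrow> ('a \<Rightarrow> 'b) \<Rightarrow> nat \<Rightarrow> int \<Rightarrow> 'a set \<Rightarrow> 'b set" where
  "coho_map Q \<phi> n p c = (\<Union>z\<in>c. coho_class Q n p (\<phi> z))"

definition quasi_iso ::
    "('a, 'k::field) dg_operad_data \<Rightarrow> ('b, 'k) dg_operad_data \<Rightarrow> ('a \<Rightarrow> 'b) \<Rightarrow> bool" where
  "quasi_iso P Q \<phi> \<longleftrightarrow> dg_operad_hom P Q \<phi> \<and>
     (\<forall>n p. bij_betw (coho_map Q \<phi> n p) (cohomology P n p) (cohomology Q n p))"


section \<open>DG operads given by generators and relations\<close>

text \<open>
  The DG operad presented by generators and relations is the quotient of the well-typed
  expressions in the DG operad operations by provable equality, the least congruence that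
  contains the DG operad axioms and the vanishing of the relations. As the differential \<open>Dif\<close> is
  one of the operations, the differentials of the generators are free unless a relation
  constrains them, and the congruence is closed under it.
\<close>

datatype ('g, 'k) opterm =
    Gen 'g
  | Zero nat int
  | Add "('g, 'k) opterm" "('g, 'k) opterm"
  | Smul 'k "('g, 'k) opterm"
  | Ident
  | Comp "('g, 'k) opterm" nat "('g, 'k) opterm"
  | Act "('g, 'k) opterm" "nat \<Rightarrow> nat"
  | Dif "('g, 'k) opterm"

record ('g, 'k) presentation =
  pgens :: "'g set"
  par   :: "'g \<Rightarrow> nat"
  pdeg  :: "'g \<Rightarrow> int"
  prels :: "('g, 'k) opterm set"

inductive typed :: "('g, 'k) presentation \<Rightarrow> ('g, 'k) opterm \<Rightarrow> nat \<Rightarrow> int \<Rightarrow> bool"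
  for X :: "('g, 'k) presentation" where
  typed_Gen: "g \<in> pgens X \<Longrightarrow> typed X (Gen g) (par X g) (pdeg X g)"
| typed_Zero: "typed X (Zero n p) n p"
| typed_Add: "\<lbrakk>typed X s n p; typed X t n p\<rbrakk> \<Longrightarrow> typed X (Add s t) n p"
| typed_Smul: "typed X t n p \<Longrightarrow> typed X (Smul c t) n p"
| typed_Ident: "typed X Ident 1 0"
| typed_Comp: "\<lbrakk>typed X s m p; typed X t n q; 1 \<le> i; i \<le> m\<rbrakk>
    \<Longrightarrow> typed X (Comp s i t) (m + n - 1) (p + q)"
| typed_Act: "\<lbrakk>typed X t n p; \<sigma> permutes {1..n}\<rbrakk> \<Longrightarrow> typed X (Act t \<sigma>) n p"
| typed_Dif: "typed X t n p \<Longrightarrow> typed X (Dif t) n (p + 1)"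

inductive eqv :: "('g, 'k::field) presentation \<Rightarrow> ('g, 'k) opterm \<Rightarrow> ('g, 'k) opterm \<Rightarrow> bool"
  for X :: "('g, 'k) presentation" where
  rel: "\<lbrakk>r \<in> prels X; typed X r n p\<rbrakk> \<Longrightarrow> eqv X r (Zero n p)"
| refl: "typed X t n p \<Longrightarrow> eqv X t t"
| sym: "eqv X s t \<Longrightarrow> eqv X t s"
| trans: "\<lbrakk>eqv X s t; eqv X t u\<rbrakk> \<Longrightarrow> eqv X s u"
| cong_Add: "\<lbrakk>eqv X s s'; eqv X t t'; typed X s n p; typed X t n p\<rbrakk>
    \<Longrightarrow> eqv X (Add s t) (Add s' t')"
| cong_Smul: "eqv X t t' \<Longrightarrow> eqv X (Smul c t) (Smul c t')"
| cong_Comp: "\<lbrakk>eqv X s s'; eqv X t t'; typed X s m p; 1 \<le> i; i \<le> m\<rbrakk>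
    \<Longrightarrow> eqv X (Comp s i t) (Comp s' i t')"
| cong_Act: "\<lbrakk>eqv X t t'; typed X t n p; \<sigma> permutes {1..n}\<rbrakk> \<Longrightarrow> eqv X (Act t \<sigma>) (Act t' \<sigma>)"
| cong_Dif: "eqv X t t' \<Longrightarrow> eqv X (Dif t) (Dif t')"
| Add_assoc: "\<lbrakk>typed X s n p; typed X t n p; typed X u n p\<rbrakk>
    \<Longrightarrow> eqv X (Add (Add s t) u) (Add s (Add t u))"
| Add_comm: "\<lbrakk>typed X s n p; typed X t n p\<rbrakk> \<Longrightarrow> eqv X (Add s t) (Add t s)"
| Add_Zero: "typed X t n p \<Longrightarrow> eqv X (Add t (Zero n p)) t"
| Add_neg: "typed X t n p \<Longrightarrow> eqv X (Add t (Smul (-1) t)) (Zero n p)"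
| Smul_Add: "\<lbrakk>typed X s n p; typed X t n p\<rbrakk>
    \<Longrightarrow> eqv X (Smul c (Add s t)) (Add (Smul c s) (Smul c t))"
| Add_Smul: "typed X t n p \<Longrightarrow> eqv X (Smul (b + c) t) (Add (Smul b t) (Smul c t))"
| Smul_Smul: "typed X t n p \<Longrightarrow> eqv X (Smul b (Smul c t)) (Smul (b * c) t)"
| one_Smul: "typed X t n p \<Longrightarrow> eqv X (Smul 1 t) t"
| Comp_Add_left: "\<lbrakk>typed X s m p; typed X s' m p; typed X t n q; 1 \<le> i; i \<le> m\<rbrakk>
    \<Longrightarrow> eqv X (Comp (Add s s') i t) (Add (Comp s i t) (Comp s' i t))"
| Comp_Add_right: "\<lbrakk>typed X s m p; typed X t n q; typed X t' n q; 1 \<le> i; i \<le> m\<rbrakk>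
    \<Longrightarrow> eqv X (Comp s i (Add t t')) (Add (Comp s i t) (Comp s i t'))"
| Comp_Smul_left: "\<lbrakk>typed X s m p; typed X t n q; 1 \<le> i; i \<le> m\<rbrakk>
    \<Longrightarrow> eqv X (Comp (Smul c s) i t) (Smul c (Comp s i t))"
| Comp_Smul_right: "\<lbrakk>typed X s m p; typed X t n q; 1 \<le> i; i \<le> m\<rbrakk>
    \<Longrightarrow> eqv X (Comp s i (Smul c t)) (Smul c (Comp s i t))"
| Act_Add: "\<lbrakk>typed X s n p; typed X t n p; \<sigma> permutes {1..n}\<rbrakk>
    \<Longrightarrow> eqv X (Act (Add s t) \<sigma>) (Add (Act s \<sigma>) (Act t \<sigma>))"
| Act_Smul: "\<lbrakk>typed X t n p; \<sigma> permutes {1..n}\<rbrakk>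
    \<Longrightarrow> eqv X (Act (Smul c t) \<sigma>) (Smul c (Act t \<sigma>))"
| Dif_Add: "\<lbrakk>typed X s n p; typed X t n p\<rbrakk> \<Longrightarrow> eqv X (Dif (Add s t)) (Add (Dif s) (Dif t))"
| Dif_Smul: "typed X t n p \<Longrightarrow> eqv X (Dif (Smul c t)) (Smul c (Dif t))"
| Act_id: "typed X t n p \<Longrightarrow> eqv X (Act t id) t"
| Act_Act: "\<lbrakk>typed X t n p; \<sigma> permutes {1..n}; \<tau> permutes {1..n}\<rbrakk>
    \<Longrightarrow> eqv X (Act (Act t \<sigma>) \<tau>) (Act t (\<sigma> \<circ> \<tau>))"
| Comp_Act: "\<lbrakk>typed X s m p; typed X t n q; 1 \<le> i; i \<le> m;
      \<sigma> permutes {1..m}; \<tau> permutes {1..n}\<rbrakk>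
    \<Longrightarrow> eqv X (Comp (Act s \<sigma>) i (Act t \<tau>)) (Act (Comp s (\<sigma> i) t) (circ_perm n i \<sigma> \<tau>))"
| Comp_Ident: "\<lbrakk>typed X s m p; 1 \<le> i; i \<le> m\<rbrakk> \<Longrightarrow> eqv X (Comp s i Ident) s"
| Ident_Comp: "typed X t n p \<Longrightarrow> eqv X (Comp Ident 1 t) t"
| Comp_seq: "\<lbrakk>typed X s l p; typed X t m q; typed X u n r; 1 \<le> i; i \<le> l; 1 \<le> j; j \<le> m\<rbrakk>
    \<Longrightarrow> eqv X (Comp (Comp s i t) (i + j - 1) u) (Comp s i (Comp t j u))"
| Comp_par: "\<lbrakk>typed X s l p; typed X t m q; typed X u n r; 1 \<le> i; i < j; j \<le> l\<rbrakk>
    \<Longrightarrow> eqv X (Comp (Comp s i t) (j + m - 1) u)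
              (Smul (koszul q r) (Comp (Comp s j u) i t))"
| Dif_Dif: "typed X t n p \<Longrightarrow> eqv X (Dif (Dif t)) (Zero n (p + 2))"
| Dif_Act: "\<lbrakk>typed X t n p; \<sigma> permutes {1..n}\<rbrakk> \<Longrightarrow> eqv X (Dif (Act t \<sigma>)) (Act (Dif t) \<sigma>)"
| Dif_Comp: "\<lbrakk>typed X s m p; typed X t n q; 1 \<le> i; i \<le> m\<rbrakk>
    \<Longrightarrow> eqv X (Dif (Comp s i t))
              (Add (Comp (Dif s) i t) (Smul (koszul 1 p) (Comp s i (Dif t))))"

definition opclass :: "('g, 'k::field) presentation \<Rightarrow> ('g, 'k) opterm \<Rightarrow> ('g, 'k) opterm set"
  where "opclass X t = {s. eqv X t s}"

definition presented ::
    "('g, 'k::field) presentation \<Rightarrow> (('g, 'k) opterm set, 'k) dg_operad_data" where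
  "presented X =
     \<lparr> ocar = (\<lambda>n p. opclass X ` {t. typed X t n p}),
       ozero = (\<lambda>n p. opclass X (Zero n p)),
       oadd = (\<lambda>A B. \<Union>s\<in>A. \<Union>t\<in>B. opclass X (Add s t)),
       osmul = (\<lambda>c A. \<Union>t\<in>A. opclass X (Smul c t)),
       oone = opclass X Ident,
       ocomp = (\<lambda>A i B. \<Union>s\<in>A. \<Union>t\<in>B. opclass X (Comp s i t)),
       oact = (\<lambda>A \<sigma>. \<Union>t\<in>A. opclass X (Act t \<sigma>)),
       odif = (\<lambda>A. \<Union>t\<in>A. opclass X (Dif t)) \<rparr>"


section \<open>The commutative operad and the exact commutative BV-infinity operad\<close>

definition tdiff :: "('g, 'k::field) opterm \<Rightarrow> ('g, 'k) opterm \<Rightarrow> ('g, 'k) opterm" where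
  "tdiff s t = Add s (Smul (-1) t)"

text \<open>The sum of a list of expressions of arity \<open>n\<close> and degree \<open>p\<close>.\<close>

definition tsum :: "nat \<Rightarrow> int \<Rightarrow> ('g, 'k) opterm list \<Rightarrow> ('g, 'k) opterm" where
  "tsum n p ts = foldr Add ts (Zero n p)"

text \<open>
  A sum over a finite set is written by means of an arbitrary enumeration of the set; up to
  \<open>eqv\<close> the result does not depend on it.
\<close>

definition enum_of :: "'a set \<Rightarrow> 'a list" where
  "enum_of A = (SOME xs. distinct xs \<and> set xs = A)"

text \<open>\<open>commutator p q a b\<close> is \<open>[a, b]\<close> for \<open>a\<close>, \<open>b\<close> of arity 1 and degrees \<open>p\<close>, \<open>q\<close>.\<close>

definition commutator ::
    "int \<Rightarrow> int \<Rightarrow> ('g, 'k::field) opterm \<Rightarrow> ('g, 'k) opterm \<Rightarrow> ('g, 'k) opterm" where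
  "commutator p q a b = tdiff (Comp a 1 b) (Smul (koszul p q) (Comp b 1 a))"

text \<open>The iterated product of arity \<open>m\<close>, for \<open>m \<ge> 1\<close>.\<close>

definition iter_prod :: "('g, 'k) opterm \<Rightarrow> nat \<Rightarrow> ('g, 'k) opterm" where
  "iter_prod mu m = ((\<lambda>t. Comp mu 1 t) ^^ (m - 1)) Ident"

definition shuffle_perms :: "nat \<Rightarrow> nat \<Rightarrow> (nat \<Rightarrow> nat) set" where
  "shuffle_perms p q = {\<sigma>. \<sigma> permutes {1..p + q} \<and>
     strict_mono_on {1..p} \<sigma> \<and> strict_mono_on {p + 1..p + q} \<sigma>}"

text \<open>
  The left-hand side of the relation saying that \<open>D\<close>, of arity 1 and degree \<open>e\<close>, is a
  differential operator of order at most \<open>n\<close>.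
\<close>

definition diff_op_rel ::
    "('g, 'k::field) opterm \<Rightarrow> ('g, 'k) opterm \<Rightarrow> int \<Rightarrow> nat \<Rightarrow> ('g, 'k) opterm" where
  "diff_op_rel mu D e n =
     tsum (n + 1) e (map (\<lambda>p. let q = n + 1 - p in
       Smul ((-1) ^ p)
         (tsum (n + 1) e (map (\<lambda>\<sigma>.
            Act (Comp (iter_prod mu (q + 1)) 1 (Comp D 1 (iter_prod mu p))) (inv \<sigma>))
          (enum_of (shuffle_perms p q)))))
       [1..<n + 2])"

definition com_rels :: "('g, 'k::field) opterm \<Rightarrow> ('g, 'k) opterm set" where
  "com_rels mu = {Dif mu, tdiff (Act mu (transpose 1 2)) mu,
     tdiff (Comp mu 1 mu) (Comp mu 2 mu)}"

datatype com_gen = ComMu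

datatype ecbv_gen = Mu | I nat

definition com_pres :: "(com_gen, 'k::field) presentation" where
  "com_pres = \<lparr> pgens = {ComMu}, par = (\<lambda>_. 2), pdeg = (\<lambda>_. 0), prels = com_rels (Gen ComMu) \<rparr>"

definition ecbv_pres :: "(ecbv_gen, 'k::field) presentation" where
  "ecbv_pres =
     \<lparr> pgens = insert Mu {I n |n. n \<ge> 1},
       par = (\<lambda>g. case g of Mu \<Rightarrow> 2 | I n \<Rightarrow> 1),
       pdeg = (\<lambda>g. case g of Mu \<Rightarrow> 0 | I n \<Rightarrow> - 2 * int n),
       prels = com_rels (Gen Mu)
         \<union> {commutator (- 2 * int n) (- 2 * int m) (Gen (I n)) (Gen (I m)) |n m. n \<ge> 1 \<and> m \<ge> 1}
         \<union> {tsum 1 (1 - 2 * int n)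
              (map (\<lambda>j. commutator (- 2 * int j) (1 - 2 * int (n - j))
                          (Gen (I j)) (Dif (Gen (I (n - j)))))
                 [1..<n]) |n. n \<ge> 2}
         \<union> {diff_op_rel (Gen Mu) (Gen (I n)) (- 2 * int n) (n + 1) |n. n \<ge> 1} \<rparr>"

type_synonym 'k com_operad = "((com_gen, 'k) opterm set, 'k) dg_operad_data"
type_synonym 'k ecbv_operad = "((ecbv_gen, 'k) opterm set, 'k) dg_operad_data"

definition Com :: "'k::field com_operad" where
  "Com = presented com_pres"

definition ECBV :: "'k::field ecbv_operad" where
  "ECBV = presented ecbv_pres"

definition com_mu :: "(com_gen, 'k::field) opterm set" where
  "com_mu = opclass com_pres (Gen ComMu)"

definition ecbv_mu :: "(ecbv_gen, 'k::field) opterm set" where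
  "ecbv_mu = opclass ecbv_pres (Gen Mu)"

text \<open>The map of presented operads that replaces the generator of \<open>Com\<close> by \<open>Mu\<close>.\<close>

definition com_incl ::
    "(com_gen, 'k::field) opterm set \<Rightarrow> (ecbv_gen, 'k) opterm set" where
  "com_incl A = (\<Union>t\<in>A. opclass ecbv_pres (map_opterm (\<lambda>_. Mu) id t))"


section \<open>Presented DG operads: well-definedness and universal property\<close>


section \<open>Presented DG operads: well-definedness and universal property\<close>

inductive_simps typed_simps:
  "typed X (Gen g) n p" "typed X (Zero m q) n p" "typed X (Add s t) n p"
  "typed X (Smul c t) n p" "typed X Ident n p" "typed X (Comp s i t) n p"
  "typed X (Act t \<sigma>) n p" "typed X (Dif t) n p"

lemma typed_unique: "typed X t n p \<Longrightarrow> typed X t m q \<Longrightarrow> m = n \<and> q = p"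
proof (induction t arbitrary: n p m q)
  case (Comp s i t)
  then show ?case unfolding typed_simps by metis
next
  case (Dif t)
  then show ?case unfolding typed_simps by metis
qed (auto simp: typed_simps)

lemma circ_perm_permutes:
  assumes s: "\<sigma> permutes {1..m}" and t: "\<tau> permutes {1..n}" and i: "1 \<le> i" "i \<le> m"
  shows "circ_perm n i \<sigma> \<tau> permutes {1..m + n - 1}"
proof (rule inj_imp_permutes)
  have s1: "\<sigma> l \<in> {1..m} \<longleftrightarrow> l \<in> {1..m}" for l using permutes_in_image[OF s] .
  have t1: "\<tau> l \<in> {1..n} \<longleftrightarrow> l \<in> {1..n}" for l using permutes_in_image[OF t] .
  have sinj: "\<sigma> a = \<sigma> b \<Longrightarrow> a = b" for a b using permutes_inj[OF s] by (auto dest: injD)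
  have tinj: "\<tau> a = \<tau> b \<Longrightarrow> a = b" for a b using permutes_inj[OF t] by (auto dest: injD)
  have si: "1 \<le> \<sigma> i" "\<sigma> i \<le> m" using s1[of i] i by auto
  define L where "L j = (if j < i then j else j + 1 - n)" for j
  have C: "(i \<le> j \<and> j < i + n \<and> \<tau> (j - i + 1) \<in> {1..n} \<and> circ_perm n i \<sigma> \<tau> j = \<sigma> i - 1 + \<tau> (j - i + 1))
     \<or> (\<not> (i \<le> j \<and> j < i + n) \<and> L j \<noteq> i \<and> \<sigma> (L j) < \<sigma> i \<and> circ_perm n i \<sigma> \<tau> j = \<sigma> (L j))
     \<or> (\<not> (i \<le> j \<and> j < i + n) \<and> L j \<noteq> i \<and> \<sigma> (L j) > \<sigma> i \<and> circ_perm n i \<sigma> \<tau> j = \<sigma> (L j) + n - 1)" for j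
  proof (cases "i \<le> j \<and> j < i + n")
    case True
    then show ?thesis using t1[of "j - i + 1"] by (auto simp: circ_perm_def)
  next
    case False
    then have "L j \<noteq> i" by (auto simp: L_def)
    then have "\<sigma> (L j) \<noteq> \<sigma> i" using sinj by blast
    with False \<open>L j \<noteq> i\<close> show ?thesis by (auto simp: circ_perm_def L_def Let_def)
  qed
  have Linj: "L a = L b \<Longrightarrow> \<not> (i \<le> a \<and> a < i + n) \<Longrightarrow> \<not> (i \<le> b \<and> b < i + n) \<Longrightarrow> a = b" for a b
    by (auto simp: L_def split: if_splits)
  show "inj_on (circ_perm n i \<sigma> \<tau>) {1..m + n - 1}"
  proof (rule inj_onI)
    fix a b assume e: "circ_perm n i \<sigma> \<tau> a = circ_perm n i \<sigma> \<tau> b"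
    consider "i \<le> a \<and> a < i + n" "i \<le> b \<and> b < i + n" "\<tau> (a - i + 1) = \<tau> (b - i + 1)"
      | "\<not> (i \<le> a \<and> a < i + n)" "\<not> (i \<le> b \<and> b < i + n)" "\<sigma> (L a) = \<sigma> (L b)"
    proof -
      have K: "(if i \<le> j \<and> j < i + n then \<sigma> i \<le> c \<and> c < \<sigma> i + n \<and> \<tau> (j - i + 1) + \<sigma> i = c + 1
          else if c < \<sigma> i then \<sigma> (L j) = c else \<sigma> i + n \<le> c \<and> \<sigma> (L j) + n = c + 1)"
        if "c = circ_perm n i \<sigma> \<tau> j" for c j
        using C[of j] si unfolding that[symmetric] atLeastAtMost_iff by (elim disjE conjE) auto
      from K[OF HOL.refl, of a] K[OF e] that show thesis
        by (auto split: if_splits)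
    qed
    then show "a = b"
    proof cases
      case 1
      then show ?thesis using tinj[of "a - i + 1" "b - i + 1"] by auto
    qed (use Linj sinj in blast)
  qed
  show "circ_perm n i \<sigma> \<tau> j \<in> {1..m + n - 1}" if j: "j \<in> {1..m + n - 1}" for j
  proof -
    have "\<not> (i \<le> j \<and> j < i + n) \<Longrightarrow> L j \<in> {1..m}" using j i by (auto simp: L_def)
    then have "\<not> (i \<le> j \<and> j < i + n) \<Longrightarrow> \<sigma> (L j) \<in> {1..m}" using s1 by blast
    with C[of j] si i show ?thesis by auto
  qed
  show "circ_perm n i \<sigma> \<tau> j = j" if j: "j \<notin> {1..m + n - 1}" for j
  proof (cases "j = 0")
    case True
    then show ?thesis using i si permutes_not_in[OF s, of 0] by (auto simp: circ_perm_def)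
  next
    case False
    then have "L j = j + 1 - n" "L j > m" "\<not> (i \<le> j \<and> j < i + n)" "j \<ge> n" using j i by (auto simp: L_def)
    moreover from this have "\<sigma> (L j) = L j" using permutes_not_in[OF s] by auto
    ultimately show ?thesis using C[of j] si by auto
  qed
qed simp

lemma typed_CompI:
  "\<lbrakk>typed X s m p; typed X t n q; 1 \<le> i; i \<le> m; k = m + n - 1; r = p + q\<rbrakk>
    \<Longrightarrow> typed X (Comp s i t) k r"
  by (metis typed_Comp)

lemma eqv_typed: "eqv X s t \<Longrightarrow> \<exists>n p. typed X s n p \<and> typed X t n p"
proof (induction rule: eqv.induct)
  case (trans s t u)
  then show ?case using typed_unique by metis
next
  case (cong_Add s s' t t' n p)
  then show ?case using typed_unique by (metis typed_Add)
next
  case (cong_Comp s s' t t' m p i)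
  then show ?case using typed_unique by (metis typed_Comp)
next
  case (cong_Act t t' n p \<sigma>)
  then show ?case using typed_unique by (metis typed_Act)
next
  case (Comp_Act s m p t n q i \<sigma> \<tau>)
  then have "1 \<le> \<sigma> i" "\<sigma> i \<le> m" using permutes_in_image[of \<sigma> "{1..m}" i] by auto
  then show ?case using Comp_Act circ_perm_permutes typed_Comp typed_Act by metis
next
  case (Comp_Ident s m p i)
  then have "typed X (Comp s i Ident) (m + 1 - 1) (p + 0)" by (intro typed_Comp typed_Ident) auto
  then show ?case using Comp_Ident by auto
next
  case (Ident_Comp t n p)
  then have "typed X (Comp Ident 1 t) (1 + n - 1) (0 + p)" by (intro typed_Comp typed_Ident) auto
  then show ?case using Ident_Comp by auto
next
  case (Comp_seq s l p t m q u n r i j)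
  then have "typed X (Comp (Comp s i t) (i + j - 1) u) (l + m + n - 2) (p + q + r)"
    by (intro typed_CompI[where m="l + m - 1" and n=n and p="p + q" and q=r]
        typed_CompI[where m=l and n=m and p=p and q=q]) auto
  moreover have "typed X (Comp s i (Comp t j u)) (l + m + n - 2) (p + q + r)"
    using Comp_seq
    by (intro typed_CompI[where m=l and n="m + n - 1" and p=p and q="q + r"]
        typed_CompI[where m=m and n=n and p=q and q=r]) auto
  ultimately show ?case by blast
next
  case (Comp_par s l p t m q u n r i j)
  then have "typed X (Comp (Comp s i t) (j + m - 1) u) (l + m + n - 2) (p + q + r)"
    by (intro typed_CompI[where m="l + m - 1" and n=n and p="p + q" and q=r]
        typed_CompI[where m=l and n=m and p=p and q=q]) auto
  moreover have "typed X (Smul (koszul q r) (Comp (Comp s j u) i t)) (l + m + n - 2) (p + q + r)"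
    using Comp_par
    by (intro typed_Smul typed_CompI[where m="l + n - 1" and n=m and p="p + r" and q=q]
        typed_CompI[where m=l and n=n and p=p and q=r]) auto
  ultimately show ?case by blast
next
  case (Dif_Dif t n p)
  then have "typed X (Dif (Dif t)) n (p + 1 + 1)" by (intro typed_Dif)
  then show ?case using typed_Zero by (metis add.assoc one_add_one)
next
  case (Dif_Comp s m p t n q i)
  then have "typed X (Dif (Comp s i t)) (m + n - 1) (p + q + 1)"
    by (intro typed_Dif typed_Comp)
  moreover have "typed X (Comp (Dif s) i t) (m + n - 1) (p + q + 1)"
    using Dif_Comp by (intro typed_CompI[where m=m and n=n and p="p + 1" and q=q] typed_Dif) auto
  moreover have "typed X (Smul (koszul 1 p) (Comp s i (Dif t))) (m + n - 1) (p + q + 1)"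
    using Dif_Comp
    by (intro typed_Smul typed_CompI[where m=m and n=n and p=p and q="q + 1"] typed_Dif) auto
  ultimately show ?case by (blast intro: typed_Add)
next
  case (Act_Act t n p \<sigma> \<tau>)
  then have "\<sigma> \<circ> \<tau> permutes {1..n}" by (simp add: permutes_compose)
  then show ?case using Act_Act by (blast intro: typed_Act)
next
  case (Act_id t n p)
  then show ?case using permutes_id by (blast intro: typed_Act)
qed (blast intro: typed.intros)+

lemma eqv_typed_iff: "eqv X s t \<Longrightarrow> typed X s n p \<longleftrightarrow> typed X t n p"
  using eqv_typed typed_unique by metis

lemma opclass_eq: "typed X t n p \<Longrightarrow> opclass X s = opclass X t \<longleftrightarrow> eqv X s t"
  unfolding opclass_def by (auto intro: eqv.refl eqv.sym eqv.trans)

lemma opclass_eqI: "eqv X s t \<Longrightarrow> opclass X s = opclass X t"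
  unfolding opclass_def by (auto intro: eqv.sym eqv.trans)

lemma UN_opclass:
  assumes "typed X t n p" and "\<And>t'. eqv X t t' \<Longrightarrow> eqv X (F t) (F t')"
  shows "(\<Union>t'\<in>opclass X t. opclass X (F t')) = opclass X (F t)"
proof -
  have "t \<in> opclass X t" using assms(1) by (simp add: opclass_def eqv.refl)
  moreover have "opclass X (F t') = opclass X (F t)" if "t' \<in> opclass X t" for t'
    using assms(2) that opclass_eqI unfolding opclass_def by blast
  ultimately show ?thesis by blast
qed

lemma presented_ops:
  "ocar (presented X) n p = opclass X ` {t. typed X t n p}"
  "ozero (presented X) n p = opclass X (Zero n p)"
  "oone (presented X) = opclass X Ident"
  "typed X s n p \<Longrightarrow> typed X t n p
    \<Longrightarrow> oadd (presented X) (opclass X s) (opclass X t) = opclass X (Add s t)"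
  "typed X t n p \<Longrightarrow> osmul (presented X) c (opclass X t) = opclass X (Smul c t)"
  "typed X s m p \<Longrightarrow> typed X t n q \<Longrightarrow> 1 \<le> i \<Longrightarrow> i \<le> m
    \<Longrightarrow> ocomp (presented X) (opclass X s) i (opclass X t) = opclass X (Comp s i t)"
  "typed X t n p \<Longrightarrow> \<sigma> permutes {1..n}
    \<Longrightarrow> oact (presented X) (opclass X t) \<sigma> = opclass X (Act t \<sigma>)"
  "typed X t n p \<Longrightarrow> odif (presented X) (opclass X t) = opclass X (Dif t)"
proof -
  show "oadd (presented X) (opclass X s) (opclass X t) = opclass X (Add s t)"
    if s: "typed X s n p" and t: "typed X t n p"
  proof -
    have "(\<Union>t'\<in>opclass X t. opclass X (Add s' t')) = opclass X (Add s' t)" if "s' \<in> opclass X s" for s'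
      using that s t eqv_typed_iff[of X s s'] unfolding opclass_def[of X s]
      by (intro UN_opclass[OF t] eqv.cong_Add[where n=n and p=p]) (auto intro: eqv.refl)
    then have "oadd (presented X) (opclass X s) (opclass X t) = (\<Union>s'\<in>opclass X s. opclass X (Add s' t))"
      by (simp add: presented_def)
    also have "\<dots> = opclass X (Add s t)"
      using s t by (intro UN_opclass[OF s] eqv.cong_Add[where n=n and p=p]) (auto intro: eqv.refl)
    finally show ?thesis .
  qed
  show "ocomp (presented X) (opclass X s) i (opclass X t) = opclass X (Comp s i t)"
    if s: "typed X s m p" and t: "typed X t n q" and i: "1 \<le> i" "i \<le> m"
  proof -
    have "(\<Union>t'\<in>opclass X t. opclass X (Comp s' i t')) = opclass X (Comp s' i t)" if "s' \<in> opclass X s" for s'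
      using that s t i eqv_typed_iff[of X s s'] unfolding opclass_def[of X s]
      by (intro UN_opclass[OF t] eqv.cong_Comp[where m=m and p=p]) (auto intro: eqv.refl)
    then have "ocomp (presented X) (opclass X s) i (opclass X t) = (\<Union>s'\<in>opclass X s. opclass X (Comp s' i t))"
      by (simp add: presented_def)
    also have "\<dots> = opclass X (Comp s i t)"
      using s t i by (intro UN_opclass[OF s] eqv.cong_Comp[where m=m and p=p]) (auto intro: eqv.refl)
    finally show ?thesis .
  qed
qed (auto simp: presented_def intro!: UN_opclass eqv.cong_Smul eqv.cong_Act eqv.cong_Dif)

lemma presented_dg_operad: "dg_operad (presented X)"
proof -
  define wt where "wt t \<longleftrightarrow> (\<exists>n p. typed X t n p)" for t
  define same where "same s t \<longleftrightarrow> (\<exists>n p. typed X s n p \<and> typed X t n p)" for s t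
  define cok where "cok s i \<longleftrightarrow> (\<exists>m p. typed X s m p \<and> 1 \<le> i \<and> i \<le> m)" for s i
  define aok where "aok t \<sigma> \<longleftrightarrow> (\<exists>n p. typed X t n p \<and> \<sigma> permutes {1..n})" for t \<sigma>
  have wt_simps:
    "wt (Add s t) \<longleftrightarrow> wt s \<and> wt t \<and> same s t" "wt (Smul c t) \<longleftrightarrow> wt t"
    "wt (Comp s i t) \<longleftrightarrow> wt s \<and> wt t \<and> cok s i" "wt (Act t \<sigma>) \<longleftrightarrow> wt t \<and> aok t \<sigma>"
    "wt (Dif t) \<longleftrightarrow> wt t" for s t c i \<sigma>
    by (auto simp: wt_def same_def cok_def aok_def typed_simps)
  have ops:
    "same s t \<Longrightarrow> oadd (presented X) (opclass X s) (opclass X t) = opclass X (Add s t)"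
    "wt t \<Longrightarrow> osmul (presented X) c (opclass X t) = opclass X (Smul c t)"
    "cok s i \<Longrightarrow> wt t \<Longrightarrow> ocomp (presented X) (opclass X s) i (opclass X t) = opclass X (Comp s i t)"
    "aok t \<sigma> \<Longrightarrow> oact (presented X) (opclass X t) \<sigma> = opclass X (Act t \<sigma>)"
    "wt t \<Longrightarrow> odif (presented X) (opclass X t) = opclass X (Dif t)" for s t c i \<sigma>
    unfolding wt_def same_def cok_def aok_def by (elim exE conjE; rule presented_ops; assumption)+
  have E: "wt s \<and> wt t \<and> opclass X s = opclass X t" if "eqv X s t" for s t
    using eqv_typed[OF that] opclass_eqI[OF that] unfolding wt_def by blast
  have carI: "x \<in> ocar (presented X) n p" if "typed X t n p" "x = opclass X t" for x t n p
    using that by (simp add: presented_ops(1))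
  note S = wt_simps ops presented_ops(1-3)
  show ?thesis
  proof (standard, goal_cases)
    case 1 show ?case by (rule carI[OF typed_Zero presented_ops(2)])
  next
    case (2 x n p y)
    then obtain s t where r: "typed X s n p" "typed X t n p" and "x = opclass X s" "y = opclass X t"
      by (auto simp: presented_ops(1))
    then show ?case using carI[OF typed_Add[OF r] presented_ops(4)[OF r]] by simp
  next
    case (3 x n p c)
    then obtain t where r: "typed X t n p" and "x = opclass X t" by (auto simp: presented_ops(1))
    then show ?case using carI[OF typed_Smul[OF r] presented_ops(5)[OF r]] by simp
  next
    case 4 show ?case by (rule carI[OF typed_Ident presented_ops(3)])
  next
    case (5 x m p y n q i)
    then obtain s t where r: "typed X s m p" "typed X t n q" and "x = opclass X s" "y = opclass X t"
      by (auto simp: presented_ops(1))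
    then show ?case using carI[OF typed_Comp[OF r 5(3,4)] presented_ops(6)[OF r 5(3,4)]] by simp
  next
    case (6 x n p \<sigma>)
    then obtain t where r: "typed X t n p" and "x = opclass X t" by (auto simp: presented_ops(1))
    then show ?case using carI[OF typed_Act[OF r 6(2)] presented_ops(7)[OF r 6(2)]] by simp
  next
    case (7 x n p)
    then obtain t where r: "typed X t n p" and "x = opclass X t" by (auto simp: presented_ops(1))
    then show ?case using carI[OF typed_Dif[OF r] presented_ops(8)[OF r]] by simp
  next
    case (8 x n p y z)
    then obtain s t u where r: "typed X s n p" "typed X t n p" "typed X u n p"
      and [simp]: "x = opclass X s" "y = opclass X t" "z = opclass X u" by (auto simp: presented_ops(1))
    show ?case using E[OF eqv.Add_assoc[OF r]] by (simp add: S)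
  next
    case (9 x n p y)
    then obtain s t where r: "typed X s n p" "typed X t n p"
      and [simp]: "x = opclass X s" "y = opclass X t" by (auto simp: presented_ops(1))
    show ?case using E[OF eqv.Add_comm[OF r]] by (simp add: S)
  next
    case (10 x n p)
    then obtain s where r: "typed X s n p"
      and [simp]: "x = opclass X s" by (auto simp: presented_ops(1))
    show ?case using E[OF eqv.Add_Zero[OF r]] by (simp add: S)
  next
    case (11 x n p)
    then obtain s where r: "typed X s n p"
      and [simp]: "x = opclass X s" by (auto simp: presented_ops(1))
    show ?case using E[OF eqv.Add_neg[OF r]] by (simp add: S)
  next
    case (12 x n p y c)
    then obtain s t where r: "typed X s n p" "typed X t n p"
      and [simp]: "x = opclass X s" "y = opclass X t" by (auto simp: presented_ops(1))
    show ?case using E[OF eqv.Smul_Add[where c=c, OF r]] by (simp add: S)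
  next
    case (13 x n p b c)
    then obtain s where r: "typed X s n p"
      and [simp]: "x = opclass X s" by (auto simp: presented_ops(1))
    show ?case using E[OF eqv.Add_Smul[where b=b and c=c, OF r]] by (simp add: S)
  next
    case (14 x n p b c)
    then obtain s where r: "typed X s n p"
      and [simp]: "x = opclass X s" by (auto simp: presented_ops(1))
    show ?case using E[OF eqv.Smul_Smul[where b=b and c=c, OF r]] by (simp add: S)
  next
    case (15 x n p)
    then obtain s where r: "typed X s n p"
      and [simp]: "x = opclass X s" by (auto simp: presented_ops(1))
    show ?case using E[OF eqv.one_Smul[OF r]] by (simp add: S)
  next
    case (16 x m p x' y n q i)
    then obtain s s' t where r: "typed X s m p" "typed X s' m p" "typed X t n q"
      and [simp]: "x = opclass X s" "x' = opclass X s'" "y = opclass X t" by (auto simp: presented_ops(1))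
    show ?case using E[OF eqv.Comp_Add_left[OF r 16(4,5)]] by (simp add: S)
  next
    case (17 x m p y n q y' i)
    then obtain s t t' where r: "typed X s m p" "typed X t n q" "typed X t' n q"
      and [simp]: "x = opclass X s" "y = opclass X t" "y' = opclass X t'" by (auto simp: presented_ops(1))
    show ?case using E[OF eqv.Comp_Add_right[OF r 17(4,5)]] by (simp add: S)
  next
    case (18 x m p y n q i c)
    then obtain s t where r: "typed X s m p" "typed X t n q"
      and [simp]: "x = opclass X s" "y = opclass X t" by (auto simp: presented_ops(1))
    show ?case using E[OF eqv.Comp_Smul_left[where c=c, OF r 18(3,4)]] by (simp add: S)
  next
    case (19 x m p y n q i c)
    then obtain s t where r: "typed X s m p" "typed X t n q"
      and [simp]: "x = opclass X s" "y = opclass X t" by (auto simp: presented_ops(1))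
    show ?case using E[OF eqv.Comp_Smul_right[where c=c, OF r 19(3,4)]] by (simp add: S)
  next
    case (20 x n p y \<sigma>)
    then obtain s t where r: "typed X s n p" "typed X t n p"
      and [simp]: "x = opclass X s" "y = opclass X t" by (auto simp: presented_ops(1))
    show ?case using E[OF eqv.Act_Add[OF r 20(3)]] by (simp add: S)
  next
    case (21 x n p \<sigma> c)
    then obtain s where r: "typed X s n p"
      and [simp]: "x = opclass X s" by (auto simp: presented_ops(1))
    show ?case using E[OF eqv.Act_Smul[where c=c, OF r 21(2)]] by (simp add: S)
  next
    case (22 x n p y)
    then obtain s t where r: "typed X s n p" "typed X t n p"
      and [simp]: "x = opclass X s" "y = opclass X t" by (auto simp: presented_ops(1))
    show ?case using E[OF eqv.Dif_Add[OF r]] by (simp add: S)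
  next
    case (23 x n p c)
    then obtain s where r: "typed X s n p"
      and [simp]: "x = opclass X s" by (auto simp: presented_ops(1))
    show ?case using E[OF eqv.Dif_Smul[where c=c, OF r]] by (simp add: S)
  next
    case (24 x n p)
    then obtain s where r: "typed X s n p"
      and [simp]: "x = opclass X s" by (auto simp: presented_ops(1))
    show ?case using E[OF eqv.Act_id[OF r]] by (simp add: S)
  next
    case (25 x n p \<sigma> \<tau>)
    then obtain s where r: "typed X s n p"
      and [simp]: "x = opclass X s" by (auto simp: presented_ops(1))
    show ?case using E[OF eqv.Act_Act[OF r 25(2,3)]] by (simp add: S)
  next
    case (26 x m p y n q i \<sigma> \<tau>)
    then obtain s t where r: "typed X s m p" "typed X t n q"
      and [simp]: "x = opclass X s" "y = opclass X t" by (auto simp: presented_ops(1))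
    show ?case using E[OF eqv.Comp_Act[OF r 26(3,4,5,6)]] by (simp add: S)
  next
    case (27 x m p i)
    then obtain s where r: "typed X s m p"
      and [simp]: "x = opclass X s" by (auto simp: presented_ops(1))
    show ?case using E[OF eqv.Comp_Ident[OF r 27(2,3)]] by (simp add: S)
  next
    case (28 x n p)
    then obtain s where r: "typed X s n p"
      and [simp]: "x = opclass X s" by (auto simp: presented_ops(1))
    show ?case using E[OF eqv.Ident_Comp[OF r]] by (simp add: S)
  next
    case (29 x l p y m q z n r i j)
    then obtain s t u where r: "typed X s l p" "typed X t m q" "typed X u n r"
      and [simp]: "x = opclass X s" "y = opclass X t" "z = opclass X u" by (auto simp: presented_ops(1))
    show ?case using E[OF eqv.Comp_seq[OF r 29(4,5,6,7)]] by (simp add: S)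
  next
    case (30 x l p y m q z n r i j)
    then obtain s t u where r: "typed X s l p" "typed X t m q" "typed X u n r"
      and [simp]: "x = opclass X s" "y = opclass X t" "z = opclass X u" by (auto simp: presented_ops(1))
    show ?case using E[OF eqv.Comp_par[OF r 30(4,5,6)]] by (simp add: S)
  next
    case (31 x n p)
    then obtain s where r: "typed X s n p"
      and [simp]: "x = opclass X s" by (auto simp: presented_ops(1))
    show ?case using E[OF eqv.Dif_Dif[OF r]] by (simp add: S)
  next
    case (32 x n p \<sigma>)
    then obtain s where r: "typed X s n p"
      and [simp]: "x = opclass X s" by (auto simp: presented_ops(1))
    show ?case using E[OF eqv.Dif_Act[OF r 32(2)]] by (simp add: S)
  next
    case (33 x m p y n q i)
    then obtain s t where r: "typed X s m p" "typed X t n q"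
      and [simp]: "x = opclass X s" "y = opclass X t" by (auto simp: presented_ops(1))
    show ?case using E[OF eqv.Dif_Comp[OF r 33(3,4)]] by (simp add: S)
  qed
qed

primrec opeval :: "('a, 'k) dg_operad_data \<Rightarrow> ('g \<Rightarrow> 'a) \<Rightarrow> ('g, 'k) opterm \<Rightarrow> 'a" where
  "opeval P \<gamma> (Gen g) = \<gamma> g"
| "opeval P \<gamma> (Zero n p) = ozero P n p"
| "opeval P \<gamma> (Add s t) = oadd P (opeval P \<gamma> s) (opeval P \<gamma> t)"
| "opeval P \<gamma> (Smul c t) = osmul P c (opeval P \<gamma> t)"
| "opeval P \<gamma> Ident = oone P"
| "opeval P \<gamma> (Comp s i t) = ocomp P (opeval P \<gamma> s) i (opeval P \<gamma> t)"
| "opeval P \<gamma> (Act t \<sigma>) = oact P (opeval P \<gamma> t) \<sigma>"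
| "opeval P \<gamma> (Dif t) = odif P (opeval P \<gamma> t)"

lemma (in dg_operad) opeval_closed:
  assumes gens: "\<And>g. g \<in> pgens X \<Longrightarrow> \<gamma> g \<in> ocar P (par X g) (pdeg X g)"
  shows "typed X t n p \<Longrightarrow> opeval P \<gamma> t \<in> ocar P n p"
  by (induction rule: typed.induct)
    (simp_all add: gens zero_closed add_closed smul_closed one_closed[simplified]
      comp_closed[simplified] act_closed[simplified] dif_closed)

lemma (in dg_operad) opeval_eqv:
  assumes gens: "\<And>g. g \<in> pgens X \<Longrightarrow> \<gamma> g \<in> ocar P (par X g) (pdeg X g)"
    and rels: "\<And>r n p. \<lbrakk>r \<in> prels X; typed X r n p\<rbrakk> \<Longrightarrow> opeval P \<gamma> r = ozero P n p"
  shows "eqv X s t \<Longrightarrow> opeval P \<gamma> s = opeval P \<gamma> t"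
proof -
  note C = opeval_closed[where X=X and \<gamma>=\<gamma>, OF gens]
  show "eqv X s t \<Longrightarrow> opeval P \<gamma> s = opeval P \<gamma> t"
  proof (induction rule: eqv.induct)
    case (rel r n p)
    then show ?case by (simp add: rels)
  next
    case Add_assoc
    then show ?case unfolding opeval.simps by (intro add_assoc C)
  next
    case Add_comm
    then show ?case unfolding opeval.simps by (intro add_comm C)
  next
    case Add_Zero
    then show ?case unfolding opeval.simps by (intro add_zero C)
  next
    case Add_neg
    then show ?case unfolding opeval.simps by (intro add_neg C)
  next
    case Smul_Add
    then show ?case unfolding opeval.simps by (intro smul_add C)
  next
    case Add_Smul
    then show ?case unfolding opeval.simps by (intro add_smul C)
  next
    case Smul_Smul
    then show ?case unfolding opeval.simps by (intro smul_smul C)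
  next
    case one_Smul
    then show ?case unfolding opeval.simps by (intro one_smul C)
  next
    case Comp_Add_left
    then show ?case unfolding opeval.simps by (intro comp_add_left C)
  next
    case Comp_Add_right
    then show ?case unfolding opeval.simps by (intro comp_add_right C)
  next
    case Comp_Smul_left
    then show ?case unfolding opeval.simps by (intro comp_smul_left C)
  next
    case Comp_Smul_right
    then show ?case unfolding opeval.simps by (intro comp_smul_right C)
  next
    case Act_Add
    then show ?case unfolding opeval.simps by (intro act_add C)
  next
    case Act_Smul
    then show ?case unfolding opeval.simps by (intro act_smul C)
  next
    case Dif_Add
    then show ?case unfolding opeval.simps by (intro dif_add C)
  next
    case Dif_Smul
    then show ?case unfolding opeval.simps by (intro dif_smul C)
  next
    case Act_id
    then show ?case unfolding opeval.simps by (intro act_id C)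
  next
    case Act_Act
    then show ?case unfolding opeval.simps by (intro act_act C)
  next
    case Comp_Act
    then show ?case unfolding opeval.simps by (intro comp_act C)
  next
    case Comp_Ident
    then show ?case unfolding opeval.simps by (intro comp_one C)
  next
    case Ident_Comp
    then show ?case unfolding opeval.simps by (intro one_comp C)
  next
    case Comp_seq
    then show ?case unfolding opeval.simps by (intro comp_seq C)
  next
    case Comp_par
    then show ?case unfolding opeval.simps by (intro comp_par C)
  next
    case Dif_Dif
    then show ?case unfolding opeval.simps by (intro dif_dif C)
  next
    case Dif_Act
    then show ?case unfolding opeval.simps by (intro dif_act C)
  next
    case Dif_Comp
    then show ?case unfolding opeval.simps by (intro dif_comp C)
  qed simp_all
qed

text \<open>
  Every assignment of the generators to elements of a DG operad \<open>Q\<close> that satisfies the relations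
  extends uniquely to a morphism.
\<close>

theorem presented_universal:
  fixes X :: "('g, 'k::field) presentation" and Q :: "('a, 'k) dg_operad_data"
  assumes Q: "dg_operad Q"
    and gens: "\<And>g. g \<in> pgens X \<Longrightarrow> \<gamma> g \<in> ocar Q (par X g) (pdeg X g)"
    and rels: "\<And>r n p. \<lbrakk>r \<in> prels X; typed X r n p\<rbrakk> \<Longrightarrow> opeval Q \<gamma> r = ozero Q n p"
  shows "\<exists>\<phi>. dg_operad_hom (presented X) Q \<phi> \<and> (\<forall>g\<in>pgens X. \<phi> (opclass X (Gen g)) = \<gamma> g) \<and>
    (\<forall>\<psi>. dg_operad_hom (presented X) Q \<psi> \<and> (\<forall>g\<in>pgens X. \<psi> (opclass X (Gen g)) = \<gamma> g)
       \<longrightarrow> (\<forall>n p. \<forall>x\<in>ocar (presented X) n p. \<psi> x = \<phi> x))"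
proof -
  interpret Q: dg_operad Q by (rule Q)
  define \<phi> where "\<phi> A = opeval Q \<gamma> (SOME t. t \<in> A)" for A
  have \<phi>: "\<phi> (opclass X t) = opeval Q \<gamma> t" if "typed X t n p" for t n p
  proof -
    have "t \<in> opclass X t" using that by (simp add: opclass_def eqv.refl)
    then have "(SOME s. s \<in> opclass X t) \<in> opclass X t" by (rule someI)
    then have "eqv X t (SOME s. s \<in> opclass X t)" by (simp add: opclass_def)
    then show ?thesis unfolding \<phi>_def using Q.opeval_eqv[OF gens rels] by metis
  qed
  note O = presented_ops(4-8)
  have hom: "dg_operad_hom (presented X) Q \<phi>"
  proof (intro dg_operad_hom.intro dg_operad_hom_axioms.intro presented_dg_operad Q, goal_cases)
    case (1 x n p)
    then show ?case using Q.opeval_closed[OF gens] \<phi> unfolding presented_ops by force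
  next
    case (2 x n p y)
    then obtain s t where r: "typed X s n p" "typed X t n p" and "x = opclass X s" "y = opclass X t"
      by (auto simp: presented_ops(1))
    then show ?case by (simp add: O(1)[OF r] \<phi>[OF typed_Add[OF r]] \<phi>[OF r(1)] \<phi>[OF r(2)])
  next
    case (3 x n p c)
    then obtain t where r: "typed X t n p" and "x = opclass X t" by (auto simp: presented_ops(1))
    then show ?case by (simp add: O(2)[OF r] \<phi>[OF typed_Smul[OF r]] \<phi>[OF r])
  next
    case 4 show ?case by (simp add: presented_ops(3) \<phi>[OF typed_Ident])
  next
    case (5 x m p y n q i)
    then obtain s t where r: "typed X s m p" "typed X t n q" and "x = opclass X s" "y = opclass X t"
      by (auto simp: presented_ops(1))
    then show ?case
      by (simp add: O(3)[OF r 5(3,4)] \<phi>[OF typed_Comp[OF r 5(3,4)]] \<phi>[OF r(1)] \<phi>[OF r(2)])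
  next
    case (6 x n p \<sigma>)
    then obtain t where r: "typed X t n p" and "x = opclass X t" by (auto simp: presented_ops(1))
    then show ?case by (simp add: O(4)[OF r 6(2)] \<phi>[OF typed_Act[OF r 6(2)]] \<phi>[OF r])
  next
    case (7 x n p)
    then obtain t where r: "typed X t n p" and "x = opclass X t" by (auto simp: presented_ops(1))
    then show ?case by (simp add: O(5)[OF r] \<phi>[OF typed_Dif[OF r]] \<phi>[OF r])
  qed
  have uniq: "\<psi> (opclass X t) = opeval Q \<gamma> t"
    if h: "dg_operad_hom (presented X) Q \<psi>" and g: "\<forall>g\<in>pgens X. \<psi> (opclass X (Gen g)) = \<gamma> g"
      and t: "typed X t n p" for \<psi> t n p
  proof -
    interpret h: dg_operad_hom "presented X" Q \<psi> by (rule h)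
    have car: "typed X t n p \<Longrightarrow> opclass X t \<in> ocar (presented X) n p" for t n p
      by (simp add: presented_ops(1))
    have zero: "\<psi> (ozero (presented X) n p) = ozero Q n p" for n p
    proof -
      let ?z = "ozero (presented X) n p"
      have z: "?z \<in> ocar (presented X) n p" by (rule h.P.zero_closed)
      have "\<psi> ?z = \<psi> (oadd (presented X) ?z (osmul (presented X) (-1) ?z))"
        by (simp add: h.P.add_neg[OF z])
      also have "\<dots> = ozero Q n p"
        using h.hom_add[OF z h.P.smul_closed[OF z]] h.hom_smul[OF z] Q.add_neg[OF h.hom_closed[OF z]]
        by simp
      finally show ?thesis .
    qed
    from t show ?thesis
    proof (induction rule: typed.induct)
      case (typed_Gen a)
      then show ?case using g by simp
    next
      case (typed_Zero n p)
      show ?case using zero by (simp add: presented_ops(2))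
    next
      case (typed_Add s n p t)
      then show ?case using h.hom_add[OF car car] O(1) by (metis opeval.simps(3))
    next
      case (typed_Smul t n p c)
      then show ?case using h.hom_smul[OF car] O(2) by (metis opeval.simps(4))
    next
      case typed_Ident
      show ?case using h.hom_one by (simp add: presented_ops(3))
    next
      case (typed_Comp s m p t n q i)
      then show ?case using h.hom_comp[OF car car] O(3) by (metis opeval.simps(6))
    next
      case (typed_Act t n p \<sigma>)
      then show ?case using h.hom_act[OF car] O(4) by (metis opeval.simps(7))
    next
      case (typed_Dif t n p)
      then show ?case using h.hom_dif[OF car] O(5) by (metis opeval.simps(8))
    qed
  qed
  have "\<phi> (opclass X (Gen g)) = \<gamma> g" if "g \<in> pgens X" for g
    using \<phi>[OF typed_Gen[OF that]] by simp
  moreover have "\<psi> x = \<phi> x"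
    if "dg_operad_hom (presented X) Q \<psi>" "\<forall>g\<in>pgens X. \<psi> (opclass X (Gen g)) = \<gamma> g"
      "x \<in> ocar (presented X) n p" for \<psi> x n p
    using uniq[OF that(1,2)] \<phi> that(3) by (auto simp: presented_ops(1))
  ultimately show ?thesis using hom by blast
qed


text \<open>The relations of \<open>Com\<close> and \<open>ECBV\<close> are well-typed, so that none of them is vacuous.\<close>

lemma typed_tdiff: "\<lbrakk>typed X s n p; typed X t n p\<rbrakk> \<Longrightarrow> typed X (tdiff s t) n p"
  unfolding tdiff_def by (intro typed.intros)

lemma typed_tsum: "(\<And>t. t \<in> set ts \<Longrightarrow> typed X t n p) \<Longrightarrow> typed X (tsum n p ts) n p"
  unfolding tsum_def by (induction ts) (auto intro: typed.intros)

lemma typed_commutator: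
  assumes "typed X a 1 p" "typed X b 1 q"
  shows "typed X (commutator p q a b) 1 (p + q)"
proof -
  have "typed X (Comp a 1 b) 1 (p + q)" by (rule typed_CompI[OF assms]) auto
  moreover have "typed X (Comp b 1 a) 1 (p + q)" by (rule typed_CompI[OF assms(2,1)]) auto
  ultimately show ?thesis unfolding commutator_def by (intro typed_tdiff typed_Smul)
qed

lemma typed_iter_prod:
  assumes "typed X mu 2 0" "m \<ge> 1"
  shows "typed X (iter_prod mu m) m 0"
proof -
  have "typed X (((\<lambda>t. Comp mu 1 t) ^^ k) Ident) (k + 1) 0" for k
  proof (induction k)
    case 0
    then show ?case using typed_Ident by simp
  next
    case (Suc k)
    then show ?case using typed_CompI[OF assms(1) Suc, of 1 "Suc k + 1" 0] by simp
  qed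
  from this[of "m - 1"] show ?thesis using assms(2) by (simp add: iter_prod_def)
qed

lemma set_enum_of: "finite A \<Longrightarrow> set (enum_of A) = A"
  unfolding enum_of_def by (rule someI2_ex) (use finite_distinct_list in auto)

lemma finite_shuffle_perms: "finite (shuffle_perms p q)"
  by (rule finite_subset[of _ "{\<sigma>. \<sigma> permutes {1..p + q}}"])
    (auto simp: shuffle_perms_def finite_permutations)

lemma typed_diff_op_rel:
  assumes mu: "typed X mu 2 0" and D: "typed X D 1 e"
  shows "typed X (diff_op_rel mu D e n) (n + 1) e"
proof -
  have "typed X (Act (Comp (iter_prod mu (n + 1 - p + 1)) 1 (Comp D 1 (iter_prod mu p))) (inv \<sigma>)) (n + 1) e"
    if p: "1 \<le> p" "p \<le> n + 1" and \<sigma>: "\<sigma> \<in> shuffle_perms p (n + 1 - p)" for p \<sigma>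
  proof (rule typed_Act)
    have "typed X (Comp D 1 (iter_prod mu p)) p e"
      by (rule typed_CompI[OF D typed_iter_prod[OF mu p(1)]]) auto
    then show "typed X (Comp (iter_prod mu (n + 1 - p + 1)) 1 (Comp D 1 (iter_prod mu p))) (n + 1) e"
      by (rule typed_CompI[OF typed_iter_prod[OF mu], rotated]) (use p in auto)
    show "inv \<sigma> permutes {1..n + 1}"
      using \<sigma> p by (intro permutes_inv) (simp add: shuffle_perms_def)
  qed
  note act = this
  show ?thesis
    unfolding diff_op_rel_def Let_def
  proof (rule typed_tsum)
    fix t
    assume "t \<in> set (map (\<lambda>p. Smul ((-1) ^ p) (tsum (n + 1) e (map (\<lambda>\<sigma>.
        Act (Comp (iter_prod mu (n + 1 - p + 1)) 1 (Comp D 1 (iter_prod mu p))) (inv \<sigma>))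
      (enum_of (shuffle_perms p (n + 1 - p)))))) [1..<n + 2])"
    then obtain p where p: "1 \<le> p" "p \<le> n + 1" and t: "t = Smul ((-1) ^ p) (tsum (n + 1) e (map (\<lambda>\<sigma>.
        Act (Comp (iter_prod mu (n + 1 - p + 1)) 1 (Comp D 1 (iter_prod mu p))) (inv \<sigma>))
      (enum_of (shuffle_perms p (n + 1 - p)))))" by fastforce
    show "typed X t (n + 1) e"
      unfolding t using act[OF p] set_enum_of[OF finite_shuffle_perms]
      by (intro typed_Smul typed_tsum) (metis (no_types, lifting) image_iff list.set_map)
  qed
qed

lemma typed_com_rels:
  assumes mu: "typed X mu 2 0" and r: "r \<in> com_rels mu"
  shows "\<exists>n p. typed X r n p"
proof -
  have "transpose 1 2 permutes {1..2::nat}" by (rule permutes_swap_id) auto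
  then have "typed X (tdiff (Act mu (transpose 1 2)) mu) 2 0"
    using mu by (intro typed_tdiff typed_Act)
  moreover have "typed X (Comp mu i mu) 3 0" if "1 \<le> i" "i \<le> 2" for i
    by (rule typed_CompI[OF mu mu that]) auto
  then have "typed X (tdiff (Comp mu 1 mu) (Comp mu 2 mu)) 3 0"
    by (intro typed_tdiff) auto
  ultimately show ?thesis using r mu typed_Dif unfolding com_rels_def by blast
qed

lemma com_pres_rels_typed: "r \<in> prels com_pres \<Longrightarrow> \<exists>n p. typed com_pres r n p"
  using typed_Gen[of ComMu com_pres] by (auto simp: com_pres_def intro: typed_com_rels)

lemma ecbv_pres_rels_typed:
  assumes "r \<in> prels (ecbv_pres :: (ecbv_gen, 'k::field) presentation)"
  shows "\<exists>n p. typed (ecbv_pres :: (ecbv_gen, 'k) presentation) r n p"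
proof -
  let ?X = "ecbv_pres :: (ecbv_gen, 'k) presentation"
  note R = arg_cong[OF ecbv_pres_def, of prels, unfolded presentation.simps]
  have G: "pgens ?X = insert Mu {I n |n. n \<ge> 1}" "par ?X Mu = 2" "par ?X (I n) = 1"
    "pdeg ?X Mu = 0" "pdeg ?X (I n) = - 2 * int n" for n
    by (auto simp: ecbv_pres_def)
  have mu: "typed ?X (Gen Mu) 2 0" using typed_Gen[of Mu ?X] by (simp add: G)
  have i: "typed ?X (Gen (I n)) 1 (- 2 * int n)" if "n \<ge> 1" for n
    using typed_Gen[of "I n" ?X] that by (simp add: G)
  have di: "typed ?X (Dif (Gen (I n))) 1 (1 - 2 * int n)" if "n \<ge> 1" for n
    using typed_Dif[OF i[OF that]] by (simp add: algebra_simps)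
  have "typed ?X (tsum 1 (1 - 2 * int n) (map (\<lambda>j. commutator (- 2 * int j) (1 - 2 * int (n - j))
      (Gen (I j)) (Dif (Gen (I (n - j))))) [1..<n])) 1 (1 - 2 * int n)" for n
  proof (rule typed_tsum)
    fix t assume "t \<in> set (map (\<lambda>j. commutator (- 2 * int j) (1 - 2 * int (n - j))
      (Gen (I j)) (Dif (Gen (I (n - j)))) :: (ecbv_gen, 'k) opterm) [1..<n])"
    then obtain j where j: "1 \<le> j" "j < n" and t: "t = commutator (- 2 * int j) (1 - 2 * int (n - j))
      (Gen (I j)) (Dif (Gen (I (n - j))))" by auto
    have "- 2 * int j + (1 - 2 * int (n - j)) = 1 - 2 * int n" using j by (simp add: of_nat_diff)
    then show "typed ?X t 1 (1 - 2 * int n)"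
      using typed_commutator[OF i[OF j(1)] di[of "n - j"]] j unfolding t by simp
  qed
  moreover have "\<exists>n p. typed ?X r n p" if "r \<in> com_rels (Gen Mu)" for r
    by (rule typed_com_rels[OF mu that])
  ultimately show ?thesis
    using assms typed_commutator[OF i i] typed_diff_op_rel[OF mu i]
    unfolding R by blast
qed

end

theory Submission
  imports Defs
begin

text \<open>
  Every relation of \<open>ECBV\<close> is homogeneous for the weight that counts the generators \<open>I n\<close>, so the
  derivation \<open>E\<close> that multiplies an element of weight \<open>w\<close> by \<open>w\<close> is defined on \<open>ECBV\<close> and commutes
  with the differential. There is also a derivation \<open>h\<close> of degree \<open>-1\<close> with \<open>h(\<mu>) = 0\<close>,
  \<open>h(i\<^sub>n) = 0\<close> and \<open>h(d(i\<^sub>n)) = i\<^sub>n\<close>, and then \<open>d h + h d = E\<close>, because both sides are derivations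
  that commute with \<open>d\<close> and agree on the generators.

  The point is that \<open>h\<close> respects the relations. It kills every relation that does not contain a
  differential; it sends \<open>d(\<mu>)\<close> to \<open>E(\<mu>) - d(h(\<mu>)) = 0\<close>; and it sends \<open>\<Sum> [i\<^sub>j, d(i\<^bsub>n-j\<^esub>)]\<close> to
  \<open>\<Sum> [i\<^sub>j, i\<^bsub>n-j\<^esub>]\<close>, which vanishes because the \<open>i\<^sub>n\<close> commute.

  So \<open>E\<close> is null-homotopic. In characteristic zero this makes the part of positive weight acyclic:
  a cocycle \<open>z\<close> is cohomologous to \<open>z - E(z)/w\<close> for every \<open>w \<ge> 1\<close>, hence to the result of applying
  \<open>\<Prod>\<^sub>w (1 - E/w)\<close> over \<open>1 \<le> w \<le> N\<close>, which for large \<open>N\<close> is the part of weight 0 of \<open>z\<close>. The part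
  of weight 0 is the image of \<open>Com\<close>, as expressions without \<open>I n\<close> are expressions in \<open>Mu\<close> alone.
  Finally, sending all \<open>I n\<close> to 0 is a morphism \<open>ECBV \<rightarrow> Com\<close> that is a left inverse of the
  inclusion, so the inclusion is injective, also in cohomology.

  To obtain \<open>E\<close> and \<open>h\<close> from the universal property, both are packed into one morphism
  \<open>x \<mapsto> x + \<epsilon> E(x) + d\<epsilon> h(x)\<close> to \<open>P \<otimes> (k \<oplus> k\<epsilon> \<oplus> k d\<epsilon>)\<close>, where \<open>\<epsilon>\<close> has degree 0 and all products
  of \<open>\<epsilon>\<close> and \<open>d\<epsilon>\<close> are zero. It commutes with the differentials exactly when \<open>E\<close> commutes with \<open>d\<close>
  and \<open>h d = E - d h\<close>. It is the first-order form at \<open>t = 1\<close> of the path \<open>i\<^sub>n \<mapsto> t i\<^sub>n\<close> in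
  \<open>P \<otimes> k[t, dt]\<close> that contracts \<open>ECBV\<close> to \<open>Com\<close>.
\<close>

section \<open>Linear algebra in a DG operad\<close>

context dg_operad
begin

lemma comp_in:
  "\<lbrakk>x \<in> ocar P m p; y \<in> ocar P n q; 1 \<le> i; i \<le> m; k = m + n - 1; r = p + q\<rbrakk>
    \<Longrightarrow> ocomp P x i y \<in> ocar P k r"
  using comp_closed by simp

lemma smul_0: "x \<in> ocar P n p \<Longrightarrow> osmul P 0 x = ozero P n p"
  using add_smul[of x n p 1 "-1"] by (simp add: one_smul add_neg)

lemma smul_zero: "osmul P c (ozero P n p) = ozero P n p"
  using smul_smul[OF zero_closed, of c 0 n p] smul_0[OF zero_closed, of n p] by simp

lemma zero_add: "x \<in> ocar P n p \<Longrightarrow> oadd P (ozero P n p) x = x"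
  using add_comm add_zero zero_closed by metis

lemma comp_zero_left:
  "\<lbrakk>y \<in> ocar P n q; 1 \<le> i; i \<le> m\<rbrakk> \<Longrightarrow> ocomp P (ozero P m p) i y = ozero P (m + n - 1) (p + q)"
  using comp_smul_left[OF zero_closed, of y n q i m 0 p] comp_closed[OF zero_closed, of y n q i m p]
  by (simp add: smul_zero smul_0)

lemma comp_zero_right:
  "\<lbrakk>x \<in> ocar P m p; 1 \<le> i; i \<le> m\<rbrakk> \<Longrightarrow> ocomp P x i (ozero P n q) = ozero P (m + n - 1) (p + q)"
  using comp_smul_right[OF _ zero_closed, of x m p i 0 n q] comp_closed[OF _ zero_closed, of x m p i n q]
  by (simp add: smul_zero smul_0)

lemma act_zero: "\<sigma> permutes {1..n} \<Longrightarrow> oact P (ozero P n p) \<sigma> = ozero P n p"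
  using act_smul[OF zero_closed, of \<sigma> n 0 p] act_closed[OF zero_closed, of \<sigma> n p]
  by (simp add: smul_zero smul_0)

lemma dif_zero: "odif P (ozero P n p) = ozero P n (p + 1)"
  using dif_smul[OF zero_closed, of 0 n p] dif_closed[OF zero_closed, of n p]
  by (simp add: smul_zero smul_0)

lemma add_left_commute:
  "\<lbrakk>x \<in> ocar P n p; y \<in> ocar P n p; z \<in> ocar P n p\<rbrakk> \<Longrightarrow> oadd P x (oadd P y z) = oadd P y (oadd P x z)"
  using add_assoc[of x n p y z] add_assoc[of y n p x z] add_comm[of x n p y] by simp

lemma add_right_commute:
  "\<lbrakk>x \<in> ocar P n p; y \<in> ocar P n p; z \<in> ocar P n p\<rbrakk> \<Longrightarrow> oadd P (oadd P x y) z = oadd P (oadd P x z) y"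
  using add_assoc[of x n p] add_comm[of y n p z] by simp

lemma add_swap:
  assumes "a \<in> ocar P n p" "b \<in> ocar P n p" "c \<in> ocar P n p" "d \<in> ocar P n p"
  shows "oadd P (oadd P a b) (oadd P c d) = oadd P (oadd P a c) (oadd P b d)"
proof -
  have "oadd P (oadd P a b) (oadd P c d) = oadd P a (oadd P b (oadd P c d))"
    using assms add_closed by (intro add_assoc)
  also have "oadd P b (oadd P c d) = oadd P c (oadd P b d)"
    using assms by (intro add_left_commute)
  also have "oadd P a (oadd P c (oadd P b d)) = oadd P (oadd P a c) (oadd P b d)"
    using assms add_closed by (intro add_assoc[symmetric])
  finally show ?thesis .
qed

end

lemma koszul_sq: "koszul p q * koszul p q = (1::'k::field)"
  by (simp add: koszul_def)

lemma koszul_add_right: "koszul p (q + r) = (koszul p q * koszul p r :: 'k::field)"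
  by (simp add: koszul_def)

section \<open>The operad of infinitesimal paths\<close>

text \<open>
  This is \<open>P \<otimes> (k \<oplus> k\<epsilon> \<oplus> k d\<epsilon>)\<close>: the quadruple \<open>(x, x', e, h)\<close> stands for \<open>x + \<epsilon> e + d\<epsilon> h\<close>.
  The redundant entry \<open>x' = (-1)\<^bsup>|x|\<^esup> x\<close> carries the degree of \<open>x\<close>, on which the Koszul sign in
  \<open>x (d\<epsilon> g) = d\<epsilon> (x' g)\<close> depends.
\<close>

definition first_order_path ::
    "('a, 'k::field) dg_operad_data \<Rightarrow> ('a \<times> 'a \<times> 'a \<times> 'a, 'k) dg_operad_data" where
  "first_order_path P =
     \<lparr> ocar = (\<lambda>n p. {(x, x', e, h). x \<in> ocar P n p \<and> x' = osmul P (koszul 1 p) x \<and>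
                          e \<in> ocar P n p \<and> h \<in> ocar P n (p - 1)}),
       ozero = (\<lambda>n p. (ozero P n p, ozero P n p, ozero P n p, ozero P n (p - 1))),
       oadd = (\<lambda>(x, x', e, h) (y, y', f, g). (oadd P x y, oadd P x' y', oadd P e f, oadd P h g)),
       osmul = (\<lambda>c (x, x', e, h). (osmul P c x, osmul P c x', osmul P c e, osmul P c h)),
       oone = (oone P, oone P, ozero P 1 0, ozero P 1 (-1)),
       ocomp = (\<lambda>(x, x', e, h) i (y, y', f, g).
          (ocomp P x i y, ocomp P x' i y', oadd P (ocomp P e i y) (ocomp P x i f),
           oadd P (ocomp P h i y) (ocomp P x' i g))),
       oact = (\<lambda>(x, x', e, h) \<sigma>. (oact P x \<sigma>, oact P x' \<sigma>, oact P e \<sigma>, oact P h \<sigma>)),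
       odif = (\<lambda>(x, x', e, h). (odif P x, osmul P (-1) (odif P x'), odif P e,
           oadd P e (osmul P (-1) (odif P h)))) \<rparr>"

context dg_operad
begin

text \<open>
  The Leibniz rule for a composition whose factors have derivatives \<open>e\<close> and \<open>f\<close>. The degrees of
  \<open>x\<close>, \<open>y\<close> and of \<open>e\<close>, \<open>f\<close> may differ, so that one set of lemmas serves both \<open>E\<close> and, with the sign
  moved into \<open>x\<close>, the derivation \<open>h\<close> of degree \<open>-1\<close>.
\<close>

definition leibniz :: "'a \<Rightarrow> 'a \<Rightarrow> nat \<Rightarrow> 'a \<Rightarrow> 'a \<Rightarrow> 'a" where
  "leibniz x e i y f = oadd P (ocomp P e i y) (ocomp P x i f)"

lemma leibniz_closed:
  assumes "x \<in> ocar P m p" "e \<in> ocar P m a" "y \<in> ocar P n q" "f \<in> ocar P n b"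
    "1 \<le> i" "i \<le> m" "a + q = p + b" "k = m + n - 1" "r = a + q"
  shows "leibniz x e i y f \<in> ocar P k r"
  unfolding leibniz_def by (intro add_closed comp_in[OF assms(2,3,5,6)] comp_in[OF assms(1,4,5,6)]) (use assms in auto)

lemma leibniz_add_left:
  assumes "x1 \<in> ocar P m p" "e1 \<in> ocar P m a" "x2 \<in> ocar P m p" "e2 \<in> ocar P m a"
    "y \<in> ocar P n q" "f \<in> ocar P n b"  "1 \<le> i" "i \<le> m" "a + q = p + b"
  shows "leibniz (oadd P x1 x2) (oadd P e1 e2) i y f = oadd P (leibniz x1 e1 i y f) (leibniz x2 e2 i y f)"
proof -
  have "leibniz (oadd P x1 x2) (oadd P e1 e2) i y f = oadd P (oadd P (ocomp P e1 i y) (ocomp P e2 i y))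
      (oadd P (ocomp P x1 i f) (ocomp P x2 i f))"
    unfolding leibniz_def using assms
    by (simp add: comp_add_left[of e1 m a e2 y n q i] comp_add_left[of x1 m p x2 f n b i])
  then show ?thesis unfolding leibniz_def
    using add_swap[of "ocomp P e1 i y" "m + n - 1" "a + q" "ocomp P e2 i y" "ocomp P x1 i f" "ocomp P x2 i f"]
      comp_in assms by simp
qed

lemma leibniz_add_right:
  assumes "x \<in> ocar P m p" "e \<in> ocar P m a"
    "y1 \<in> ocar P n q" "f1 \<in> ocar P n b" "y2 \<in> ocar P n q" "f2 \<in> ocar P n b" "1 \<le> i" "i \<le> m" "a + q = p + b"
  shows "leibniz x e i (oadd P y1 y2) (oadd P f1 f2) = oadd P (leibniz x e i y1 f1) (leibniz x e i y2 f2)"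
proof -
  have "leibniz x e i (oadd P y1 y2) (oadd P f1 f2) = oadd P (oadd P (ocomp P e i y1) (ocomp P e i y2))
      (oadd P (ocomp P x i f1) (ocomp P x i f2))"
    unfolding leibniz_def using assms
    by (simp add: comp_add_right[of e m a y1 n q y2 i] comp_add_right[of x m p f1 n b f2 i])
  then show ?thesis unfolding leibniz_def
    using add_swap[of "ocomp P e i y1" "m + n - 1" "a + q" "ocomp P e i y2" "ocomp P x i f1" "ocomp P x i f2"]
      comp_in assms by simp
qed

lemma leibniz_smul_left:
  assumes "x \<in> ocar P m p" "e \<in> ocar P m a" "y \<in> ocar P n q" "f \<in> ocar P n b" "1 \<le> i" "i \<le> m" "a + q = p + b"
  shows "leibniz (osmul P c x) (osmul P c e) i y f = osmul P c (leibniz x e i y f)"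
  unfolding leibniz_def using assms
    comp_smul_left[of e m a y n q i c] comp_smul_left[of x m p f n b i c]
    smul_add[of "ocomp P e i y" "m + n - 1" "a + q" "ocomp P x i f" c] comp_in by simp

lemma leibniz_smul_right:
  assumes "x \<in> ocar P m p" "e \<in> ocar P m a" "y \<in> ocar P n q" "f \<in> ocar P n b" "1 \<le> i" "i \<le> m" "a + q = p + b"
  shows "leibniz x e i (osmul P c y) (osmul P c f) = osmul P c (leibniz x e i y f)"
  unfolding leibniz_def using assms
    comp_smul_right[of e m a y n q i c] comp_smul_right[of x m p f n b i c]
    smul_add[of "ocomp P e i y" "m + n - 1" "a + q" "ocomp P x i f" c] comp_in by simp

lemma leibniz_act:
  assumes "x \<in> ocar P m p" "e \<in> ocar P m a" "y \<in> ocar P n q" "f \<in> ocar P n b" "1 \<le> i" "i \<le> m" "a + q = p + b"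
    and \<sigma>: "\<sigma> permutes {1..m}" and \<tau>: "\<tau> permutes {1..n}"
  shows "leibniz (oact P x \<sigma>) (oact P e \<sigma>) i (oact P y \<tau>) (oact P f \<tau>)
    = oact P (leibniz x e (\<sigma> i) y f) (circ_perm n i \<sigma> \<tau>)"
proof -
  have "1 \<le> \<sigma> i" "\<sigma> i \<le> m" using permutes_in_image[OF \<sigma>, of i] assms by auto
  then show ?thesis
    unfolding leibniz_def using assms
      comp_act[of e m a y n q i \<sigma> \<tau>] comp_act[of x m p f n b i \<sigma> \<tau>]
      act_add[of "ocomp P e (\<sigma> i) y" "m + n - 1" "a + q" "ocomp P x (\<sigma> i) f" "circ_perm n i \<sigma> \<tau>"]
      comp_in circ_perm_permutes[OF \<sigma> \<tau>] by simp
qed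

text \<open>
  The element \<open>y'\<close> is \<open>y\<close> for a derivation of degree 0 and \<open>(-1)\<^bsup>|y|\<^esup> y\<close> for one of odd degree, with
  the sign that arises when the derivation passes \<open>y\<close> in order to act on \<open>z\<close>.
\<close>

lemma leibniz_seq:
  assumes xs: "x \<in> ocar P l p" "e \<in> ocar P l a" "y \<in> ocar P m q" "y' \<in> ocar P m q" "f \<in> ocar P m b"
    "z \<in> ocar P n r" "g \<in> ocar P n c"
    and ij: "1 \<le> i" "i \<le> l" "1 \<le> j" "j \<le> m" and deg: "a + q = p + b" "b + r = q + c"
  shows "leibniz (ocomp P x i y') (leibniz x e i y f) (i + j - 1) z g
    = leibniz x e i (ocomp P y j z) (leibniz y' f j z g)"
proof -
  let ?k = "i + j - 1"
  have k: "1 \<le> ?k" "?k \<le> l + m - 1" using ij by auto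
  have 1: "ocomp P (leibniz x e i y f) ?k z = oadd P (ocomp P (ocomp P e i y) ?k z) (ocomp P (ocomp P x i f) ?k z)"
    unfolding leibniz_def using xs ij k deg
    by (intro comp_add_left[of _ "l + m - 1" "a + q"]) (auto intro!: comp_in simp del: One_nat_def)
  have 2: "ocomp P x i (leibniz y' f j z g) = oadd P (ocomp P x i (ocomp P f j z)) (ocomp P x i (ocomp P y' j g))"
    unfolding leibniz_def using xs ij k deg
    by (intro comp_add_right[of _ _ _ _ "m + n - 1" "b + r"]) (auto intro!: comp_in simp del: One_nat_def)
  have A: "ocomp P (ocomp P e i y) ?k z = ocomp P e i (ocomp P y j z)"
    "ocomp P (ocomp P x i f) ?k z = ocomp P x i (ocomp P f j z)"
    "ocomp P (ocomp P x i y') ?k g = ocomp P x i (ocomp P y' j g)"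
    using comp_seq[OF xs(2,3,6) ij] comp_seq[OF xs(1,5,6) ij] comp_seq[OF xs(1,4,7) ij] by simp_all
  have C: "ocomp P e i (ocomp P y j z) \<in> ocar P (l + m + n - 2) (a + q + r)"
    "ocomp P x i (ocomp P f j z) \<in> ocar P (l + m + n - 2) (a + q + r)"
    "ocomp P x i (ocomp P y' j g) \<in> ocar P (l + m + n - 2) (a + q + r)"
    by (rule comp_in[OF xs(2) comp_closed[OF xs(3,6)]] comp_in[OF xs(1) comp_closed[OF xs(5,6)]]
          comp_in[OF xs(1) comp_closed[OF xs(4,7)]]; use ij deg in simp)+
  show ?thesis
    unfolding leibniz_def[of "ocomp P x i y'"] leibniz_def[of x e i "ocomp P y j z"] 1 2 A
    using add_assoc[OF C] .
qed

text \<open>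
  The scalars \<open>s\<close> and \<open>t\<close> are 1 for a derivation of degree 0 and \<open>(-1)\<^bsup>|y|\<^esup>\<close>, \<open>(-1)\<^bsup>|z|\<^esup>\<close> for one of odd
  degree. The two conditions on them are what keeps the total exchange sign equal to \<open>koszul q r\<close>
  when \<open>y\<close> or \<open>z\<close> is replaced by its derivative.
\<close>

lemma leibniz_par:
  assumes xs: "x \<in> ocar P l p" "e \<in> ocar P l a" "y \<in> ocar P m q" "f \<in> ocar P m b"
    "z \<in> ocar P n r" "g \<in> ocar P n c"
    and ij: "1 \<le> i" "i < j" "j \<le> l" and deg: "a + q = p + b" "a + r = p + c"
    and s: "s * koszul q c = koszul q r" and t: "koszul b r = koszul q r * t"
  shows "leibniz (ocomp P x i (osmul P s y)) (leibniz x e i y f) (j + m - 1) z g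
    = osmul P (koszul q r) (leibniz (ocomp P x j (osmul P t z)) (leibniz x e j z g) i y f)"
proof -
  let ?k = "j + m - 1"
  have k: "1 \<le> ?k" "?k \<le> l + m - 1" "i \<le> l" "1 \<le> j" "i \<le> l + n - 1" using ij by auto
  have 1: "ocomp P (leibniz x e i y f) ?k z = oadd P (ocomp P (ocomp P e i y) ?k z) (ocomp P (ocomp P x i f) ?k z)"
    unfolding leibniz_def using xs ij k deg
    by (intro comp_add_left[of _ "l + m - 1" "a + q"]) (auto intro!: comp_in simp del: One_nat_def)
  have 2: "ocomp P (leibniz x e j z g) i y = oadd P (ocomp P (ocomp P e j z) i y) (ocomp P (ocomp P x j g) i y)"
    unfolding leibniz_def using xs ij k deg
    by (intro comp_add_left[of _ "l + n - 1" "a + r"]) (auto intro!: comp_in simp del: One_nat_def)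
  let ?u = "ocomp P (ocomp P e j z) i y" and ?v = "ocomp P (ocomp P x j z) i f"
    and ?w = "ocomp P (ocomp P x j g) i y"
  have A: "ocomp P (ocomp P e i y) ?k z = osmul P (koszul q r) ?u"
    "ocomp P (ocomp P x i f) ?k z = osmul P (koszul b r) ?v"
    "ocomp P (ocomp P x i y) ?k g = osmul P (koszul q c) ?w"
    using comp_par[OF xs(2,3,5) ij] comp_par[OF xs(1,4,5) ij] comp_par[OF xs(1,3,6) ij] by simp_all
  let ?N = "l + m + n - 2" and ?D = "a + q + r"
  have C: "?u \<in> ocar P ?N ?D" "?v \<in> ocar P ?N ?D" "?w \<in> ocar P ?N ?D"
    by (rule comp_in[OF comp_closed[OF xs(2,5)] xs(3)] comp_in[OF comp_closed[OF xs(1,5)] xs(4)]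
          comp_in[OF comp_closed[OF xs(1,6)] xs(3)]; use ij deg in simp)+
  have B: "ocomp P (ocomp P x i (osmul P s y)) ?k g = osmul P (koszul q r) ?w"
  proof -
    have "ocomp P (ocomp P x i (osmul P s y)) ?k g = osmul P s (ocomp P (ocomp P x i y) ?k g)"
      using xs k ij comp_smul_right[OF xs(1,3)] comp_smul_left[OF comp_closed[OF xs(1,3)] xs(6)] by simp
    then show ?thesis using A(3) smul_smul[OF C(3)] s by simp
  qed
  have B2: "ocomp P (ocomp P x j (osmul P t z)) i f = osmul P t ?v"
    using xs k ij comp_smul_right[OF xs(1,5)] comp_smul_left[OF comp_closed[OF xs(1,5)] xs(4)] by simp
  let ?c = "koszul q r"
  note C' = smul_closed[OF C(1), of ?c] smul_closed[OF C(2), of t] smul_closed[OF C(3), of ?c]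
  have "leibniz (ocomp P x i (osmul P s y)) (leibniz x e i y f) ?k z g
     = oadd P (oadd P (osmul P ?c ?u) (osmul P ?c (osmul P t ?v))) (osmul P ?c ?w)"
    unfolding leibniz_def[of "ocomp P x i (osmul P s y)"] 1 A B using smul_smul[OF C(2)] t by simp
  also have "\<dots> = oadd P (oadd P (osmul P ?c ?u) (osmul P ?c ?w)) (osmul P ?c (osmul P t ?v))"
    using add_right_commute[OF C'(1) smul_closed[OF C'(2)] C'(3)] .
  also have "\<dots> = osmul P ?c (oadd P (oadd P ?u ?w) (osmul P t ?v))"
    using smul_add[of "oadd P ?u ?w" ?N ?D "osmul P t ?v" ?c] smul_add[OF C(1,3), of ?c] C C' add_closed by simp
  also have "\<dots> = osmul P (koszul q r) (leibniz (ocomp P x j (osmul P t z)) (leibniz x e j z g) i y f)"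
    unfolding leibniz_def[of "ocomp P x j (osmul P t z)"] 2 B2 ..
  finally show ?thesis .
qed

lemma dif_leibniz:
  assumes xs: "x \<in> ocar P m p" "e \<in> ocar P m p" "y \<in> ocar P n q" "f \<in> ocar P n q" and i: "1 \<le> i" "i \<le> m"
  shows "odif P (leibniz x e i y f)
    = oadd P (leibniz (odif P x) (odif P e) i y f) (osmul P (koszul 1 p) (leibniz x e i (odif P y) (odif P f)))"
proof -
  let ?N = "m + n - 1" and ?D = "p + q + 1" and ?s = "koszul 1 p :: 'k"
  note d = xs[THEN dif_closed]
  have C: "ocomp P e i y \<in> ocar P ?N (p + q)" "ocomp P x i f \<in> ocar P ?N (p + q)"
    "ocomp P (odif P e) i y \<in> ocar P ?N ?D" "ocomp P (odif P x) i f \<in> ocar P ?N ?D"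
    "ocomp P e i (odif P y) \<in> ocar P ?N ?D" "ocomp P x i (odif P f) \<in> ocar P ?N ?D"
    by (rule comp_in[OF xs(2,3) i] comp_in[OF xs(1,4) i] comp_in[OF d(2) xs(3) i]
          comp_in[OF d(1) xs(4) i] comp_in[OF xs(2) d(3) i] comp_in[OF xs(1) d(4) i]; simp)+
  show ?thesis
    unfolding leibniz_def
    by (simp only: dif_add[OF C(1,2)] dif_comp[OF xs(2,3) i] dif_comp[OF xs(1,4) i] smul_add[OF C(5,6)]
        add_swap[OF C(3) smul_closed[OF C(5)] C(4) smul_closed[OF C(6)]])
qed

text \<open>
  The coefficient of \<open>d\<epsilon>\<close> in the Leibniz rule for the differential of \<open>first_order_path P\<close>. Both
  sides are sums of the same six terms. The signs of the terms that contain \<open>d y\<close> agree because \<open>h\<close>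
  has degree \<open>p - 1\<close>, which compensates for the sign in \<open>d(d\<epsilon> h) = - d\<epsilon> d(h)\<close>.
\<close>

lemma dif_leibniz_homotopy:
  assumes xs: "x \<in> ocar P m p" "e \<in> ocar P m p" "y \<in> ocar P n q" "f \<in> ocar P n q"
    and hg: "h \<in> ocar P m (p - 1)" "g \<in> ocar P n (q - 1)" and i: "1 \<le> i" "i \<le> m"
  defines "x' \<equiv> osmul P (koszul 1 p) x"
  shows "oadd P (leibniz x e i y f) (osmul P (-1) (odif P (leibniz x' h i y g)))
    = oadd P (leibniz (osmul P (-1) (odif P x')) (oadd P e (osmul P (-1) (odif P h))) i y g)
        (osmul P (koszul 1 p) (leibniz x' h i (odif P y) (oadd P f (osmul P (-1) (odif P g)))))"
proof -
  let ?N = "m + n - 1" and ?D = "p + q" and ?s = "koszul 1 p :: 'k"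
  have x': "x' \<in> ocar P m p" unfolding x'_def using xs(1) smul_closed by simp
  have dh: "odif P h \<in> ocar P m p" and dg: "odif P g \<in> ocar P n q" using hg[THEN dif_closed] by simp_all
  have m: "osmul P (-1) (odif P h) \<in> ocar P m p" "osmul P (-1) (odif P g) \<in> ocar P n q"
    "osmul P (-1) (odif P x') \<in> ocar P m (p + 1)"
    using dh dg dif_closed[OF x'] smul_closed by blast+
  have C: "ocomp P e i y \<in> ocar P ?N ?D" "ocomp P x i f \<in> ocar P ?N ?D"
    "ocomp P (odif P h) i y \<in> ocar P ?N ?D" "ocomp P h i (odif P y) \<in> ocar P ?N ?D"
    "ocomp P (odif P x') i g \<in> ocar P ?N ?D" "ocomp P x' i (odif P g) \<in> ocar P ?N ?D"
    by (rule comp_in[OF xs(2,3) i] comp_in[OF xs(1,4) i] comp_in[OF dh xs(3) i]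
          comp_in[OF hg(1) dif_closed[OF xs(3)] i] comp_in[OF dif_closed[OF x'] hg(2) i] comp_in[OF x' dg i]; simp)+
  have C0: "ocomp P h i y \<in> ocar P ?N (?D - 1)" "ocomp P x' i g \<in> ocar P ?N (?D - 1)"
    by (rule comp_in[OF hg(1) xs(3) i] comp_in[OF x' hg(2) i]; simp)+
  have k: "koszul 1 (p - 1) = - ?s" by (simp add: koszul_def)
  have ss: "?s * ?s = 1" by (rule koszul_sq)
  have 1: "odif P (leibniz x' h i y g) = oadd P
      (oadd P (ocomp P (odif P h) i y) (osmul P (- ?s) (ocomp P h i (odif P y))))
      (oadd P (ocomp P (odif P x') i g) (osmul P ?s (ocomp P x' i (odif P g))))"
    unfolding leibniz_def
    by (simp only: dif_add[OF C0] dif_comp[OF hg(1) xs(3) i] dif_comp[OF x' hg(2) i] k)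
  have 2: "leibniz (osmul P (-1) (odif P x')) (oadd P e (osmul P (-1) (odif P h))) i y g
    = oadd P (oadd P (ocomp P e i y) (osmul P (-1) (ocomp P (odif P h) i y))) (osmul P (-1) (ocomp P (odif P x') i g))"
    unfolding leibniz_def
    by (simp only: comp_add_left[OF xs(2) m(1) xs(3) i] comp_smul_left[OF dh xs(3) i]
        comp_smul_left[OF dif_closed[OF x'] hg(2) i])
  have 3: "leibniz x' h i (odif P y) (oadd P f (osmul P (-1) (odif P g)))
    = oadd P (ocomp P h i (odif P y)) (oadd P (osmul P ?s (ocomp P x i f)) (osmul P (-1) (ocomp P x' i (odif P g))))"
    unfolding leibniz_def
    by (simp only: comp_add_right[OF x' xs(4) m(2) i] comp_smul_right[OF x' dg i])
      (simp only: x'_def comp_smul_left[OF xs(1,4) i])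
  note R = add_closed[where n="?N" and p="?D"] smul_closed[where n="?N" and p="?D"]
    smul_add[where n="?N" and p="?D"] smul_smul[where n="?N" and p="?D"]
    one_smul[where n="?N" and p="?D"] add_assoc[where n="?N" and p="?D"]
    add_comm[where n="?N" and p="?D"] add_left_commute[where n="?N" and p="?D"]
  show ?thesis
    unfolding 1 2 3 unfolding leibniz_def by (simp del: One_nat_def add: R C ss)
qed

lemma leibniz_zero_right:
  assumes "e \<in> ocar P m a" "y \<in> ocar P n q" "x \<in> ocar P m p" "1 \<le> i" "i \<le> m" "a + q = p + b"
  shows "leibniz x e i y (ozero P n b) = ocomp P e i y"
  unfolding leibniz_def using assms add_zero[OF comp_closed[OF assms(1,2,4,5)]] by (simp add: comp_zero_right)

lemma leibniz_zero_left:
  assumes "f \<in> ocar P n b" "y \<in> ocar P n q" "x \<in> ocar P m p" "1 \<le> i" "i \<le> m" "a + q = p + b"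
  shows "leibniz x (ozero P m a) i y f = ocomp P x i f"
  unfolding leibniz_def using assms zero_add[OF comp_closed[OF assms(3,1,4,5)]] by (simp add: comp_zero_left)

lemma path_simps:
  "(x, x', e, h) \<in> ocar (first_order_path P) n p \<longleftrightarrow>
     x \<in> ocar P n p \<and> x' = osmul P (koszul 1 p) x \<and> e \<in> ocar P n p \<and> h \<in> ocar P n (p - 1)"
  "ozero (first_order_path P) n p = (ozero P n p, ozero P n p, ozero P n p, ozero P n (p - 1))"
  "oadd (first_order_path P) (x, x', e, h) (y, y', f, g) = (oadd P x y, oadd P x' y', oadd P e f, oadd P h g)"
  "osmul (first_order_path P) c (x, x', e, h) = (osmul P c x, osmul P c x', osmul P c e, osmul P c h)"
  "oone (first_order_path P) = (oone P, oone P, ozero P 1 0, ozero P 1 (-1))"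
  "ocomp (first_order_path P) (x, x', e, h) i (y, y', f, g)
    = (ocomp P x i y, ocomp P x' i y', leibniz x e i y f, leibniz x' h i y g)"
  "oact (first_order_path P) (x, x', e, h) \<sigma> = (oact P x \<sigma>, oact P x' \<sigma>, oact P e \<sigma>, oact P h \<sigma>)"
  "odif (first_order_path P) (x, x', e, h)
    = (odif P x, osmul P (-1) (odif P x'), odif P e, oadd P e (osmul P (-1) (odif P h)))"
  by (auto simp: first_order_path_def leibniz_def)

lemma comp_signed:
  assumes "x \<in> ocar P m p" "y \<in> ocar P n q" "1 \<le> i" "i \<le> m"
  shows "ocomp P (osmul P (koszul 1 p) x) i (osmul P (koszul 1 q) y) = osmul P (koszul 1 (p + q)) (ocomp P x i y)"
  unfolding comp_smul_left[OF assms(1) smul_closed[OF assms(2)] assms(3,4)] comp_smul_right[OF assms]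
    smul_smul[OF comp_closed[OF assms]] koszul_add_right ..

text \<open>
  The first two entries repeat the axioms of \<open>P\<close>. The entry at \<open>\<epsilon>\<close> is a derivation of degree 0 over
  the first one, and the entry at \<open>d\<epsilon>\<close> is a derivation of degree \<open>-1\<close> over the second one.
\<close>

theorem first_order_path_dg_operad: "dg_operad (first_order_path P)"
proof (standard, goal_cases)
  case (1 n p) show ?case by (simp add: path_simps zero_closed smul_zero)
next
  case (2 x n p y) then show ?case by (cases x; cases y) (simp add: path_simps add_closed[of _ n p] add_closed[of _ n "p - 1"] smul_add[of _ n p] smul_add[of _ n "p - 1"])
next
  case (3 x n p c) then show ?case by (cases x) (simp add: path_simps smul_closed[of _ n p] smul_closed[of _ n "p - 1"] smul_smul[of _ n p] smul_smul[of _ n "p - 1"] mult.commute)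
next
  case 4 then show ?case using one_closed
    by (simp add: path_simps zero_closed one_smul koszul_def del: One_nat_def)
next
  case (5 x m p y n q i)
  then obtain x0 e h y0 f g where [simp]: "x = (x0, osmul P (koszul 1 p) x0, e, h)" "y = (y0, osmul P (koszul 1 q) y0, f, g)"
    and c: "x0 \<in> ocar P m p" "y0 \<in> ocar P n q" "e \<in> ocar P m p" "h \<in> ocar P m (p - 1)" "f \<in> ocar P n q" "g \<in> ocar P n (q - 1)"
    by (cases x; cases y) (auto simp: path_simps)
  show ?case unfolding path_simps \<open>x = _\<close> \<open>y = _\<close> using 5(3,4) c
    by (intro conjI comp_signed comp_closed leibniz_closed[of x0 m p _ p _ n q _ q]
      leibniz_closed[of "osmul P (koszul 1 p) x0" m p _ "p - 1" _ n q _ "q - 1"] smul_closed) auto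
next
  case (6 x n p \<sigma>) then show ?case by (cases x) (simp add: path_simps act_closed[of _ n p] act_closed[of _ n "p - 1"] act_smul[of _ n p] act_smul[of _ n "p - 1"])
next
  case (7 x n p) then show ?case
    using dif_closed[of _ n "p - 1"] dif_closed[of _ n p] smul_closed add_closed dif_smul
    by (cases x) (simp add: path_simps dif_smul[of _ n p] smul_smul[of _ n "p + 1"] koszul_add_right; auto simp: koszul_def)
next
  case (8 x n p y z) then show ?case by (cases x; cases y; cases z) (simp add: path_simps add_assoc[of _ n p] add_assoc[of _ n "p - 1"] smul_closed[of _ n p] smul_closed[of _ n "p - 1"])
next
  case (9 x n p y) then show ?case by (cases x; cases y) (simp add: path_simps add_comm[of _ n p] add_comm[of _ n "p - 1"] smul_closed[of _ n p] smul_closed[of _ n "p - 1"])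
next
  case (10 x n p) then show ?case by (cases x) (simp add: path_simps add_zero[of _ n p] add_zero[of _ n "p - 1"] smul_closed[of _ n p] smul_closed[of _ n "p - 1"])
next
  case (11 x n p) then show ?case by (cases x) (simp add: path_simps add_neg[of _ n p] add_neg[of _ n "p - 1"] smul_closed[of _ n p] smul_closed[of _ n "p - 1"])
next
  case (12 x n p y c) then show ?case by (cases x; cases y) (simp add: path_simps smul_add[of _ n p] smul_add[of _ n "p - 1"] smul_closed[of _ n p] smul_closed[of _ n "p - 1"])
next
  case (13 x n p b c) then show ?case by (cases x) (simp add: path_simps add_smul[of _ n p] add_smul[of _ n "p - 1"] smul_closed[of _ n p] smul_closed[of _ n "p - 1"])
next
  case (14 x n p b c) then show ?case by (cases x) (simp add: path_simps smul_smul[of _ n p] smul_smul[of _ n "p - 1"] smul_closed[of _ n p] smul_closed[of _ n "p - 1"] mult.assoc)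
next
  case (15 x n p) then show ?case by (cases x) (simp add: path_simps one_smul[of _ n p] one_smul[of _ n "p - 1"] smul_closed[of _ n p] smul_closed[of _ n "p - 1"])
next
  case (16 x m p x' y n q i)
  obtain x0 x1 e h where x: "x = (x0, x1, e, h)" by (cases x)
  obtain y0 y1 f g where y: "y = (y0, y1, f, g)" by (cases y)
  obtain z0 z1 e' h' where z: "x' = (z0, z1, e', h')" by (cases x')
  show ?case using 16 unfolding x y z path_simps
    by (simp del: One_nat_def add: comp_add_left[of _ m p _ _ n q] smul_closed leibniz_add_left[of _ m p _ p _ _ _ n q _ q]
        leibniz_add_left[of _ m p _ "p - 1" _ _ _ n q _ "q - 1"])
next
  case (17 x m p y n q y' i)
  obtain x0 x1 e h where x: "x = (x0, x1, e, h)" by (cases x)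
  obtain y0 y1 f g where y: "y = (y0, y1, f, g)" by (cases y)
  obtain z0 z1 e' h' where z: "y' = (z0, z1, e', h')" by (cases y')
  show ?case using 17 unfolding x y z path_simps
    by (simp del: One_nat_def add: comp_add_right[of _ m p _ n q] smul_closed leibniz_add_right[of _ m p _ p _ n q _ q]
        leibniz_add_right[of _ m p _ "p - 1" _ n q _ "q - 1"])
next
  case (18 x m p y n q i c)
  obtain x0 x1 e h where x: "x = (x0, x1, e, h)" by (cases x)
  obtain y0 y1 f g where y: "y = (y0, y1, f, g)" by (cases y)
  show ?case using 18 unfolding x y path_simps
    by (simp del: One_nat_def add: comp_smul_left[of _ m p _ n q] smul_closed leibniz_smul_left[of _ m p _ p _ n q _ q]
        leibniz_smul_left[of _ m p _ "p - 1" _ n q _ "q - 1"])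
next
  case (19 x m p y n q i c)
  obtain x0 x1 e h where x: "x = (x0, x1, e, h)" by (cases x)
  obtain y0 y1 f g where y: "y = (y0, y1, f, g)" by (cases y)
  show ?case using 19 unfolding x y path_simps
    by (simp del: One_nat_def add: comp_smul_right[of _ m p _ n q] smul_closed leibniz_smul_right[of _ m p _ p _ n q _ q]
        leibniz_smul_right[of _ m p _ "p - 1" _ n q _ "q - 1"])
next
  case (20 x n p y \<sigma>) then show ?case by (cases x; cases y) (simp add: path_simps act_add[of _ n p] act_add[of _ n "p - 1"] smul_closed[of _ n p] smul_closed[of _ n "p - 1"])
next
  case (21 x n p \<sigma> c) then show ?case by (cases x) (simp add: path_simps act_smul[of _ n p] act_smul[of _ n "p - 1"] smul_closed[of _ n p] smul_closed[of _ n "p - 1"])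
next
  case (22 x n p y)
  obtain x0 x1 e h where x: "x = (x0, x1, e, h)" by (cases x)
  obtain y0 y1 f g where y: "y = (y0, y1, f, g)" by (cases y)
  have c: "x0 \<in> ocar P n p" "y0 \<in> ocar P n p" "x1 \<in> ocar P n p" "y1 \<in> ocar P n p" "e \<in> ocar P n p" "f \<in> ocar P n p"
    "h \<in> ocar P n (p - 1)" "g \<in> ocar P n (p - 1)"
    using 22 by (auto simp: x y path_simps smul_closed)
  have d: "odif P h \<in> ocar P n p" "odif P g \<in> ocar P n p" using dif_closed[OF c(7)] dif_closed[OF c(8)] by simp_all
  show ?case unfolding x y path_simps using c d
    add_swap[OF c(5,6) smul_closed[OF d(1)] smul_closed[OF d(2)]]
    by (simp add: dif_add[of _ n "p - 1"] dif_add[of _ n p] smul_add[of _ n "p + 1"] smul_add[of _ n p] dif_closed)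
next
  case (23 x n p c)
  obtain x0 x1 e h where x: "x = (x0, x1, e, h)" by (cases x)
  have c: "x0 \<in> ocar P n p" "x1 \<in> ocar P n p" "e \<in> ocar P n p" "h \<in> ocar P n (p - 1)"
    using 23 by (auto simp: x path_simps smul_closed)
  have d: "odif P h \<in> ocar P n p" using dif_closed[OF c(4)] by simp
  show ?case unfolding x path_simps using c d smul_closed[OF d]
    by (simp add: dif_smul[of _ n "p - 1"] dif_smul[of _ n p] smul_add[of _ n p] smul_smul[of _ n p]
      smul_smul[of _ n "p + 1"] dif_closed)
next
  case (24 x n p) then show ?case by (cases x) (simp add: path_simps act_id[of _ n p] act_id[of _ n "p - 1"] smul_closed[of _ n p] smul_closed[of _ n "p - 1"])
next
  case (25 x n p \<sigma> \<tau>) then show ?case by (cases x) (simp add: path_simps act_act[of _ n p] act_act[of _ n "p - 1"] smul_closed[of _ n p] smul_closed[of _ n "p - 1"])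
next
  case (26 x m p y n q i \<sigma> \<tau>)
  obtain x0 x1 e h where x: "x = (x0, x1, e, h)" by (cases x)
  obtain y0 y1 f g where y: "y = (y0, y1, f, g)" by (cases y)
  show ?case using 26 unfolding x y path_simps
    by (simp del: One_nat_def add: comp_act[of _ m p _ n q] smul_closed leibniz_act[of _ m p _ p _ n q _ q]
        leibniz_act[of _ m p _ "p - 1" _ n q _ "q - 1"])
next
  case (27 x m p i)
  obtain x0 x1 e h where x: "x = (x0, x1, e, h)" by (cases x)
  show ?case using 27 unfolding x path_simps
    by (simp del: One_nat_def add: comp_one[of _ m p] comp_one[of _ m "p - 1"] smul_closed one_closed
      leibniz_zero_right[of _ m p _ 1 0 _ p] leibniz_zero_right[of _ m "p - 1" _ 1 0 _ p])
next
  case (28 x n p)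
  obtain x0 x1 e h where x: "x = (x0, x1, e, h)" by (cases x)
  show ?case using 28 unfolding x path_simps
    by (simp del: One_nat_def add: one_comp[of _ n p] one_comp[of _ n "p - 1"] smul_closed one_closed
      leibniz_zero_left[of _ n p _ p _ 1 0] leibniz_zero_left[of _ n "p - 1" _ p _ 1 0])
next
  case (29 x l p y m q z n r i j)
  obtain x0 x1 e h where x: "x = (x0, x1, e, h)" by (cases x)
  obtain y0 y1 f g where y: "y = (y0, y1, f, g)" by (cases y)
  obtain z0 z1 e' h' where z: "z = (z0, z1, e', h')" by (cases z)
  show ?case using 29 unfolding x y z path_simps
    by (simp del: One_nat_def add: comp_seq[of _ l p _ m q _ n r] smul_closed
        leibniz_seq[of _ l p _ p _ m q _ _ q _ n r _ r]
        leibniz_seq[of _ l p _ "p - 1" _ m q _ _ "q - 1" _ n r _ "r - 1"])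
next
  case (30 x l p y m q z n r i j)
  obtain x0 x1 e h where x: "x = (x0, x1, e, h)" by (cases x)
  obtain y0 y1 f g where y: "y = (y0, y1, f, g)" by (cases y)
  obtain z0 z1 e' h' where z: "z = (z0, z1, e', h')" by (cases z)
  have c: "x0 \<in> ocar P l p" "x1 \<in> ocar P l p" "e \<in> ocar P l p" "h \<in> ocar P l (p - 1)"
    "y0 \<in> ocar P m q" "y1 = osmul P (koszul 1 q) y0" "y1 \<in> ocar P m q" "f \<in> ocar P m q" "g \<in> ocar P m (q - 1)"
    "z0 \<in> ocar P n r" "z1 = osmul P (koszul 1 r) z0" "z1 \<in> ocar P n r" "e' \<in> ocar P n r" "h' \<in> ocar P n (r - 1)"
    using 30(1-3) by (auto simp: x y z path_simps smul_closed)
  note ij = 30(4-6)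
  have E: "leibniz (ocomp P x0 i y0) (leibniz x0 e i y0 f) (j + m - 1) z0 e'
    = osmul P (koszul q r) (leibniz (ocomp P x0 j z0) (leibniz x0 e j z0 e') i y0 f)"
    using leibniz_par[OF c(1,3,5,8,10,13) ij, of 1 1] one_smul[OF c(5)] one_smul[OF c(10)] by simp
  have H: "leibniz (ocomp P x1 i y1) (leibniz x1 h i y0 g) (j + m - 1) z0 h'
    = osmul P (koszul q r) (leibniz (ocomp P x1 j z1) (leibniz x1 h j z0 h') i y0 g)"
    unfolding c(6,11) by (rule leibniz_par[OF c(2,4,5,9,10,14) ij]) (auto simp: koszul_def)
  show ?case unfolding x y z path_simps
    using comp_par[OF c(1,5,10) ij] comp_par[OF c(2,7,12) ij] E H by simp
next
  case (31 x n p)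
  obtain x0 x1 e h where x: "x = (x0, x1, e, h)" by (cases x)
  have c: "x0 \<in> ocar P n p" "x1 \<in> ocar P n p" "e \<in> ocar P n p" "h \<in> ocar P n (p - 1)"
    using 31 by (auto simp: x path_simps smul_closed)
  have d: "odif P h \<in> ocar P n p" "odif P (odif P h) = ozero P n (p + 1)"
    using dif_closed[OF c(4)] dif_dif[OF c(4)] by (simp_all add: add.commute)
  have "oadd P e (osmul P (- 1) (odif P h)) \<in> ocar P n p" using c d add_closed smul_closed by blast
  then have "odif P (oadd P e (osmul P (- 1) (odif P h))) = odif P e"
    using c d dif_add[of e n p "osmul P (- 1) (odif P h)"] smul_closed[OF d(1)]
    by (simp add: dif_smul[of _ n p] smul_zero add_zero[OF dif_closed])
  then show ?case unfolding x path_simps using c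
    by (simp add: dif_dif[of _ n p] dif_smul[of _ n "p + 1"] dif_closed smul_zero add_neg[of _ n "p + 1"] add.commute[of 1 p])
next
  case (32 x n p \<sigma>)
  obtain x0 x1 e h where x: "x = (x0, x1, e, h)" by (cases x)
  have c: "x0 \<in> ocar P n p" "x1 \<in> ocar P n p" "e \<in> ocar P n p" "h \<in> ocar P n (p - 1)"
    using 32 by (auto simp: x path_simps smul_closed)
  have d: "odif P h \<in> ocar P n p"
    using dif_closed[OF c(4)] by simp_all
  show ?case unfolding x path_simps using c d 32(2)
    by (simp del: One_nat_def add: dif_act[of _ n p] dif_act[of _ n "p - 1"] act_add[of _ n p] act_smul[of _ n p]
       act_smul[of _ n "p + 1"] dif_closed smul_closed)
next
  case (33 x m p y n q i)
  obtain x0 x1 e h where x: "x = (x0, x1, e, h)" by (cases x)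
  obtain y0 y1 f g where y: "y = (y0, y1, f, g)" by (cases y)
  have c: "x0 \<in> ocar P m p" "x1 \<in> ocar P m p" "e \<in> ocar P m p" "h \<in> ocar P m (p - 1)" "x1 = osmul P (koszul 1 p) x0"
    "y0 \<in> ocar P n q" "y1 \<in> ocar P n q" "f \<in> ocar P n q" "g \<in> ocar P n (q - 1)"
    using 33(1,2) by (auto simp: x y path_simps smul_closed)
  note i = 33(3,4)
  let ?D = "p + q + 1" and ?N = "m + n - 1"
  have C: "ocomp P (odif P x1) i y1 \<in> ocar P ?N ?D" "ocomp P x1 i (odif P y1) \<in> ocar P ?N ?D"
    by (rule comp_in[OF dif_closed[OF c(2)] c(7) i] comp_in[OF c(2) dif_closed[OF c(7)] i]; simp)+
  have X: "osmul P (-1) (odif P (ocomp P x1 i y1)) = oadd P (ocomp P (osmul P (-1) (odif P x1)) i y1)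
      (osmul P (koszul 1 p) (ocomp P x1 i (osmul P (-1) (odif P y1))))"
    by (simp only: dif_comp[OF c(2,7) i] comp_smul_left[OF dif_closed[OF c(2)] c(7) i]
      comp_smul_right[OF c(2) dif_closed[OF c(7)] i] smul_add[OF C(1) smul_closed[OF C(2)]]
      smul_smul[OF C(2)] mult.commute)
  show ?case unfolding x y path_simps
    using dif_comp[OF c(1,6) i] X dif_leibniz[OF c(1,3,6,8) i] dif_leibniz_homotopy[OF c(1,3,6,8,4,9) i, folded c(5)]
    by simp
qed

end

section \<open>Maps in cohomology\<close>

context dg_operad_hom
begin

lemma hom_zero: "\<phi> (ozero P n p) = ozero Q n p"
  using hom_smul[OF P.zero_closed, of 0 n p] hom_closed[OF P.zero_closed, of n p]
  by (simp add: P.smul_zero Q.smul_0)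

end

context dg_operad
begin

lemma coho_class_shift:
  assumes z: "z \<in> ocar P n p" and b: "b \<in> ocar P n (p - 1)"
  shows "coho_class P n p (oadd P z (odif P b)) = coho_class P n p z"
proof -
  have d: "odif P c \<in> ocar P n p" if "c \<in> ocar P n (p - 1)" for c
    using dif_closed[OF that] by simp
  have 1: "oadd P (oadd P z (odif P b)) (odif P c) = oadd P z (odif P (oadd P b c))"
    if c: "c \<in> ocar P n (p - 1)" for c
    using add_assoc[OF z d[OF b] d[OF c]] dif_add[OF b c] by simp
  have 2: "oadd P z (odif P c) = oadd P (oadd P z (odif P b)) (odif P (oadd P (osmul P (-1) b) c))"
    if c: "c \<in> ocar P n (p - 1)" for c
  proof -
    note nb = smul_closed[OF b, of "-1"]
    have "oadd P b (oadd P (osmul P (-1) b) c) = c"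
      using add_assoc[OF b nb c] add_neg[OF b] zero_add[OF c] by simp
    then show ?thesis using 1[OF add_closed[OF nb c]] by simp
  qed
  show ?thesis
    unfolding coho_class_def coboundaries_def image_image
  proof (intro equalityI image_subsetI)
    fix c assume c: "c \<in> ocar P n (p - 1)"
    show "oadd P (oadd P z (odif P b)) (odif P c) \<in> (\<lambda>x. oadd P z (odif P x)) ` ocar P n (p - 1)"
      using 1[OF c] add_closed[OF b c] by blast
    show "oadd P z (odif P c) \<in> (\<lambda>x. oadd P (oadd P z (odif P b)) (odif P x)) ` ocar P n (p - 1)"
      using 2[OF c] add_closed[OF smul_closed[OF b] c] by blast
  qed
qed

lemma coho_class_self: "z \<in> ocar P n p \<Longrightarrow> z \<in> coho_class P n p z"
  using add_zero[of z n p] dif_zero[of n "p - 1"] zero_closed[of n "p - 1"]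
  unfolding coho_class_def coboundaries_def by force

lemma coho_class_mem: "z \<in> coho_class P n p y \<longleftrightarrow> (\<exists>b\<in>ocar P n (p - 1). z = oadd P y (odif P b))"
  unfolding coho_class_def coboundaries_def by blast

end

lemma (in dg_operad_hom) coho_map_class:
  assumes z: "z \<in> ocar P n p"
  shows "coho_map Q \<phi> n p (coho_class P n p z) = coho_class Q n p (\<phi> z)"
proof -
  have "coho_class Q n p (\<phi> y) = coho_class Q n p (\<phi> z)" if y: "y \<in> coho_class P n p z" for y
  proof -
    obtain b where b: "b \<in> ocar P n (p - 1)" "y = oadd P z (odif P b)" using y P.coho_class_mem by blast
    have "odif P b \<in> ocar P n p" using P.dif_closed[OF b(1)] by simp
    then have "\<phi> y = oadd Q (\<phi> z) (odif Q (\<phi> b))" using hom_add[OF z] hom_dif[OF b(1)] b(2) by simp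
    then show ?thesis using Q.coho_class_shift hom_closed z b(1) by simp
  qed
  then show ?thesis using P.coho_class_self[OF z] unfolding coho_map_def by blast
qed

text \<open>
  The retraction gives injectivity. It also gives surjectivity, since an element \<open>c\<close> of \<open>P\<close> for which
  \<open>\<phi> c\<close> is a cocycle is a cocycle itself: \<open>c = \<psi> (\<phi> c)\<close>.
\<close>

theorem quasi_iso_if_retraction:
  assumes \<phi>: "dg_operad_hom P Q \<phi>" and \<psi>: "dg_operad_hom Q P \<psi>"
    and retr: "\<And>n p x. x \<in> ocar P n p \<Longrightarrow> \<psi> (\<phi> x) = x"
    and cohomologous: "\<And>n p z. z \<in> cocycles Q n p
      \<Longrightarrow> \<exists>c\<in>ocar P n p. \<exists>b\<in>ocar Q n (p - 1). z = oadd Q (\<phi> c) (odif Q b)"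
  shows "quasi_iso P Q \<phi>"
proof -
  interpret \<phi>: dg_operad_hom P Q \<phi> by (rule \<phi>)
  interpret \<psi>: dg_operad_hom Q P \<psi> by (rule \<psi>)
  have "bij_betw (coho_map Q \<phi> n p) (cohomology P n p) (cohomology Q n p)" for n p
    unfolding bij_betw_def
  proof
    show "inj_on (coho_map Q \<phi> n p) (cohomology P n p)"
    proof (rule inj_onI)
      fix u v assume "u \<in> cohomology P n p" "v \<in> cohomology P n p"
        and e: "coho_map Q \<phi> n p u = coho_map Q \<phi> n p v"
      then obtain y z where y: "y \<in> ocar P n p" "u = coho_class P n p y"
        and z: "z \<in> ocar P n p" "v = coho_class P n p z"
        unfolding cohomology_def cocycles_def by blast
      have "\<phi> y \<in> coho_class Q n p (\<phi> z)"
        using e \<phi>.coho_map_class y z \<phi>.Q.coho_class_self[OF \<phi>.hom_closed[OF y(1)]] by simp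
      then obtain b where b: "b \<in> ocar Q n (p - 1)" "\<phi> y = oadd Q (\<phi> z) (odif Q b)"
        using \<phi>.Q.coho_class_mem by blast
      have "odif Q b \<in> ocar Q n p" using \<phi>.Q.dif_closed[OF b(1)] by simp
      then have "\<psi> (\<phi> y) = oadd P (\<psi> (\<phi> z)) (odif P (\<psi> b))"
        using b \<psi>.hom_add[OF \<phi>.hom_closed[OF z(1)]] \<psi>.hom_dif[OF b(1)] by simp
      then have "y = oadd P z (odif P (\<psi> b))" using retr y(1) z(1) by simp
      then show "u = v"
        using \<phi>.P.coho_class_shift[OF z(1) \<psi>.hom_closed[OF b(1)]] y(2) z(2) by simp
    qed
    show "coho_map Q \<phi> n p ` cohomology P n p = cohomology Q n p"
    proof (intro equalityI subsetI)
      fix u assume "u \<in> coho_map Q \<phi> n p ` cohomology P n p"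
      then obtain z where z: "z \<in> ocar P n p" "odif P z = ozero P n (p + 1)"
        "u = coho_map Q \<phi> n p (coho_class P n p z)"
        unfolding cohomology_def cocycles_def by blast
      have "odif Q (\<phi> z) = ozero Q n (p + 1)"
        using \<phi>.hom_dif[OF z(1)] z(2) \<phi>.hom_zero by simp
      then show "u \<in> cohomology Q n p"
        using \<phi>.coho_map_class[OF z(1)] z(3) \<phi>.hom_closed[OF z(1)]
        unfolding cohomology_def cocycles_def by blast
    next
      fix u assume "u \<in> cohomology Q n p"
      then obtain z where z: "z \<in> cocycles Q n p" "u = coho_class Q n p z"
        unfolding cohomology_def by blast
      obtain c b where c: "c \<in> ocar P n p" and b: "b \<in> ocar Q n (p - 1)" and e: "z = oadd Q (\<phi> c) (odif Q b)"
        using cohomologous[OF z(1)] by blast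
      note c' = \<phi>.hom_closed[OF c]
      have db: "odif Q b \<in> ocar Q n p" using \<phi>.Q.dif_closed[OF b] by simp
      have "odif Q z = oadd Q (odif Q (\<phi> c)) (ozero Q n (p + 1))"
        unfolding e using \<phi>.Q.dif_add[OF c' db] \<phi>.Q.dif_dif[OF b] by (simp add: add.commute)
      then have "odif Q (\<phi> c) = ozero Q n (p + 1)"
        using z(1) \<phi>.Q.add_zero[OF \<phi>.Q.dif_closed[OF c']] by (simp add: cocycles_def)
      then have "odif P (\<psi> (\<phi> c)) = ozero P n (p + 1)"
        using \<psi>.hom_dif[OF c'] \<psi>.hom_zero by simp
      then have "c \<in> cocycles P n p" using c retr[OF c] by (simp add: cocycles_def)
      moreover have "u = coho_map Q \<phi> n p (coho_class P n p c)"
        using z(2) e \<phi>.Q.coho_class_shift[OF c' b] \<phi>.coho_map_class[OF c] by simp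
      ultimately show "u \<in> coho_map Q \<phi> n p ` cohomology P n p"
        unfolding cohomology_def by blast
    qed
  qed
  then show ?thesis using \<phi> unfolding quasi_iso_def by blast
qed

section \<open>Weights\<close>

text \<open>
  An expression in which every summand contains generators of total weight \<open>w\<close>. The zero
  expression has every weight, so the weight is a relation and not a function.
\<close>

inductive homogeneous :: "('g \<Rightarrow> nat) \<Rightarrow> ('g, 'k) opterm \<Rightarrow> nat \<Rightarrow> bool" for wt where
  homogeneous_Gen: "homogeneous wt (Gen g) (wt g)"
| homogeneous_Zero: "homogeneous wt (Zero n p) w"
| homogeneous_Add: "\<lbrakk>homogeneous wt s w; homogeneous wt t w\<rbrakk> \<Longrightarrow> homogeneous wt (Add s t) w"
| homogeneous_Smul: "homogeneous wt t w \<Longrightarrow> homogeneous wt (Smul c t) w"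
| homogeneous_Ident: "homogeneous wt Ident 0"
| homogeneous_Comp: "\<lbrakk>homogeneous wt s v; homogeneous wt t w\<rbrakk> \<Longrightarrow> homogeneous wt (Comp s i t) (v + w)"
| homogeneous_Act: "homogeneous wt t w \<Longrightarrow> homogeneous wt (Act t \<sigma>) w"
| homogeneous_Dif: "homogeneous wt t w \<Longrightarrow> homogeneous wt (Dif t) w"

inductive_simps homogeneous_simps:
  "homogeneous wt (Gen g) w" "homogeneous wt (Zero n p) w" "homogeneous wt (Add s t) w"
  "homogeneous wt (Smul c t) w" "homogeneous wt Ident w" "homogeneous wt (Comp s i t) w"
  "homogeneous wt (Act t \<sigma>) w" "homogeneous wt (Dif t) w"

primrec dif_free :: "('g, 'k) opterm \<Rightarrow> bool" where
  "dif_free (Gen g) = True"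
| "dif_free (Zero n p) = True"
| "dif_free (Add s t) = (dif_free s \<and> dif_free t)"
| "dif_free (Smul c t) = dif_free t"
| "dif_free Ident = True"
| "dif_free (Comp s i t) = (dif_free s \<and> dif_free t)"
| "dif_free (Act t \<sigma>) = dif_free t"
| "dif_free (Dif t) = False"

context dg_operad
begin

text \<open>
  The values on the generators of the path \<open>x + \<epsilon> E(x) + d\<epsilon> h(x)\<close>: \<open>E\<close> multiplies a generator by
  its weight, and \<open>h\<close> is zero. On the differential of a generator \<open>g\<close> the differential of
  \<open>first_order_path P\<close> then forces \<open>h(d g) = E(g)\<close>.
\<close>

definition weight_path :: "('g, 'k) presentation \<Rightarrow> ('g \<Rightarrow> nat) \<Rightarrow> ('g \<Rightarrow> 'a) \<Rightarrow> 'g \<Rightarrow> 'a \<times> 'a \<times> 'a \<times> 'a" where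
  "weight_path X wt \<gamma> g = (\<gamma> g, osmul P (koszul 1 (pdeg X g)) (\<gamma> g), osmul P (of_nat (wt g)) (\<gamma> g),
     ozero P (par X g) (pdeg X g - 1))"

lemma weight_path_closed:
  "\<gamma> g \<in> ocar P (par X g) (pdeg X g) \<Longrightarrow> weight_path X wt \<gamma> g \<in> ocar (first_order_path P) (par X g) (pdeg X g)"
  unfolding weight_path_def path_simps by (simp add: smul_closed zero_closed)

text \<open>
  These properties are proved for the evaluation of expressions, before anything is known about
  relations; they are used to check that the relations are respected.
\<close>

lemma opeval_weight_path:
  assumes gens: "\<And>g. g \<in> pgens X \<Longrightarrow> \<gamma> g \<in> ocar P (par X g) (pdeg X g)" and t: "typed X t n p"
  obtains e h where "opeval (first_order_path P) (weight_path X wt \<gamma>) t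
      = (opeval P \<gamma> t, osmul P (koszul 1 p) (opeval P \<gamma> t), e, h)"
    "e \<in> ocar P n p" "h \<in> ocar P n (p - 1)"
    "\<And>w. homogeneous wt t w \<Longrightarrow> e = osmul P (of_nat w) (opeval P \<gamma> t)"
    "dif_free t \<Longrightarrow> h = ozero P n (p - 1)"
proof -
  interpret R: dg_operad "first_order_path P" by (rule first_order_path_dg_operad)
  let ?V = "opeval (first_order_path P) (weight_path X wt \<gamma>)"
  have C: "opeval P \<gamma> t \<in> ocar P n p" if "typed X t n p" for t n p
    using that by (rule opeval_closed[rotated]) (rule gens)
  have RC: "?V t \<in> ocar (first_order_path P) n p" if "typed X t n p" for t n p
    using that by (rule R.opeval_closed[rotated]) (rule weight_path_closed[OF gens])
  have 1: "fst (?V t) = opeval P \<gamma> t" for t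
  proof (induction t)
    case (Comp s i t)
    then show ?case by (cases "?V s"; cases "?V t") (simp add: path_simps)
  next
    case (Add s t)
    then show ?case by (cases "?V s"; cases "?V t") (simp add: path_simps)
  next
    case (Smul c t)
    then show ?case by (cases "?V t") (simp add: path_simps)
  next
    case (Act t \<sigma>)
    then show ?case by (cases "?V t") (simp add: path_simps)
  next
    case (Dif t)
    then show ?case by (cases "?V t") (simp add: path_simps)
  qed (simp_all add: path_simps weight_path_def)
  have V: "\<exists>e h. ?V t = (opeval P \<gamma> t, osmul P (koszul 1 p) (opeval P \<gamma> t), e, h)
      \<and> e \<in> ocar P n p \<and> h \<in> ocar P n (p - 1)" if "typed X t n p" for t n p
    using 1[of t] RC[OF that] by (cases "?V t") (auto simp: path_simps)
  have 2: "fst (snd (snd (?V t))) = osmul P (of_nat w) (opeval P \<gamma> t)"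
    if "typed X t n p" "homogeneous wt t w" for t n p w
    using that
  proof (induction arbitrary: w rule: typed.induct)
    case (typed_Gen g)
    then show ?case by (simp add: weight_path_def homogeneous_simps)
  next
    case (typed_Zero n p)
    then show ?case by (simp add: path_simps smul_zero)
  next
    case (typed_Add s n p t)
    then show ?case using V[OF typed_Add(1)] V[OF typed_Add(2)] C[OF typed_Add(1)] C[OF typed_Add(2)]
      by (auto simp: path_simps homogeneous_simps smul_add)
  next
    case (typed_Smul t n p c)
    then show ?case using V[OF typed_Smul(1)] C[OF typed_Smul(1)]
      by (auto simp: path_simps homogeneous_simps smul_smul mult.commute)
  next
    case typed_Ident
    then show ?case using smul_0[OF one_closed] by (auto simp: path_simps homogeneous_simps)
  next
    case (typed_Comp s m p t n q i)
    from typed_Comp.prems obtain v u where w: "w = v + u" "homogeneous wt s v" "homogeneous wt t u"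
      by (auto simp: homogeneous_simps)
    note c = C[OF typed_Comp(1)] C[OF typed_Comp(2)]
    show ?case using V[OF typed_Comp(1)] V[OF typed_Comp(2)] c typed_Comp.IH(1)[OF w(2)] typed_Comp.IH(2)[OF w(3)]
        comp_smul_left[OF c typed_Comp(3,4)] comp_smul_right[OF c typed_Comp(3,4)]
        add_smul[OF comp_closed[OF c typed_Comp(3,4)], of "of_nat v" "of_nat u"]
      by (auto simp: path_simps leibniz_def w(1))
  next
    case (typed_Act t n p \<sigma>)
    then show ?case using V[OF typed_Act(1)] C[OF typed_Act(1)]
      by (auto simp: path_simps homogeneous_simps act_smul)
  next
    case (typed_Dif t n p)
    then show ?case using V[OF typed_Dif(1)] C[OF typed_Dif(1)]
      by (auto simp: path_simps homogeneous_simps dif_smul)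
  qed
  have 3: "snd (snd (snd (?V t))) = ozero P n (p - 1)"
    if "typed X t n p" "dif_free t" for t n p
    using that
  proof (induction rule: typed.induct)
    case (typed_Gen g)
    then show ?case by (simp add: weight_path_def)
  next
    case (typed_Zero n p)
    then show ?case by (simp add: path_simps)
  next
    case (typed_Add s n p t)
    then show ?case using V[OF typed_Add(1)] V[OF typed_Add(2)]
      by (auto simp: path_simps add_zero zero_closed)
  next
    case (typed_Smul t n p c)
    then show ?case using V[OF typed_Smul(1)] by (auto simp: path_simps smul_zero)
  next
    case typed_Ident
    then show ?case by (auto simp: path_simps)
  next
    case (typed_Comp s m p t n q i)
    note c = C[OF typed_Comp(1)] C[OF typed_Comp(2)]
    show ?case using V[OF typed_Comp(1)] V[OF typed_Comp(2)] typed_Comp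
        leibniz_zero_left[OF zero_closed c(2) smul_closed[OF c(1)] typed_Comp(3,4), of "p - 1" "q - 1" "koszul 1 p"]
        comp_zero_right[OF smul_closed[OF c(1)] typed_Comp(3,4), of "koszul 1 p" n "q - 1"]
      by (auto simp: path_simps add_diff_eq)
  next
    case (typed_Act t n p \<sigma>)
    then show ?case using V[OF typed_Act(1)] by (auto simp: path_simps act_zero)
  qed simp
  obtain e h where "?V t = (opeval P \<gamma> t, osmul P (koszul 1 p) (opeval P \<gamma> t), e, h)"
      "e \<in> ocar P n p" "h \<in> ocar P n (p - 1)"
    using V[OF t] by blast
  then show thesis using that[of e h] 2[OF t] 3[OF t] by simp
qed

end

lemma presented_hom_exists:
  assumes Q: "dg_operad Q"
    and gens: "\<And>g. g \<in> pgens X \<Longrightarrow> \<gamma> g \<in> ocar Q (par X g) (pdeg X g)"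
    and rels: "\<And>r n p. \<lbrakk>r \<in> prels X; typed X r n p\<rbrakk> \<Longrightarrow> opeval Q \<gamma> r = ozero Q n p"
  shows "\<exists>\<phi>. dg_operad_hom (presented X) Q \<phi> \<and> (\<forall>g\<in>pgens X. \<phi> (opclass X (Gen g)) = \<gamma> g)"
proof -
  have "\<exists>\<phi>. dg_operad_hom (presented X) Q \<phi> \<and> (\<forall>g\<in>pgens X. \<phi> (opclass X (Gen g)) = \<gamma> g) \<and>
    (\<forall>\<psi>. dg_operad_hom (presented X) Q \<psi> \<and> (\<forall>g\<in>pgens X. \<psi> (opclass X (Gen g)) = \<gamma> g)
       \<longrightarrow> (\<forall>n p. \<forall>x\<in>ocar (presented X) n p. \<psi> x = \<phi> x))"
    by (rule presented_universal[OF Q]) (fact gens rels)+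
  then show ?thesis by blast
qed

lemma hom_opclass:
  assumes h: "dg_operad_hom (presented X) Q \<psi>"
    and g: "\<And>g. g \<in> pgens X \<Longrightarrow> \<psi> (opclass X (Gen g)) = \<gamma> g"
    and t: "typed X t n p"
  shows "\<psi> (opclass X t) = opeval Q \<gamma> t"
proof -
  interpret h: dg_operad_hom "presented X" Q \<psi> by (rule h)
  note O = presented_ops(4-8)
  have car: "typed X t n p \<Longrightarrow> opclass X t \<in> ocar (presented X) n p" for t n p
    by (simp add: presented_ops(1))
  from t show ?thesis
  proof (induction rule: typed.induct)
    case (typed_Gen a)
    then show ?case using g by simp
  next
    case (typed_Zero n p)
    show ?case using h.hom_zero by (simp add: presented_ops(2))
  next
    case (typed_Add s n p t)
    then show ?case using h.hom_add[OF car car] O(1) by (metis opeval.simps(3))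
  next
    case (typed_Smul t n p c)
    then show ?case using h.hom_smul[OF car] O(2) by (metis opeval.simps(4))
  next
    case typed_Ident
    show ?case using h.hom_one by (simp add: presented_ops(3))
  next
    case (typed_Comp s m p t n q i)
    then show ?case using h.hom_comp[OF car car] O(3) by (metis opeval.simps(6))
  next
    case (typed_Act t n p \<sigma>)
    then show ?case using h.hom_act[OF car] O(4) by (metis opeval.simps(7))
  next
    case (typed_Dif t n p)
    then show ?case using h.hom_dif[OF car] O(5) by (metis opeval.simps(8))
  qed
qed

lemma opeval_opclass: "typed X t n p \<Longrightarrow> opeval (presented X) (\<lambda>g. opclass X (Gen g)) t = opclass X t"
  by (induction rule: typed.induct) (simp_all add: presented_ops del: One_nat_def)

inductive homogeneous_sum :: "('g, 'k::field) presentation \<Rightarrow> ('g \<Rightarrow> nat) \<Rightarrow> nat \<Rightarrow> int \<Rightarrow> ('g, 'k) opterm set \<Rightarrow> bool"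
  for X wt where
  homogeneous_sum_single: "\<lbrakk>typed X t n p; homogeneous wt t w\<rbrakk> \<Longrightarrow> homogeneous_sum X wt n p (opclass X t)"
| homogeneous_sum_add: "\<lbrakk>homogeneous_sum X wt n p x; homogeneous_sum X wt n p y\<rbrakk>
    \<Longrightarrow> homogeneous_sum X wt n p (oadd (presented X) x y)"

lemma homogeneous_sum_closed: "homogeneous_sum X wt n p x \<Longrightarrow> x \<in> ocar (presented X) n p"
proof (induction rule: homogeneous_sum.induct)
  case (homogeneous_sum_single t n p w)
  then show ?case by (simp add: presented_ops(1))
next
  case (homogeneous_sum_add n p x y)
  then show ?case using dg_operad.add_closed[OF presented_dg_operad] by blast
qed

lemma homogeneous_sum_linear:
  assumes "homogeneous_sum X wt n p x"
    and "\<And>t w. typed X t n p \<Longrightarrow> homogeneous wt t w \<Longrightarrow> homogeneous_sum X wt m q (F (opclass X t))"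
    and "\<And>x y. x \<in> ocar (presented X) n p \<Longrightarrow> y \<in> ocar (presented X) n p
      \<Longrightarrow> F (oadd (presented X) x y) = oadd (presented X) (F x) (F y)"
  shows "homogeneous_sum X wt m q (F x)"
  using assms
proof (induction rule: homogeneous_sum.induct)
  case (homogeneous_sum_add n p x y)
  then show ?case using homogeneous_sum.homogeneous_sum_add homogeneous_sum_closed by metis
qed

text \<open>Every operation is linear in each argument and maps homogeneous expressions to homogeneous ones.\<close>

lemma homogeneous_sum_opclass: "typed X t n p \<Longrightarrow> homogeneous_sum X wt n p (opclass X t)"
proof (induction rule: typed.induct)
  case (typed_Gen g)
  then show ?case by (rule homogeneous_sum_single[OF typed.typed_Gen homogeneous_Gen])
next
  case (typed_Zero n p)
  then show ?case by (rule homogeneous_sum_single[OF typed.typed_Zero homogeneous_Zero[of _ _ _ 0]])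
next
  case (typed_Add s n p t)
  then show ?case using homogeneous_sum_add presented_ops(4) by metis
next
  case (typed_Smul t n p c)
  have "homogeneous_sum X wt n p (osmul (presented X) c (opclass X t))"
  proof (rule homogeneous_sum_linear[OF typed_Smul.IH])
    fix s w assume s: "typed X s n p" "homogeneous wt s w"
    show "homogeneous_sum X wt n p (osmul (presented X) c (opclass X s))"
      unfolding presented_ops(5)[OF s(1)]
      by (rule homogeneous_sum_single[OF typed.typed_Smul[OF s(1)] homogeneous_Smul[OF s(2)]])
  qed (rule dg_operad.smul_add[OF presented_dg_operad])
  then show ?case using typed_Smul presented_ops(5) by metis
next
  case typed_Ident
  then show ?case by (rule homogeneous_sum_single[OF typed.typed_Ident homogeneous_Ident])
next
  case (typed_Comp s m p t n q i)
  have car: "opclass X u \<in> ocar (presented X) k r" if "typed X u k r" for u k r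
    using that by (simp add: presented_ops(1))
  have "homogeneous_sum X wt (m + n - 1) (p + q) (ocomp (presented X) (opclass X s) i (opclass X t))"
  proof (rule homogeneous_sum_linear[OF typed_Comp.IH(1)])
    fix u v assume u: "typed X u m p" "homogeneous wt u v"
    show "homogeneous_sum X wt (m + n - 1) (p + q) (ocomp (presented X) (opclass X u) i (opclass X t))"
    proof (rule homogeneous_sum_linear[OF typed_Comp.IH(2)])
      fix s w assume s: "typed X s n q" "homogeneous wt s w"
      show "homogeneous_sum X wt (m + n - 1) (p + q) (ocomp (presented X) (opclass X u) i (opclass X s))"
        unfolding presented_ops(6)[OF u(1) s(1) typed_Comp(3,4)]
        by (rule homogeneous_sum_single[OF typed.typed_Comp[OF u(1) s(1) typed_Comp(3,4)] homogeneous_Comp[OF u(2) s(2)]])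
    qed (rule dg_operad.comp_add_right[OF presented_dg_operad car[OF u(1)] _ _ typed_Comp(3,4)])
  qed (rule dg_operad.comp_add_left[OF presented_dg_operad _ _ car[OF typed_Comp(2)] typed_Comp(3,4)])
  then show ?case using presented_ops(6)[OF typed_Comp(1-4)] by simp
next
  case (typed_Act t n p \<sigma>)
  have "homogeneous_sum X wt n p (oact (presented X) (opclass X t) \<sigma>)"
  proof (rule homogeneous_sum_linear[OF typed_Act.IH])
    fix s w assume s: "typed X s n p" "homogeneous wt s w"
    show "homogeneous_sum X wt n p (oact (presented X) (opclass X s) \<sigma>)"
      unfolding presented_ops(7)[OF s(1) typed_Act(2)]
      by (rule homogeneous_sum_single[OF typed.typed_Act[OF s(1) typed_Act(2)] homogeneous_Act[OF s(2)]])
  qed (rule dg_operad.act_add[OF presented_dg_operad _ _ typed_Act(2)])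
  then show ?case using presented_ops(7)[OF typed_Act(1,2)] by simp
next
  case (typed_Dif t n p)
  have "homogeneous_sum X wt n (p + 1) (odif (presented X) (opclass X t))"
  proof (rule homogeneous_sum_linear[OF typed_Dif.IH])
    fix s w assume s: "typed X s n p" "homogeneous wt s w"
    show "homogeneous_sum X wt n (p + 1) (odif (presented X) (opclass X s))"
      unfolding presented_ops(8)[OF s(1)]
      by (rule homogeneous_sum_single[OF typed.typed_Dif[OF s(1)] homogeneous_Dif[OF s(2)]])
  qed (rule dg_operad.dif_add[OF presented_dg_operad])
  then show ?case using presented_ops(8)[OF typed_Dif(1)] by simp
qed

section \<open>Contraction to weight zero\<close>

text \<open>
  This is \<open>\<Prod>\<^sub>w (1 - E/w)\<close> over \<open>1 \<le> w \<le> N\<close>, a polynomial in \<open>E\<close> that projects a sum of elements of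
  weights at most \<open>N\<close> to its part of weight 0. A polynomial in \<open>E\<close> makes sense without knowing
  that the decomposition into weights is unique.
\<close>

primrec weight_zero_part :: "('a, 'k::field) dg_operad_data \<Rightarrow> ('a \<Rightarrow> 'a) \<Rightarrow> nat \<Rightarrow> 'a \<Rightarrow> 'a" where
  "weight_zero_part P E 0 x = x"
| "weight_zero_part P E (Suc N) x = oadd P (weight_zero_part P E N x)
     (osmul P (- inverse (of_nat (Suc N))) (E (weight_zero_part P E N x)))"

text \<open>
  On cocycles, the equation \<open>d h + h d = E\<close> reads \<open>E = d h\<close>.
\<close>

locale weight_homotopy = dg_operad P for P :: "('a, 'k::field_char_0) dg_operad_data" +
  fixes E h :: "'a \<Rightarrow> 'a"
  assumes euler_closed: "x \<in> ocar P n p \<Longrightarrow> E x \<in> ocar P n p"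
    and euler_add: "\<lbrakk>x \<in> ocar P n p; y \<in> ocar P n p\<rbrakk> \<Longrightarrow> E (oadd P x y) = oadd P (E x) (E y)"
    and euler_smul: "x \<in> ocar P n p \<Longrightarrow> E (osmul P c x) = osmul P c (E x)"
    and homotopy_closed: "x \<in> ocar P n p \<Longrightarrow> h x \<in> ocar P n (p - 1)"
    and euler_cocycle: "\<lbrakk>x \<in> ocar P n p; odif P x = ozero P n (p + 1)\<rbrakk> \<Longrightarrow> E x = odif P (h x)"
begin

abbreviation "Z \<equiv> weight_zero_part P E"

lemma weight_zero_part_closed: "x \<in> ocar P n p \<Longrightarrow> Z N x \<in> ocar P n p"
  by (induction N) (simp_all add: add_closed smul_closed euler_closed)

lemma weight_zero_part_add:
  assumes x: "x \<in> ocar P n p" and y: "y \<in> ocar P n p"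
  shows "Z N (oadd P x y) = oadd P (Z N x) (Z N y)"
proof (induction N)
  case (Suc N)
  let ?c = "- inverse (of_nat (Suc N)) :: 'k"
  note a = weight_zero_part_closed[OF x, of N] and b = weight_zero_part_closed[OF y, of N]
  note Ea = euler_closed[OF a] and Eb = euler_closed[OF b]
  show ?case unfolding weight_zero_part.simps Suc euler_add[OF a b] smul_add[OF Ea Eb]
    by (rule add_swap[OF a b smul_closed[OF Ea] smul_closed[OF Eb]])
qed simp

lemma weight_zero_part_eigen:
  assumes x: "x \<in> ocar P n p" and e: "E x = osmul P (of_nat w) x"
  shows "Z N x = osmul P (\<Prod>v=1..N. 1 - of_nat w * inverse (of_nat v)) x"
proof (induction N)
  case 0
  show ?case using one_smul[OF x] by simp
next
  case (Suc N)
  let ?a = "\<Prod>v=1..N. 1 - of_nat w * inverse (of_nat v) :: 'k" and ?i = "inverse (of_nat (Suc N)) :: 'k"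
  have "Z (Suc N) x = oadd P (osmul P ?a x) (osmul P (- ?i) (osmul P ?a (osmul P (of_nat w) x)))"
    unfolding weight_zero_part.simps Suc euler_smul[OF x] e ..
  also have "\<dots> = oadd P (osmul P ?a x) (osmul P (- (?a * (of_nat w * ?i))) x)"
    using smul_smul[OF x] smul_smul[OF smul_closed[OF x]] by (simp add: mult_ac)
  also have "\<dots> = osmul P (?a * (1 - of_nat w * ?i)) x"
    unfolding add_smul[OF x, symmetric] by (simp add: algebra_simps)
  finally show ?case by simp
qed

lemma weight_zero_part_eigen_0:
  "\<lbrakk>x \<in> ocar P n p; E x = osmul P (of_nat 0) x\<rbrakk> \<Longrightarrow> Z N x = x"
  using weight_zero_part_eigen[of x n p 0 N] one_smul by simp

lemma weight_zero_part_eigen_pos: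
  assumes "x \<in> ocar P n p" "E x = osmul P (of_nat w) x" "1 \<le> w" "w \<le> N"
  shows "Z N x = ozero P n p"
proof -
  have "(\<Prod>v=1..N. 1 - of_nat w * inverse (of_nat v) :: 'k) = 0"
    using assms(3,4) by (intro prod_zero) (auto intro!: bexI[of _ w])
  then show ?thesis using weight_zero_part_eigen[OF assms(1,2), of N] smul_0[OF assms(1)] by (simp only:)
qed

text \<open>On a cocycle \<open>z\<close> each factor subtracts \<open>E(z)/w = d(h(z)/w)\<close>.\<close>

lemma cocycle_cohomologous_weight_zero_part:
  assumes x: "x \<in> ocar P n p" and d: "odif P x = ozero P n (p + 1)"
  shows "odif P (Z N x) = ozero P n (p + 1) \<and> (\<exists>b\<in>ocar P n (p - 1). x = oadd P (Z N x) (odif P b))"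
proof (induction N)
  case 0
  show ?case using d add_zero[OF x] dif_zero[of n "p - 1"] zero_closed[of n "p - 1"] by force
next
  case (Suc N)
  let ?i = "inverse (of_nat (Suc N)) :: 'k" and ?z = "Z N x"
  obtain b where b: "b \<in> ocar P n (p - 1)" "x = oadd P ?z (odif P b)" using Suc by blast
  note z = weight_zero_part_closed[OF x, of N]
  have dz: "odif P ?z = ozero P n (p + 1)" using Suc by blast
  note hz = homotopy_closed[OF z]
  have dh: "odif P (h ?z) \<in> ocar P n p" and db: "odif P b \<in> ocar P n p"
    using dif_closed[OF hz] dif_closed[OF b(1)] by simp_all
  have S: "Z (Suc N) x = oadd P ?z (osmul P (- ?i) (odif P (h ?z)))"
    using euler_cocycle[OF z dz] by simp
  have "odif P (odif P (h ?z)) = ozero P n (p + 1)" using dif_dif[OF hz] by (simp add: add.commute)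
  then have 1: "odif P (Z (Suc N) x) = ozero P n (p + 1)"
    unfolding S using dif_add[OF z smul_closed[OF dh]] dif_smul[OF dh] dz
    by (simp add: smul_zero zero_add[OF zero_closed])
  let ?b = "oadd P (osmul P ?i (h ?z)) b"
  have bc: "?b \<in> ocar P n (p - 1)" by (intro add_closed smul_closed hz b)
  have "oadd P (Z (Suc N) x) (odif P ?b)
     = oadd P (oadd P ?z (osmul P (- ?i) (odif P (h ?z)))) (oadd P (osmul P ?i (odif P (h ?z))) (odif P b))"
    unfolding S dif_add[OF smul_closed[OF hz] b(1)] dif_smul[OF hz] ..
  also have "\<dots> = oadd P ?z (oadd P (oadd P (osmul P (- ?i) (odif P (h ?z))) (osmul P ?i (odif P (h ?z)))) (odif P b))"
    using add_assoc[OF z smul_closed[OF dh] add_closed[OF smul_closed[OF dh] db]]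
      add_assoc[OF smul_closed[OF dh] smul_closed[OF dh] db] by simp
  also have "oadd P (osmul P (- ?i) (odif P (h ?z))) (osmul P ?i (odif P (h ?z))) = ozero P n p"
    using add_smul[OF dh, of "- ?i" ?i] smul_0[OF dh] by simp
  also have "oadd P ?z (oadd P (ozero P n p) (odif P b)) = x"
    using b(2) zero_add[OF db] by simp
  finally show ?case using 1 bc by metis
qed

end

text \<open>
  The condition \<open>rel_homotopy\<close> says that \<open>h\<close> vanishes on the relations. Homogeneity of the
  relations gives the same for \<open>E\<close>, so the path defines a morphism on the presented operad.
\<close>

theorem cocycle_cohomologous_to_weight_zero:
  fixes X :: "('g, 'k::field_char_0) presentation" and wt :: "'g \<Rightarrow> nat"
    and S :: "nat \<Rightarrow> int \<Rightarrow> ('g, 'k) opterm set set"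
  defines "P \<equiv> presented X"
  defines "\<delta> \<equiv> dg_operad.weight_path P X wt (\<lambda>g. opclass X (Gen g))"
  assumes rel_weight: "\<And>r. r \<in> prels X \<Longrightarrow> \<exists>w. homogeneous wt r w"
    and rel_homotopy: "\<And>r n p. \<lbrakk>r \<in> prels X; typed X r n p\<rbrakk>
      \<Longrightarrow> snd (snd (snd (opeval (first_order_path P) \<delta> r))) = ozero P n (p - 1)"
    and S_weight_0: "\<And>t n p. \<lbrakk>typed X t n p; homogeneous wt t 0\<rbrakk> \<Longrightarrow> opclass X t \<in> S n p"
    and S_add: "\<And>x y n p. \<lbrakk>x \<in> S n p; y \<in> S n p\<rbrakk> \<Longrightarrow> oadd P x y \<in> S n p"
    and z: "z \<in> cocycles P n p"
  shows "\<exists>c\<in>S n p. \<exists>b\<in>ocar P n (p - 1). z = oadd P c (odif P b)"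
proof -
  interpret P: dg_operad P unfolding P_def by (rule presented_dg_operad)
  let ?Q = "first_order_path P"
  have gens: "opclass X (Gen g) \<in> ocar P (par X g) (pdeg X g)" if "g \<in> pgens X" for g
    using typed_Gen[OF that] by (auto simp: P_def presented_ops(1))
  note W = P.opeval_weight_path[where X=X and wt=wt and \<gamma>="\<lambda>g. opclass X (Gen g)", folded \<delta>_def, OF gens]
  have cls: "opeval P (\<lambda>g. opclass X (Gen g)) t = opclass X t" if "typed X t n p" for t n p
    unfolding P_def by (rule opeval_opclass[OF that])
  have "opeval ?Q \<delta> r = ozero ?Q n p" if r: "r \<in> prels X" and t: "typed X r n p" for r n p
  proof -
    obtain e h where e: "opeval ?Q \<delta> r = (opclass X r, osmul P (koszul 1 p) (opclass X r), e, h)"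
      and E: "\<And>w. homogeneous wt r w \<Longrightarrow> e = osmul P (of_nat w) (opclass X r)"
      using W[OF _ t, unfolded cls[OF t]] by metis
    have 0: "opclass X r = ozero P n p"
      using opclass_eqI[OF eqv.rel[OF r t]] by (simp add: P_def presented_ops(2))
    have "e = ozero P n p" using rel_weight[OF r] E 0 P.smul_zero by auto
    moreover have "h = ozero P n (p - 1)" using rel_homotopy[OF r t] e by simp
    ultimately show ?thesis unfolding e 0 P.path_simps by (simp add: P.smul_zero)
  qed
  moreover have "\<delta> g \<in> ocar ?Q (par X g) (pdeg X g)" if "g \<in> pgens X" for g
    unfolding \<delta>_def using gens[OF that] by (rule P.weight_path_closed)
  ultimately obtain \<Phi> where \<Phi>: "dg_operad_hom P ?Q \<Phi>" and \<Phi>g: "\<And>g. g \<in> pgens X \<Longrightarrow> \<Phi> (opclass X (Gen g)) = \<delta> g"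
    using presented_universal[OF P.first_order_path_dg_operad, of X \<delta>] unfolding P_def by metis
  interpret \<Phi>: dg_operad_hom P ?Q \<Phi> by (rule \<Phi>)
  define E h where "E x = fst (snd (snd (\<Phi> x)))" and "h x = snd (snd (snd (\<Phi> x)))" for x
  have \<Phi>t: "\<Phi> (opclass X t) = opeval ?Q \<delta> t" if "typed X t n p" for t n p
    by (rule hom_opclass[OF \<Phi>[unfolded P_def] \<Phi>g that, folded P_def])
  have \<Phi>x: "\<Phi> x = (x, osmul P (koszul 1 p) x, E x, h x)" if x: "x \<in> ocar P n p" for x n p
  proof -
    obtain t where t: "typed X t n p" "x = opclass X t" using x by (auto simp: P_def presented_ops(1))
    then show ?thesis using W[OF _ t(1), unfolded cls[OF t(1)]] \<Phi>t[OF t(1)] unfolding E_def h_def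
      by (metis fst_conv snd_conv)
  qed
  have closed: "E x \<in> ocar P n p" "h x \<in> ocar P n (p - 1)" if "x \<in> ocar P n p" for x n p
    using \<Phi>.hom_closed[OF that] \<Phi>x[OF that] by (simp_all add: P.path_simps)
  have dif: "h (odif P x) = oadd P (E x) (osmul P (-1) (odif P (h x)))" if x: "x \<in> ocar P n p" for x n p
    using \<Phi>.hom_dif[OF x] \<Phi>x[OF x] \<Phi>x[OF P.dif_closed[OF x]] by (simp add: P.path_simps)
  have hom0: "h (ozero P n p) = ozero P n (p - 1)" for n p
    using \<Phi>.hom_zero[of n p] \<Phi>x[OF P.zero_closed[of n p]] by (simp add: P.path_simps)
  interpret weight_homotopy P E h
  proof
    fix x y :: "('g, 'k) opterm set" and n p c
    assume x: "x \<in> ocar P n p"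
    show "E x \<in> ocar P n p" "h x \<in> ocar P n (p - 1)" by (rule closed[OF x])+
    show "E (oadd P x y) = oadd P (E x) (E y)" if y: "y \<in> ocar P n p"
      using \<Phi>.hom_add[OF x y] \<Phi>x[OF x] \<Phi>x[OF y] \<Phi>x[OF P.add_closed[OF x y]] by (simp add: P.path_simps)
    show "E (osmul P c x) = osmul P c (E x)"
      using \<Phi>.hom_smul[OF x] \<Phi>x[OF x] \<Phi>x[OF P.smul_closed[OF x]] by (simp add: P.path_simps)
    assume d: "odif P x = ozero P n (p + 1)"
    have dh: "odif P (h x) \<in> ocar P n p" using P.dif_closed[OF closed(2)[OF x]] by simp
    have 0: "oadd P (E x) (osmul P (-1) (odif P (h x))) = ozero P n p"
      using dif[OF x] hom0[of n "p + 1"] unfolding d by simp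
    have "E x = oadd P (E x) (oadd P (osmul P (-1) (odif P (h x))) (odif P (h x)))"
      using P.add_neg[OF dh] P.add_comm[OF dh P.smul_closed[OF dh]] P.add_zero[OF closed(1)[OF x]] by metis
    also have "\<dots> = odif P (h x)"
      using P.add_assoc[OF closed(1)[OF x] P.smul_closed[OF dh, of "-1"] dh] 0 P.zero_add[OF dh] by simp
    finally show "E x = odif P (h x)" .
  qed
  have S0: "ozero P n p \<in> S n p" for n p
    using S_weight_0[OF typed_Zero homogeneous_Zero] by (simp add: P_def presented_ops(2))
  have eigen: "E (opclass X t) = osmul P (of_nat w) (opclass X t)" if "typed X t n p" "homogeneous wt t w" for t n p w
    using W[OF _ that(1), unfolded cls[OF that(1)]] \<Phi>t[OF that(1)] that(2) unfolding E_def
    by (metis fst_conv snd_conv)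
  \<comment> \<open>The bound is from some \<open>N0\<close> on, so that the summands of a sum can share one \<open>N\<close>.\<close>
  have in_S: "\<exists>N0. \<forall>N\<ge>N0. Z N x \<in> S n p" if "homogeneous_sum X wt n p x" for n p x
    using that
  proof (induction rule: homogeneous_sum.induct)
    case (homogeneous_sum_single t n p w)
    have t: "opclass X t \<in> ocar P n p" using homogeneous_sum_single(1) by (simp add: P_def presented_ops(1))
    note e = eigen[OF homogeneous_sum_single]
    show ?case
    proof (cases "w = 0")
      case True
      then have "Z N (opclass X t) = opclass X t" for N using e weight_zero_part_eigen_0[OF t] by simp
      then show ?thesis using S_weight_0 homogeneous_sum_single True by auto
    next
      case False
      then have "Z N (opclass X t) = ozero P n p" if "N \<ge> w" for N
        using weight_zero_part_eigen_pos[OF t e _ that] by simp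
      then show ?thesis using S0[of n p] by (intro exI[of _ w]) simp
    qed
  next
    case (homogeneous_sum_add n p x y)
    then obtain M N where M: "\<forall>K\<ge>M. Z K x \<in> S n p" and N: "\<forall>K\<ge>N. Z K y \<in> S n p" by blast
    have "Z K (oadd P x y) \<in> S n p" if "K \<ge> max M N" for K
      using that M N S_add weight_zero_part_add homogeneous_sum_add(1,2)[THEN homogeneous_sum_closed, folded P_def]
      by simp
    then show ?case unfolding P_def by blast
  qed
  have zc: "z \<in> ocar P n p" "odif P z = ozero P n (p + 1)" using z by (auto simp: cocycles_def)
  then obtain t where "typed X t n p" "z = opclass X t" by (auto simp: P_def presented_ops(1))
  then obtain N where "Z N z \<in> S n p" using in_S homogeneous_sum_opclass by blast
  then show ?thesis using cocycle_cohomologous_weight_zero_part[OF zc] by blast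
qed

section \<open>The relations of the exact commutative BV-infinity operad\<close>

lemma homogeneous_tdiff: "\<lbrakk>homogeneous wt s w; homogeneous wt t w\<rbrakk> \<Longrightarrow> homogeneous wt (tdiff s t) w"
  unfolding tdiff_def by (intro homogeneous.intros)

lemma homogeneous_tsum: "(\<And>t. t \<in> set ts \<Longrightarrow> homogeneous wt t w) \<Longrightarrow> homogeneous wt (tsum n p ts) w"
  unfolding tsum_def by (induction ts) (auto intro: homogeneous.intros)

lemma homogeneous_commutator:
  assumes "homogeneous wt a v" "homogeneous wt b w"
  shows "homogeneous wt (commutator p q a b) (v + w)"
  unfolding commutator_def using homogeneous_Comp[OF assms] homogeneous_Comp[OF assms(2,1)]
  by (intro homogeneous_tdiff homogeneous_Smul) (simp_all add: add.commute)

lemma homogeneous_iter_prod: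
  assumes "homogeneous wt mu 0"
  shows "homogeneous wt (iter_prod mu m) 0"
proof -
  have "homogeneous wt (((\<lambda>t. Comp mu 1 t) ^^ k) Ident) 0" for k
    by (induction k) (use homogeneous_Ident homogeneous_Comp[OF assms, of _ 0 1] in simp_all)
  then show ?thesis by (simp add: iter_prod_def)
qed

lemma homogeneous_diff_op_rel:
  assumes "homogeneous wt mu 0" "homogeneous wt D w"
  shows "homogeneous wt (diff_op_rel mu D e n) w"
  unfolding diff_op_rel_def Let_def
  using homogeneous_Comp[OF homogeneous_iter_prod[OF assms(1)]
      homogeneous_Comp[OF assms(2) homogeneous_iter_prod[OF assms(1)]]]
  by (intro homogeneous_tsum; auto intro!: homogeneous_tsum homogeneous_Smul homogeneous_Act)

lemma dif_free_tsum: "dif_free (tsum n p ts) \<longleftrightarrow> (\<forall>t\<in>set ts. dif_free t)"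
  unfolding tsum_def by (induction ts) auto

lemma dif_free_iter_prod: "dif_free mu \<Longrightarrow> dif_free (iter_prod mu m)"
proof -
  assume "dif_free mu"
  then have "dif_free (((\<lambda>t. Comp mu 1 t) ^^ k) Ident)" for k by (induction k) simp_all
  then show ?thesis by (simp add: iter_prod_def)
qed

lemma dif_free_diff_op_rel: "\<lbrakk>dif_free mu; dif_free D\<rbrakk> \<Longrightarrow> dif_free (diff_op_rel mu D e n)"
  unfolding diff_op_rel_def Let_def by (simp add: dif_free_tsum dif_free_iter_prod)

lemma typed_tsum_unique: "typed X (tsum n p ts) m q \<Longrightarrow> m = n \<and> q = p"
  unfolding tsum_def by (induction ts) (auto simp: typed_simps)

lemma (in dg_operad) opeval_path_tsum:
  assumes "\<And>t. t \<in> set ts \<Longrightarrow> snd (snd (snd (opeval (first_order_path P) \<delta> t))) = ozero P n (p - 1)"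
  shows "snd (snd (snd (opeval (first_order_path P) \<delta> (tsum n p ts)))) = ozero P n (p - 1)"
  using assms
proof (induction ts)
  case Nil
  show ?case by (simp add: tsum_def path_simps)
next
  case (Cons t ts)
  obtain x x' e h where t: "opeval (first_order_path P) \<delta> t = (x, x', e, h)"
    by (cases "opeval (first_order_path P) \<delta> t")
  moreover have "h = ozero P n (p - 1)" using Cons.prems[of t] t by simp
  moreover obtain y y' f g where "opeval (first_order_path P) \<delta> (tsum n p ts) = (y, y', f, g)"
    by (cases "opeval (first_order_path P) \<delta> (tsum n p ts)")
  ultimately show ?case using Cons by (simp add: tsum_def path_simps add_zero[OF zero_closed])
qed

fun ecbv_weight :: "ecbv_gen \<Rightarrow> nat" where
  "ecbv_weight Mu = 0"
| "ecbv_weight (I n) = 1"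

lemma ecbv_pres_simps:
  "pgens ecbv_pres = insert Mu {I n |n. n \<ge> 1}" "par ecbv_pres Mu = 2" "par ecbv_pres (I n) = 1"
  "pdeg ecbv_pres Mu = 0" "pdeg ecbv_pres (I n) = - 2 * int n"
  by (auto simp: ecbv_pres_def)

lemma ecbv_rel_cases:
  assumes "r \<in> prels (ecbv_pres :: (ecbv_gen, 'k::field) presentation)"
  obtains (com) "r \<in> com_rels (Gen Mu)"
  | (comm) n m where "n \<ge> 1" "m \<ge> 1" "r = commutator (- 2 * int n) (- 2 * int m) (Gen (I n)) (Gen (I m))"
  | (exact) n where "n \<ge> 2" "r = tsum 1 (1 - 2 * int n)
              (map (\<lambda>j. commutator (- 2 * int j) (1 - 2 * int (n - j))
                          (Gen (I j)) (Dif (Gen (I (n - j)))))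
                 [1..<n])"
  | (order) n where "n \<ge> 1" "r = diff_op_rel (Gen Mu) (Gen (I n)) (- 2 * int n) (n + 1)"
  using assms unfolding arg_cong[OF ecbv_pres_def, of prels, unfolded presentation.simps] by blast

lemma ecbv_rel_weight:
  assumes "r \<in> prels (ecbv_pres :: (ecbv_gen, 'k::field) presentation)"
  shows "r \<in> com_rels (Gen Mu) \<and> homogeneous ecbv_weight r 0 \<or> (\<exists>w>0. homogeneous ecbv_weight r w)"
proof -
  have mu: "homogeneous ecbv_weight (Gen Mu) 0" using homogeneous_Gen[of ecbv_weight Mu] by simp
  have i: "homogeneous ecbv_weight (Gen (I n)) 1" for n using homogeneous_Gen[of ecbv_weight "I n"] by simp
  from assms show ?thesis
  proof (cases rule: ecbv_rel_cases)
    case com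
    then show ?thesis using mu homogeneous_Comp[OF mu mu]
      by (auto simp: com_rels_def intro!: homogeneous_tdiff homogeneous_Act homogeneous_Dif)
  next
    case (comm n m)
    show ?thesis unfolding comm(3) using homogeneous_commutator[OF i i] by (intro disjI2 exI[of _ "1 + 1"]) simp
  next
    case (exact n)
    show ?thesis unfolding exact(2)
      using homogeneous_commutator[OF i homogeneous_Dif[OF i]]
      by (intro disjI2 exI[of _ "1 + 1"]) (auto intro!: homogeneous_tsum)
  next
    case (order n)
    show ?thesis unfolding order(2) using homogeneous_diff_op_rel[OF mu i] by (intro disjI2 exI[of _ 1]) simp
  qed
qed

text \<open>
  The only two kinds of relations that contain a differential are \<open>d(\<mu>)\<close> and \<open>\<Sum> [i\<^sub>j, d(i\<^bsub>n-j\<^esub>)]\<close>;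
  on the second one \<open>h\<close> takes the value \<open>\<Sum> [i\<^sub>j, i\<^bsub>n-j\<^esub>]\<close>, which is zero by another relation.
\<close>

lemma ecbv_rel_homotopy:
  fixes r :: "(ecbv_gen, 'k::field) opterm"
  defines "P \<equiv> ECBV :: 'k ecbv_operad"
  defines "\<delta> \<equiv> dg_operad.weight_path P ecbv_pres ecbv_weight (\<lambda>g. opclass ecbv_pres (Gen g))"
  assumes r: "r \<in> prels ecbv_pres" and t: "typed ecbv_pres r n p"
  shows "snd (snd (snd (opeval (first_order_path P) \<delta> r))) = ozero P n (p - 1)"
proof -
  interpret P: dg_operad P unfolding P_def ECBV_def by (rule presented_dg_operad)
  interpret Q: dg_operad "first_order_path P" by (rule P.first_order_path_dg_operad)
  let ?X = "ecbv_pres :: (ecbv_gen, 'k) presentation" and ?Q = "first_order_path P"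
  let ?\<gamma> = "\<lambda>g. opclass ?X (Gen g)"
  let ?V = "opeval ?Q \<delta>"
  have gens: "?\<gamma> g \<in> ocar P (par ?X g) (pdeg ?X g)" if "g \<in> pgens ?X" for g
    using typed_Gen[OF that] by (auto simp: P_def ECBV_def presented_ops(1))
  note W = P.opeval_weight_path[where X="?X" and wt=ecbv_weight and \<gamma>="?\<gamma>", folded \<delta>_def, OF gens]
  have free: ?thesis if "dif_free r"
    using W[OF _ t] that by (metis snd_conv)
  define i where "i n = opclass ?X (Gen (I n))" for n
  have ic: "i n \<in> ocar P 1 (- 2 * int n)" if "n \<ge> 1" for n
    using gens[of "I n"] that by (auto simp: ecbv_pres_simps i_def)
  have \<delta>I: "\<delta> (I n) = (i n, osmul P (koszul 1 (-2 * int n)) (i n), i n, ozero P 1 (- 2 * int n - 1))" if "n \<ge> 1" for n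
    using P.one_smul[OF ic[OF that]] by (simp add: \<delta>_def P.weight_path_def ecbv_pres_simps i_def)
  from r show ?thesis
  proof (cases rule: ecbv_rel_cases)
    case com
    have "?thesis" if "r = Dif (Gen Mu)"
    proof -
      have np: "n = 2" "p = 1" using t unfolding that by (auto simp: typed_simps ecbv_pres_simps)
      have "?\<gamma> Mu \<in> ocar P 2 0" using gens[of Mu] by (simp add: ecbv_pres_simps)
      then show ?thesis unfolding that np
        by (simp add: \<delta>_def P.weight_path_def P.path_simps ecbv_pres_simps P.smul_0 P.dif_zero[of 2 "-1", simplified]
            P.smul_zero P.add_zero[OF P.zero_closed])
    qed
    moreover have "r = Dif (Gen Mu) \<or> dif_free r" using com by (auto simp: com_rels_def tdiff_def)
    ultimately show ?thesis using free by blast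
  next
    case (comm n m)
    then show ?thesis by (intro free) (simp add: commutator_def tdiff_def)
  next
    case (order n)
    then show ?thesis by (intro free) (simp add: dif_free_diff_op_rel)
  next
    case (exact N)
    have np: "n = 1" "p = 1 - 2 * int N" using typed_tsum_unique[OF t[unfolded exact(2)]] by simp_all
    have C: "snd (snd (snd (?V (commutator (- 2 * int j) (1 - 2 * int k) (Gen (I j)) (Dif (Gen (I k)))))))
       = ozero P 1 (- 2 * int (j + k))" if j: "j \<ge> 1" and k: "k \<ge> 1" for j k
    proof -
      let ?a = "i j" and ?b = "i k"
      note a = ic[OF j] and b = ic[OF k]
      let ?r = "commutator (- 2 * int j) (- 2 * int k) (Gen (I j)) (Gen (I k)) :: (ecbv_gen, 'k) opterm"
      have tr: "typed ?X ?r 1 (- 2 * int j + - 2 * int k)"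
        using typed_Gen[of "I j" ?X] typed_Gen[of "I k" ?X] j k
        by (intro typed_commutator) (simp_all add: ecbv_pres_simps)
      have "?r \<in> prels ?X" using j k unfolding ecbv_pres_def by auto
      then have "opclass ?X ?r = ozero P 1 (- 2 * int j + - 2 * int k)"
        using opclass_eqI[OF eqv.rel[OF _ tr]] by (simp add: P_def ECBV_def presented_ops(2))
      moreover have "opclass ?X ?r = opeval P ?\<gamma> ?r"
        using opeval_opclass[OF tr] by (simp add: P_def ECBV_def)
      ultimately have comm: "oadd P (ocomp P ?a 1 ?b) (osmul P (-1) (ocomp P ?b 1 ?a)) = ozero P 1 (- 2 * int (j + k))"
        using P.one_smul[OF P.comp_closed[OF b a, of 1]]
        by (simp add: commutator_def tdiff_def koszul_def i_def algebra_simps)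
      have Va: "?V (Gen (I j)) = (?a, ?a, ?a, ozero P 1 (- 2 * int j - 1))"
        using \<delta>I[OF j] P.one_smul[OF a] by (simp add: koszul_def)
      have db: "odif P ?b \<in> ocar P 1 (1 - 2 * int k)" using P.dif_closed[OF b] by (simp add: algebra_simps)
      have d0: "odif P (ozero P 1 (- 2 * int k - 1)) = ozero P 1 (- 2 * int k)"
        using P.dif_zero[of 1 "- 2 * int k - 1"] by simp
      have Vb: "?V (Dif (Gen (I k))) = (odif P ?b, osmul P (-1) (odif P ?b), odif P ?b, ?b)"
        using \<delta>I[OF k] P.one_smul[OF b] P.add_zero[OF b] d0
        by (simp add: koszul_def P.path_simps P.smul_zero)
      have 1: "P.leibniz ?a (ozero P 1 (- 2 * int j - 1)) 1 (odif P ?b) ?b = ocomp P ?a 1 ?b"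
        by (rule P.leibniz_zero_left[OF b db a]) simp_all
      have 2: "P.leibniz (osmul P (-1) (odif P ?b)) ?b 1 ?a (ozero P 1 (- 2 * int j - 1)) = ocomp P ?b 1 ?a"
        by (rule P.leibniz_zero_right[OF b a P.smul_closed[OF db]]) simp_all
      show ?thesis
        using comm P.one_smul[OF P.comp_closed[OF b a, of 1]]
        by (simp only: commutator_def tdiff_def opeval.simps Va[unfolded opeval.simps] Vb[unfolded opeval.simps] P.path_simps 1 2 snd_conv)
          (simp add: koszul_def)
    qed
    have "snd (snd (snd (?V s))) = ozero P 1 (1 - 2 * int N - 1)"
      if "s \<in> set (map (\<lambda>j. commutator (- 2 * int j) (1 - 2 * int (N - j))
                          (Gen (I j)) (Dif (Gen (I (N - j))))) [1..<N])" for s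
    proof -
      from that obtain j where "1 \<le> j" "j < N"
        "s = commutator (- 2 * int j) (1 - 2 * int (N - j)) (Gen (I j)) (Dif (Gen (I (N - j))))" by auto
      then show ?thesis using C[of j "N - j"] by simp
    qed
    then show ?thesis unfolding exact(2) np by (rule P.opeval_path_tsum)
  qed
qed

section \<open>The commutative operad inside the exact commutative BV-infinity operad\<close>

text \<open>
  An expression of weight 0 can contain \<open>I n\<close> only by way of a subexpression of positive weight,
  and weights are natural numbers that add up; so it is literally an expression in \<open>Mu\<close>.
\<close>

lemma weight_0_from_com:
  assumes "typed (ecbv_pres :: (ecbv_gen, 'k::field) presentation) t n p" "homogeneous ecbv_weight t 0"
  shows "\<exists>s. typed (com_pres :: (com_gen, 'k) presentation) s n p \<and> t = map_opterm (\<lambda>_. Mu) id s"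
  using assms
proof (induction rule: typed.induct)
  case (typed_Gen g)
  then have "g = Mu" by (cases g) (auto simp: homogeneous_simps)
  moreover have "typed (com_pres :: (com_gen, 'k) presentation) (Gen ComMu) 2 0"
    using typed.typed_Gen[of ComMu "com_pres :: (com_gen, 'k) presentation"] by (simp add: com_pres_def)
  ultimately show ?case by (intro exI[of _ "Gen ComMu"]) (simp add: ecbv_pres_simps id_def)
next
  case (typed_Zero n p)
  then show ?case by (intro exI[of _ "Zero n p"]) (simp add: typed_simps id_def)
next
  case (typed_Add s n p t)
  have "homogeneous ecbv_weight s 0" "homogeneous ecbv_weight t 0"
    using typed_Add.prems by (simp_all add: homogeneous_simps)
  with typed_Add.IH obtain s' t' where "typed (com_pres :: (com_gen, 'k) presentation) s' n p" "s = map_opterm (\<lambda>_. Mu) id s'"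
    "typed (com_pres :: (com_gen, 'k) presentation) t' n p" "t = map_opterm (\<lambda>_. Mu) id t'"
    by blast
  then show ?case by (intro exI[of _ "Add s' t'"]) (simp add: typed_simps id_def)
next
  case (typed_Smul t n p c)
  have "homogeneous ecbv_weight t 0" using typed_Smul.prems by (simp add: homogeneous_simps)
  with typed_Smul.IH obtain t' where "typed (com_pres :: (com_gen, 'k) presentation) t' n p" "t = map_opterm (\<lambda>_. Mu) id t'"
    by blast
  then show ?case by (intro exI[of _ "Smul c t'"]) (simp add: typed_simps id_def)
next
  case typed_Ident
  then show ?case by (intro exI[of _ Ident]) (simp add: typed_simps id_def)
next
  case (typed_Comp s m p t n q i)
  have "homogeneous ecbv_weight s 0" "homogeneous ecbv_weight t 0"
    using typed_Comp.prems by (simp_all add: homogeneous_simps)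
  with typed_Comp.IH obtain s' t' where "typed (com_pres :: (com_gen, 'k) presentation) s' m p" "s = map_opterm (\<lambda>_. Mu) id s'"
    "typed (com_pres :: (com_gen, 'k) presentation) t' n q" "t = map_opterm (\<lambda>_. Mu) id t'"
    by blast
  then show ?case using typed_Comp(3,4) by (intro exI[of _ "Comp s' i t'"]) (auto intro: typed.typed_Comp simp: id_def simp del: One_nat_def)
next
  case (typed_Act t n p \<sigma>)
  have "homogeneous ecbv_weight t 0" using typed_Act.prems by (simp add: homogeneous_simps)
  with typed_Act.IH obtain t' where "typed (com_pres :: (com_gen, 'k) presentation) t' n p" "t = map_opterm (\<lambda>_. Mu) id t'"
    by blast
  then show ?case using typed_Act(2) by (intro exI[of _ "Act t' \<sigma>"]) (simp add: typed_simps id_def)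
next
  case (typed_Dif t n p)
  have "homogeneous ecbv_weight t 0" using typed_Dif.prems by (simp add: homogeneous_simps)
  with typed_Dif.IH obtain t' where "typed (com_pres :: (com_gen, 'k) presentation) t' n p" "t = map_opterm (\<lambda>_. Mu) id t'"
    by blast
  then show ?case by (intro exI[of _ "Dif t'"]) (simp add: typed_simps id_def)
qed

lemma opeval_map_opterm: "opeval Q \<gamma> (map_opterm f id t) = opeval Q (\<gamma> \<circ> f) t"
  by (induction t) simp_all

lemma (in dg_operad) opeval_positive_weight:
  assumes gens: "\<And>g. g \<in> pgens X \<Longrightarrow> \<gamma> g \<in> ocar P (par X g) (pdeg X g)"
    and zero: "\<And>g. \<lbrakk>g \<in> pgens X; wt g > 0\<rbrakk> \<Longrightarrow> \<gamma> g = ozero P (par X g) (pdeg X g)"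
    and t: "typed X t n p" "homogeneous wt t w" "w > 0"
  shows "opeval P \<gamma> t = ozero P n p"
proof -
  have C: "opeval P \<gamma> t \<in> ocar P n p" if "typed X t n p" for t n p
    using that by (rule opeval_closed[rotated]) (rule gens)
  from t show ?thesis
  proof (induction arbitrary: w rule: typed.induct)
    case (typed_Comp s m p t n q i)
    then obtain u v where uv: "homogeneous wt s u" "homogeneous wt t v" "u > 0 \<or> v > 0"
      by (auto simp: homogeneous_simps)
    note c = C[OF typed_Comp(1)] C[OF typed_Comp(2)]
    show ?case
      using uv typed_Comp.IH comp_zero_left[OF c(2) typed_Comp(3,4), of p] comp_zero_right[OF c(1) typed_Comp(3,4), of n q]
      by (auto simp del: One_nat_def)
  qed (auto simp: homogeneous_simps zero add_zero[OF zero_closed] smul_zero act_zero dif_zero)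
qed

lemma dg_operad_hom_cong:
  assumes "dg_operad_hom P Q \<phi>" and eq: "\<And>x n p. x \<in> ocar P n p \<Longrightarrow> \<psi> x = \<phi> x"
  shows "dg_operad_hom P Q \<psi>"
proof -
  interpret \<phi>: dg_operad_hom P Q \<phi> by fact
  show ?thesis
  proof
    fix x y n m p q c i \<sigma>
    show "\<psi> x \<in> ocar Q n p" if "x \<in> ocar P n p" using that \<phi>.hom_closed eq by simp
    show "\<psi> (oadd P x y) = oadd Q (\<psi> x) (\<psi> y)" if "x \<in> ocar P n p" "y \<in> ocar P n p"
      using that \<phi>.hom_add eq \<phi>.P.add_closed by metis
    show "\<psi> (osmul P c x) = osmul Q c (\<psi> x)" if "x \<in> ocar P n p"
      using that \<phi>.hom_smul eq \<phi>.P.smul_closed by metis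
    show "\<psi> (oone P) = oone Q" using \<phi>.hom_one eq \<phi>.P.one_closed by metis
    show "\<psi> (ocomp P x i y) = ocomp Q (\<psi> x) i (\<psi> y)" if "x \<in> ocar P m p" "y \<in> ocar P n q" "1 \<le> i" "i \<le> m"
      using that \<phi>.hom_comp eq \<phi>.P.comp_closed by metis
    show "\<psi> (oact P x \<sigma>) = oact Q (\<psi> x) \<sigma>" if "x \<in> ocar P n p" "\<sigma> permutes {1..n}"
      using that \<phi>.hom_act eq \<phi>.P.act_closed by metis
    show "\<psi> (odif P x) = odif Q (\<psi> x)" if "x \<in> ocar P n p"
      using that \<phi>.hom_dif eq \<phi>.P.dif_closed by metis
  qed
qed

abbreviation com_to_ecbv :: "(com_gen, 'k::field) opterm \<Rightarrow> (ecbv_gen, 'k) opterm" where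
  "com_to_ecbv \<equiv> map_opterm (\<lambda>_. Mu) id"

lemma com_pres_simps:
  "pgens com_pres = {ComMu}" "par com_pres g = 2" "pdeg com_pres g = 0" "prels com_pres = com_rels (Gen ComMu)"
  by (auto simp: com_pres_def)

lemma typed_com_to_ecbv: "typed com_pres t n p \<Longrightarrow> typed ecbv_pres (com_to_ecbv t) n p"
proof (induction rule: typed.induct)
  case (typed_Gen g)
  have "typed ecbv_pres (Gen Mu) 2 0" using typed.typed_Gen[of Mu ecbv_pres] by (simp add: ecbv_pres_simps)
  then show ?case by (simp add: com_pres_simps)
qed (auto intro: typed.intros simp del: One_nat_def)

lemma com_rels_com_to_ecbv: "com_rels (Gen Mu) = com_to_ecbv ` com_rels (Gen ComMu)"
  by (simp add: com_rels_def tdiff_def)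

lemma ecbv_mu_closed: "ecbv_mu \<in> ocar ECBV 2 0"
  using typed_Gen[of Mu ecbv_pres] by (auto simp: ecbv_mu_def ECBV_def presented_ops(1) ecbv_pres_simps)

lemma opeval_ecbv_mu:
  assumes "typed com_pres t n p"
  shows "opeval ECBV (\<lambda>_. ecbv_mu) t = opclass ecbv_pres (com_to_ecbv t)"
  using opeval_opclass[OF typed_com_to_ecbv[OF assms]]
  by (simp add: opeval_map_opterm ECBV_def ecbv_mu_def comp_def)

lemma ecbv_mu_com_rels:
  assumes r: "r \<in> prels com_pres" and t: "typed com_pres r n p"
  shows "opeval ECBV (\<lambda>_. ecbv_mu) r = ozero ECBV n p"
proof -
  have "com_to_ecbv r \<in> prels ecbv_pres"
    using r com_rels_com_to_ecbv by (auto simp: com_pres_simps ecbv_pres_def)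
  then show ?thesis
    using opclass_eqI[OF eqv.rel[OF _ typed_com_to_ecbv[OF t]]] opeval_ecbv_mu[OF t]
    by (simp add: ECBV_def presented_ops(2))
qed

lemma com_incl_opclass:
  fixes t :: "(com_gen, 'k::field) opterm"
  assumes t: "typed com_pres t n p"
  shows "com_incl (opclass com_pres t) = opclass ecbv_pres (com_to_ecbv t)"
proof -
  interpret E: dg_operad "ECBV :: 'k ecbv_operad" unfolding ECBV_def by (rule presented_dg_operad)
  have "opclass ecbv_pres (com_to_ecbv s) = opclass ecbv_pres (com_to_ecbv t)" if "s \<in> opclass com_pres t" for s
  proof -
    have e: "eqv com_pres t s" using that by (simp add: opclass_def)
    have "opeval ECBV (\<lambda>_. ecbv_mu) t = opeval ECBV (\<lambda>_. ecbv_mu) s"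
      by (rule E.opeval_eqv[OF _ ecbv_mu_com_rels e]) (simp_all add: com_pres_simps ecbv_mu_closed)
    moreover have "typed com_pres s n p" using eqv_typed_iff[OF e] t by blast
    ultimately show ?thesis using opeval_ecbv_mu t by metis
  qed
  moreover have "t \<in> opclass com_pres t" using t by (simp add: opclass_def eqv.refl)
  ultimately show ?thesis unfolding com_incl_def by blast
qed

lemma com_incl_hom: "dg_operad_hom (Com :: 'k::field com_operad) ECBV com_incl"
proof -
  have gens: "ecbv_mu \<in> ocar (ECBV :: 'k ecbv_operad) (par com_pres g) (pdeg com_pres g)"
    if "g \<in> pgens (com_pres :: (com_gen, 'k) presentation)" for g
    using ecbv_mu_closed by (simp add: com_pres_simps)
  have "\<exists>\<phi>. dg_operad_hom (Com :: 'k com_operad) (ECBV :: 'k ecbv_operad) \<phi> \<and>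
      (\<forall>g\<in>pgens (com_pres :: (com_gen, 'k) presentation). \<phi> (opclass com_pres (Gen g)) = ecbv_mu)"
    unfolding Com_def
    by (rule presented_hom_exists[where \<gamma>="\<lambda>_. ecbv_mu"])
      (simp_all add: presented_dg_operad[of ecbv_pres, folded ECBV_def] gens ecbv_mu_com_rels)
  then obtain \<phi> :: "(com_gen, 'k) opterm set \<Rightarrow> (ecbv_gen, 'k) opterm set"
    where \<phi>: "dg_operad_hom Com ECBV \<phi>" "\<And>g. g \<in> pgens (com_pres :: (com_gen, 'k) presentation)
        \<Longrightarrow> \<phi> (opclass com_pres (Gen g)) = ecbv_mu"
    by blast
  show ?thesis
  proof (rule dg_operad_hom_cong[OF \<phi>(1)])
    fix x :: "(com_gen, 'k) opterm set" and n p assume "x \<in> ocar Com n p"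
    then obtain t where t: "typed com_pres t n p" "x = opclass com_pres t" by (auto simp: Com_def presented_ops(1))
    have "\<phi> x = opeval ECBV (\<lambda>_. ecbv_mu) t"
      unfolding t(2) by (rule hom_opclass[OF \<phi>(1)[unfolded Com_def] \<phi>(2) t(1)])
    then show "com_incl x = \<phi> x" using t(2) com_incl_opclass[OF t(1)] opeval_ecbv_mu[OF t(1)] by simp
  qed
qed

lemma com_incl_mu: "com_incl com_mu = ecbv_mu"
  using com_incl_opclass[OF typed_Gen[of ComMu com_pres]]
  by (simp add: com_mu_def ecbv_mu_def com_pres_simps)

text \<open>
  Sending every \<open>I n\<close> to zero respects the relations: those of \<open>Mu\<close> hold in \<open>Com\<close>, and all others
  have positive weight.
\<close>

lemma ecbv_retraction:
  obtains \<rho> where "dg_operad_hom (ECBV :: 'k::field ecbv_operad) Com \<rho>"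
    "\<And>n p x. x \<in> ocar Com n p \<Longrightarrow> \<rho> (com_incl x) = x"
proof -
  interpret C: dg_operad "Com :: 'k com_operad" unfolding Com_def by (rule presented_dg_operad)
  let ?X = "ecbv_pres :: (ecbv_gen, 'k) presentation"
  define \<gamma> :: "ecbv_gen \<Rightarrow> (com_gen, 'k) opterm set" where
    "\<gamma> g = (case g of Mu \<Rightarrow> com_mu | I n \<Rightarrow> ozero Com 1 (- 2 * int n))" for g
  have mu: "com_mu \<in> ocar (Com :: 'k com_operad) 2 0"
    using typed_Gen[of ComMu "com_pres :: (com_gen, 'k) presentation"]
    by (auto simp: com_mu_def Com_def presented_ops(1) com_pres_simps)
  have gens: "\<gamma> g \<in> ocar Com (par ?X g) (pdeg ?X g)" if "g \<in> pgens ?X" for g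
    using mu C.zero_closed by (cases g) (auto simp: \<gamma>_def ecbv_pres_simps)
  have ev: "opeval Com \<gamma> (com_to_ecbv t) = opclass com_pres t" if "typed com_pres t n p" for t n p
  proof -
    have "\<gamma> \<circ> (\<lambda>_. Mu) = (\<lambda>g. opclass com_pres (Gen g))"
      by (rule ext, rename_tac g, case_tac g) (simp add: \<gamma>_def com_mu_def)
    then show ?thesis using opeval_opclass[OF that] by (simp add: opeval_map_opterm Com_def)
  qed
  have rels: "opeval Com \<gamma> r = ozero Com n p" if r: "r \<in> prels ?X" and t: "typed ?X r n p" for r n p
    using ecbv_rel_weight[OF r]
  proof (elim disjE conjE exE)
    assume "r \<in> com_rels (Gen Mu)"
    then obtain s where s: "s \<in> prels com_pres" "r = com_to_ecbv s"
      unfolding com_rels_com_to_ecbv com_pres_simps by blast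
    obtain m q where ts: "typed com_pres s m q" using com_pres_rels_typed[OF s(1)] by blast
    have "m = n" "q = p" using typed_unique[OF t] typed_com_to_ecbv[OF ts] s(2) by auto
    then show ?thesis using ev[OF ts] s(2) opclass_eqI[OF eqv.rel[OF s(1) ts]] by (simp add: Com_def presented_ops(2))
  next
    fix w assume "w > 0" "homogeneous ecbv_weight r w"
    then show ?thesis using t
      by (intro C.opeval_positive_weight[where X="?X" and wt=ecbv_weight and w=w])
        (use gens in \<open>auto simp: \<gamma>_def ecbv_pres_simps\<close>)
  qed
  have "\<exists>\<rho>. dg_operad_hom (ECBV :: 'k ecbv_operad) Com \<rho> \<and> (\<forall>g\<in>pgens ?X. \<rho> (opclass ?X (Gen g)) = \<gamma> g)"
    unfolding ECBV_def by (rule presented_hom_exists) (fact C.dg_operad_axioms gens rels)+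
  then obtain \<rho> where \<rho>: "dg_operad_hom (ECBV :: 'k ecbv_operad) Com \<rho>"
    "\<And>g. g \<in> pgens ?X \<Longrightarrow> \<rho> (opclass ?X (Gen g)) = \<gamma> g"
    by blast
  have "\<rho> (com_incl x) = x" if x: "x \<in> ocar Com n p" for n p x
  proof -
    obtain t where t: "typed com_pres t n p" "x = opclass com_pres t"
      using x by (auto simp: Com_def presented_ops(1))
    then show ?thesis
      using hom_opclass[OF \<rho>(1)[unfolded ECBV_def] \<rho>(2) typed_com_to_ecbv[OF t(1)]]
        com_incl_opclass[OF t(1)] ev[OF t(1)] by simp
  qed
  then show thesis by (rule that[OF \<rho>(1)])
qed

theorem theorem6p10:
  shows "dg_operad_hom (Com :: 'k::field_char_0 com_operad) (ECBV :: 'k ecbv_operad) com_incl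
    \<and> com_incl (com_mu :: (com_gen, 'k) opterm set) = ecbv_mu
    \<and> (\<forall>n p. inj_on com_incl (ocar (Com :: 'k com_operad) n p))
    \<and> quasi_iso (Com :: 'k com_operad) (ECBV :: 'k ecbv_operad) com_incl"
proof (intro conjI allI)
  interpret incl: dg_operad_hom "Com :: 'k com_operad" ECBV com_incl by (rule com_incl_hom)
  obtain \<rho> where \<rho>: "dg_operad_hom (ECBV :: 'k ecbv_operad) Com \<rho>"
    and retr: "\<And>n p x. x \<in> ocar Com n p \<Longrightarrow> \<rho> (com_incl x) = x"
    by (rule ecbv_retraction) (rule that)
  show "dg_operad_hom (Com :: 'k com_operad) ECBV com_incl" by (rule com_incl_hom)
  show "com_incl (com_mu :: (com_gen, 'k) opterm set) = ecbv_mu" by (rule com_incl_mu)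
  show "inj_on com_incl (ocar (Com :: 'k com_operad) n p)" for n p
    by (rule inj_on_inverseI[of _ \<rho>]) (rule retr)
  show "quasi_iso (Com :: 'k com_operad) (ECBV :: 'k ecbv_operad) com_incl"
  proof (rule quasi_iso_if_retraction[OF com_incl_hom \<rho> retr])
    fix n p and z :: "(ecbv_gen, 'k) opterm set"
    assume z: "z \<in> cocycles ECBV n p"
    have "\<exists>c\<in>com_incl ` ocar Com n p. \<exists>b\<in>ocar ECBV n (p - 1). z = oadd ECBV c (odif ECBV b)"
      unfolding ECBV_def
    proof (rule cocycle_cohomologous_to_weight_zero)
      show "\<exists>w. homogeneous ecbv_weight r w" if "r \<in> prels ecbv_pres" for r :: "(ecbv_gen, 'k) opterm"
        using ecbv_rel_weight[OF that] by blast
      show "snd (snd (snd (opeval (first_order_path (presented ecbv_pres))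
            (dg_operad.weight_path (presented ecbv_pres) ecbv_pres ecbv_weight (\<lambda>g. opclass ecbv_pres (Gen g))) r)))
          = ozero (presented ecbv_pres) n (p - 1)"
        if "r \<in> prels ecbv_pres" "typed ecbv_pres r n p" for r :: "(ecbv_gen, 'k) opterm" and n p
        using ecbv_rel_homotopy[OF that] by (simp add: ECBV_def)
      show "opclass ecbv_pres t \<in> com_incl ` ocar Com n p"
        if t: "typed ecbv_pres t n p" "homogeneous ecbv_weight t 0" for t :: "(ecbv_gen, 'k) opterm" and n p
      proof -
        obtain s where s: "typed (com_pres :: (com_gen, 'k) presentation) s n p" "t = com_to_ecbv s"
          using weight_0_from_com[OF t] by blast
        then show ?thesis using com_incl_opclass[OF s(1)] by (auto simp: Com_def presented_ops(1))
      qed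
      show "oadd (presented ecbv_pres) x y \<in> com_incl ` ocar Com n p"
        if "x \<in> com_incl ` ocar Com n p" "y \<in> com_incl ` ocar Com n p" for x y :: "(ecbv_gen, 'k) opterm set" and n p
        using that incl.P.add_closed unfolding ECBV_def[symmetric] by (auto simp: incl.hom_add[symmetric])
      show "z \<in> cocycles (presented ecbv_pres) n p" using z by (simp add: ECBV_def)
    qed
    then show "\<exists>c\<in>ocar Com n p. \<exists>b\<in>ocar ECBV n (p - 1). z = oadd ECBV (com_incl c) (odif ECBV b)" by blast
  qed
qed

end
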